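(* Let $\Psi:\mathsf{Map}\to\mathsf{Cat}$, $(\mathcal U,\mathfrak a)\mapsto\mathcal U$, and endow $\mathsf{Cat}$ with the pretopology of $n$-covers for some $n\in\mathbb N\cup\{\infty\}$. The pseudofunctor $\mathsf{Map}':\mathsf{Cat}^{op}\to\mathsf{Cat}$ associated to $\Psi$ (with the choice of cartesian morphisms $(\varphi,\delta^{\varphi,\mathfrak a}):(\mathcal V,\mathfrak a^\varphi)\to(\mathcal U,\mathfrak a)$) is a functor. Moreover: (1) If $n\ge2$, then $\mathsf{Map}'$ is a prestack. (2) If $n\ge3$, then $\mathsf{Map}'$ is a stack.
   Context: Fix a commutative ring $k$. For a small category $\mathcal U$, a ($k$-linear) $\mathcal U$-graded category $\mathfrak a$ consists of a set $\mathfrak a_U$ for each object $U$; a $k$-module $\mathfrak a_u(A,A')$ for each $u:U\to U'$, $A\in\mathfrak a_U$, $A'\in\mathfrak a_{U'}$; compositions $\mathfrak a_{u'}(A',A'')\otimes_k\mathfrak a_u(A,A')\to\mathfrak a_{u'u}(A,A'')$ and identities $1_A\in\mathfrak a_{1_U}(A,A)$, associative and unital. A graded functor $(\varphi,F):(\mathcal V,\mathfrak b)\to(\mathcal U,\mathfrak a)$ is a functor $\varphi:\mathcal V\to\mathcal U$ with maps $\mathfrak b_V\to\mathfrak a_{\varphi(V)}$ and $k$-linear maps $\mathfrak b_v(B,B')\to\mathfrak a_{\varphi(v)}(F(B),F(B'))$ respecting compositions and identities. $\mathsf{Map}$ is the category of pairs $(\mathcal U,\mathfrak a)$ and graded functors.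 For $\varphi:\mathcal V\to\mathcal U$, $\mathfrak a^\varphi$ is the $\mathcal V$-graded category with $\mathfrak a^\varphi_V=\mathfrak a_{\varphi(V)}$, $\mathfrak a^\varphi_v(A,A')=\mathfrak a_{\varphi(v)}(A,A')$, and $\delta^{\varphi,\mathfrak a}$ is given by identities. The associated pseudofunctor sends $\mathcal U$ to the category $\mathsf{Map}'(\mathcal U)$ of $\mathcal U$-graded categories and graded functors over $1_{\mathcal U}$, and $\varphi$ to $\mathfrak a\mapsto\mathfrak a^\varphi$. A collection of functors $(\varphi_i:\mathcal V_i\to\mathcal U)_{i\in I}$ is an $n$-cover if for all $m\in\mathbb N$ with $m\le n$ the maps $\mathcal N_m(\varphi_i):\mathcal N_m(\mathcal V_i)\to\mathcal N_m(\mathcal U)$ on $m$-simplices of the nerves are jointly surjective. For a cover $\mathcal S=(\varphi_i:\mathcal V_i\to\mathcal U)_i$, the descent category $\mathrm{Des}(\mathcal S,\mathsf{Map}')$ has as objects families $\mathfrak b_i\in\mathsf{Map}'(\mathcal V_i)$ with isomorphisms between the restrictions of $\mathfrak b_i$ and $\mathfrak b_j$ to $\mathcal V_i\times_{\mathcal U}\mathcal V_j$ (for all $i,j$) satisfying the cocycle condition on triple fibre products, and as morphisms compatible families of morphisms in the $\mathsf{Map}'(\mathcal V_i)$. $\mathsf{Map}'$ is a prestack (resp. stack) if for every cover the comparison functor $\mathsf{Map}'(\mathcal U)\to\mathrm{Des}(\mathcal S,\mathsf{Map}')$, $\mathfrak a\mapsto(\mathfrak a^{\varphi_i})_i$, is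 fully faithful (resp. an equivalence). *)

theory Defs
  imports "HOL-Algebra.Module" "HOL-Library.Extended_Nat"
begin

section \<open>Categories and functors\<close>

text \<open>
  All maps that are subject to equality tests (functors, graded functors, families) are
  extensional, that is, \<^const>\<open>undefined\<close> outside their domain; so HOL equality of them
  is the mathematical equality.
\<close>

record ('o, 'a) cat =
  Obj :: "'o set"
  Arr :: "'a set"
  Dom :: "'a \<Rightarrow> 'o"
  Cod :: "'a \<Rightarrow> 'o"
  Ident :: "'o \<Rightarrow> 'a"
  Cmp :: "'a \<Rightarrow> 'a \<Rightarrow> 'a"  \<comment> \<open>\<open>Cmp C g f\<close> is \<open>g\<close> after \<open>f\<close>\<close>

locale category =
  fixes C :: "('o, 'a) cat"
  assumes Dom_closed: "f \<in> Arr C \<Longrightarrow> Dom C f \<in> Obj C"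
    and Cod_closed: "f \<in> Arr C \<Longrightarrow> Cod C f \<in> Obj C"
    and Ident_closed: "X \<in> Obj C \<Longrightarrow> Ident C X \<in> Arr C"
    and Dom_Ident: "X \<in> Obj C \<Longrightarrow> Dom C (Ident C X) = X"
    and Cod_Ident: "X \<in> Obj C \<Longrightarrow> Cod C (Ident C X) = X"
    and Cmp_closed: "\<lbrakk>f \<in> Arr C; g \<in> Arr C; Dom C g = Cod C f\<rbrakk> \<Longrightarrow> Cmp C g f \<in> Arr C"
    and Dom_Cmp: "\<lbrakk>f \<in> Arr C; g \<in> Arr C; Dom C g = Cod C f\<rbrakk> \<Longrightarrow> Dom C (Cmp C g f) = Dom C f"
    and Cod_Cmp: "\<lbrakk>f \<in> Arr C; g \<in> Arr C; Dom C g = Cod C f\<rbrakk> \<Longrightarrow> Cod C (Cmp C g f) = Cod C g"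
    and Cmp_Ident_right: "f \<in> Arr C \<Longrightarrow> Cmp C f (Ident C (Dom C f)) = f"
    and Cmp_Ident_left: "f \<in> Arr C \<Longrightarrow> Cmp C (Ident C (Cod C f)) f = f"
    and Cmp_assoc: "\<lbrakk>f \<in> Arr C; g \<in> Arr C; h \<in> Arr C; Dom C g = Cod C f; Dom C h = Cod C g\<rbrakk>
      \<Longrightarrow> Cmp C h (Cmp C g f) = Cmp C (Cmp C h g) f"

definition arrows :: "('o, 'a) cat \<Rightarrow> 'o \<Rightarrow> 'o \<Rightarrow> 'a set" where
  "arrows C X Y = {f \<in> Arr C. Dom C f = X \<and> Cod C f = Y}"

definition iso_arr :: "('o, 'a) cat \<Rightarrow> 'a \<Rightarrow> bool" where
  "iso_arr C f \<longleftrightarrow> f \<in> Arr C \<and>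
     (\<exists>g \<in> arrows C (Cod C f) (Dom C f).
        Cmp C g f = Ident C (Dom C f) \<and> Cmp C f g = Ident C (Cod C f))"

record ('o, 'a, 'p, 'b) func =
  fob :: "'o \<Rightarrow> 'p"
  farr :: "'a \<Rightarrow> 'b"

locale cat_functor = C: category C + D: category D
  for C :: "('o, 'a) cat" and D :: "('p, 'b) cat" +
  fixes F :: "('o, 'a, 'p, 'b) func"
  assumes fob_ext: "fob F \<in> Obj C \<rightarrow>\<^sub>E Obj D"
    and farr_ext: "farr F \<in> Arr C \<rightarrow>\<^sub>E Arr D"
    and farr_Dom: "f \<in> Arr C \<Longrightarrow> Dom D (farr F f) = fob F (Dom C f)"
    and farr_Cod: "f \<in> Arr C \<Longrightarrow> Cod D (farr F f) = fob F (Cod C f)"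
    and farr_Ident: "X \<in> Obj C \<Longrightarrow> farr F (Ident C X) = Ident D (fob F X)"
    and farr_Cmp: "\<lbrakk>f \<in> Arr C; g \<in> Arr C; Dom C g = Cod C f\<rbrakk>
      \<Longrightarrow> farr F (Cmp C g f) = Cmp D (farr F g) (farr F f)"

definition id_func :: "('o, 'a) cat \<Rightarrow> ('o, 'a, 'o, 'a) func" where
  "id_func C = \<lparr>fob = \<lambda>X\<in>Obj C. X, farr = \<lambda>f\<in>Arr C. f\<rparr>"

text \<open>\<open>comp_func C G F\<close> is \<open>G\<close> after \<open>F\<close>, where \<open>C\<close> is the source of \<open>F\<close>.\<close>

definition comp_func ::
  "('o, 'a) cat \<Rightarrow> ('p, 'b, 'q, 'c) func \<Rightarrow> ('o, 'a, 'p, 'b) func \<Rightarrow> ('o, 'a, 'q, 'c) func" where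
  "comp_func C G F =
     \<lparr>fob = \<lambda>X\<in>Obj C. fob G (fob F X), farr = \<lambda>f\<in>Arr C. farr G (farr F f)\<rparr>"

definition fully_faithful ::
  "('o, 'a) cat \<Rightarrow> ('p, 'b) cat \<Rightarrow> ('o, 'a, 'p, 'b) func \<Rightarrow> bool" where
  "fully_faithful C D F \<longleftrightarrow> cat_functor C D F \<and>
     (\<forall>X\<in>Obj C. \<forall>Y\<in>Obj C. bij_betw (farr F) (arrows C X Y) (arrows D (fob F X) (fob F Y)))"

definition naturally_isomorphic ::
  "('o, 'a) cat \<Rightarrow> ('p, 'b) cat \<Rightarrow> ('o, 'a, 'p, 'b) func \<Rightarrow> ('o, 'a, 'p, 'b) func \<Rightarrow> bool" where
  "naturally_isomorphic C D F G \<longleftrightarrow>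
     (\<exists>\<eta>. (\<forall>X\<in>Obj C. \<eta> X \<in> arrows D (fob F X) (fob G X) \<and> iso_arr D (\<eta> X)) \<and>
          (\<forall>f\<in>Arr C. Cmp D (\<eta> (Cod C f)) (farr F f) = Cmp D (farr G f) (\<eta> (Dom C f))))"

definition cat_equivalence ::
  "('o, 'a) cat \<Rightarrow> ('p, 'b) cat \<Rightarrow> ('o, 'a, 'p, 'b) func \<Rightarrow> bool" where
  "cat_equivalence C D F \<longleftrightarrow> cat_functor C D F \<and>
     (\<exists>G. cat_functor D C G \<and>
          naturally_isomorphic C C (id_func C) (comp_func C G F) \<and>
          naturally_isomorphic D D (comp_func D F G) (id_func D))"


section \<open>Covers\<close>

definition ordinal :: "nat \<Rightarrow> (nat, nat \<times> nat) cat" where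
  "ordinal m = \<lparr>Obj = {0..m}, Arr = {(i, j). i \<le> j \<and> j \<le> m}, Dom = fst, Cod = snd,
     Ident = (\<lambda>i. (i, i)), Cmp = (\<lambda>g f. (fst f, snd g))\<rparr>"

definition nerve :: "nat \<Rightarrow> ('o, 'a) cat \<Rightarrow> (nat, nat \<times> nat, 'o, 'a) func set" where
  "nerve m C = {\<sigma>. cat_functor (ordinal m) C \<sigma>}"

definition nerve_map :: "nat \<Rightarrow> ('o, 'a, 'p, 'b) func \<Rightarrow>
    (nat, nat \<times> nat, 'o, 'a) func \<Rightarrow> (nat, nat \<times> nat, 'p, 'b) func" where
  "nerve_map m F \<sigma> = comp_func (ordinal m) F \<sigma>"

definition n_cover :: "enat \<Rightarrow> 'i set \<Rightarrow> ('i \<Rightarrow> ('vo, 'va) cat) \<Rightarrow>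
    ('i \<Rightarrow> ('vo, 'va, 'uo, 'ua) func) \<Rightarrow> ('uo, 'ua) cat \<Rightarrow> bool" where
  "n_cover n I V \<phi> U \<longleftrightarrow> category U \<and> (\<forall>i\<in>I. cat_functor (V i) U (\<phi> i)) \<and>
     (\<forall>m::nat. enat m \<le> n \<longrightarrow> (\<Union>i\<in>I. nerve_map m (\<phi> i) ` nerve m (V i)) = nerve m U)"

definition fprod :: "('o, 'a) cat \<Rightarrow> ('p, 'b) cat \<Rightarrow> ('o, 'a, 'q, 'c) func \<Rightarrow>
    ('p, 'b, 'q, 'c) func \<Rightarrow> ('o \<times> 'p, 'a \<times> 'b) cat" where
  "fprod C D F G =
     \<lparr>Obj = {(X, Y) \<in> Obj C \<times> Obj D. fob F X = fob G Y},
      Arr = {(f, g) \<in> Arr C \<times> Arr D. farr F f = farr G g},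
      Dom = (\<lambda>(f, g). (Dom C f, Dom D g)),
      Cod = (\<lambda>(f, g). (Cod C f, Cod D g)),
      Ident = (\<lambda>(X, Y). (Ident C X, Ident D Y)),
      Cmp = (\<lambda>(f', g') (f, g). (Cmp C f' f, Cmp D g' g))\<rparr>"

definition fprod3 :: "('o, 'a) cat \<Rightarrow> ('p, 'b) cat \<Rightarrow> ('q, 'c) cat \<Rightarrow> ('o, 'a, 'r, 'd) func \<Rightarrow>
    ('p, 'b, 'r, 'd) func \<Rightarrow> ('q, 'c, 'r, 'd) func \<Rightarrow> ('o \<times> 'p \<times> 'q, 'a \<times> 'b \<times> 'c) cat" where
  "fprod3 C D E F G H =
     \<lparr>Obj = {(X, Y, Z) \<in> Obj C \<times> Obj D \<times> Obj E. fob F X = fob G Y \<and> fob G Y = fob H Z},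
      Arr = {(f, g, h) \<in> Arr C \<times> Arr D \<times> Arr E. farr F f = farr G g \<and> farr G g = farr H h},
      Dom = (\<lambda>(f, g, h). (Dom C f, Dom D g, Dom E h)),
      Cod = (\<lambda>(f, g, h). (Cod C f, Cod D g, Cod E h)),
      Ident = (\<lambda>(X, Y, Z). (Ident C X, Ident D Y, Ident E Z)),
      Cmp = (\<lambda>(f', g', h') (f, g, h). (Cmp C f' f, Cmp D g' g, Cmp E h' h))\<rparr>"

text \<open>Functors out of a (double or triple) fibre product \<open>P\<close> given by projection to components.\<close>

definition proj_func :: "('o, 'a) cat \<Rightarrow> ('o \<Rightarrow> 'p) \<Rightarrow> ('a \<Rightarrow> 'b) \<Rightarrow> ('o, 'a, 'p, 'b) func" where
  "proj_func P p q = \<lparr>fob = restrict p (Obj P), farr = restrict q (Arr P)\<rparr>"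

definition pr1 :: "('o \<times> 'p, 'a \<times> 'b) cat \<Rightarrow> ('o \<times> 'p, 'a \<times> 'b, 'o, 'a) func" where
  "pr1 P = proj_func P fst fst"

definition pr2 :: "('o \<times> 'p, 'a \<times> 'b) cat \<Rightarrow> ('o \<times> 'p, 'a \<times> 'b, 'p, 'b) func" where
  "pr2 P = proj_func P snd snd"

definition pr12 :: "('o \<times> 'p \<times> 'q, 'a \<times> 'b \<times> 'c) cat \<Rightarrow>
    ('o \<times> 'p \<times> 'q, 'a \<times> 'b \<times> 'c, 'o \<times> 'p, 'a \<times> 'b) func" where
  "pr12 P = proj_func P (\<lambda>(x, y, z). (x, y)) (\<lambda>(f, g, h). (f, g))"

definition pr13 :: "('o \<times> 'p \<times> 'q, 'a \<times> 'b \<times> 'c) cat \<Rightarrow>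
    ('o \<times> 'p \<times> 'q, 'a \<times> 'b \<times> 'c, 'o \<times> 'q, 'a \<times> 'c) func" where
  "pr13 P = proj_func P (\<lambda>(x, y, z). (x, z)) (\<lambda>(f, g, h). (f, h))"

definition pr23 :: "('o \<times> 'p \<times> 'q, 'a \<times> 'b \<times> 'c) cat \<Rightarrow>
    ('o \<times> 'p \<times> 'q, 'a \<times> 'b \<times> 'c, 'p \<times> 'q, 'b \<times> 'c) func" where
  "pr23 P = proj_func P (\<lambda>(x, y, z). (y, z)) (\<lambda>(f, g, h). (g, h))"


section \<open>Graded categories\<close>

definition linear_map :: "('k, 'r) ring_scheme \<Rightarrow> ('k, 'm) module \<Rightarrow> ('k, 'm) module \<Rightarrow>
    ('m \<Rightarrow> 'm) \<Rightarrow> bool" where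
  "linear_map R M N h \<longleftrightarrow> h \<in> carrier M \<rightarrow> carrier N \<and>
     (\<forall>x\<in>carrier M. \<forall>y\<in>carrier M. h (x \<oplus>\<^bsub>M\<^esub> y) = h x \<oplus>\<^bsub>N\<^esub> h y) \<and>
     (\<forall>r\<in>carrier R. \<forall>x\<in>carrier M. h (r \<odot>\<^bsub>M\<^esub> x) = r \<odot>\<^bsub>N\<^esub> h x)"

definition bilinear_map :: "('k, 'r) ring_scheme \<Rightarrow> ('k, 'm) module \<Rightarrow> ('k, 'm) module \<Rightarrow>
    ('k, 'm) module \<Rightarrow> ('m \<Rightarrow> 'm \<Rightarrow> 'm) \<Rightarrow> bool" where
  "bilinear_map R M N P h \<longleftrightarrow>
     (\<forall>x\<in>carrier M. linear_map R N P (\<lambda>y. h x y)) \<and>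
     (\<forall>y\<in>carrier N. linear_map R M P (\<lambda>x. h x y))"

text \<open>
  For a graded category \<open>a\<close>: \<open>gob a U\<close> is the set $a_U$, \<open>ghom a (u, A, A')\<close> is the module
  $a_u(A, A')$, \<open>gid a (U, A)\<close> is the identity of \<open>A\<close> in $a_U$, and
  \<open>gcomp a (u', u, A, A', A'')\<close> is the composition
  $a_{u'}(A', A'') \otimes a_u(A, A') \to a_{u'u}(A, A'')$, rendered as a bilinear map.
  The library type of modules carries irrelevant values (the multiplicative structure, and values
  outside the carrier); two graded categories differing only in those are isomorphic through
  identity maps.
\<close>

record ('uo, 'ua, 'x, 'k, 'm) gcat =
  gob :: "'uo \<Rightarrow> 'x set"
  ghom :: "'ua \<times> 'x \<times> 'x \<Rightarrow> ('k, 'm) module"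
  gcomp :: "'ua \<times> 'ua \<times> 'x \<times> 'x \<times> 'x \<Rightarrow> 'm \<Rightarrow> 'm \<Rightarrow> 'm"
  gid :: "'uo \<times> 'x \<Rightarrow> 'm"

definition ob_index :: "('uo, 'ua) cat \<Rightarrow> ('uo \<Rightarrow> 'x set) \<Rightarrow> ('uo \<times> 'x) set" where
  "ob_index U ob = {(X, A). X \<in> Obj U \<and> A \<in> ob X}"

definition hom_index :: "('uo, 'ua) cat \<Rightarrow> ('uo \<Rightarrow> 'x set) \<Rightarrow> ('ua \<times> 'x \<times> 'x) set" where
  "hom_index U ob = {(u, A, A'). u \<in> Arr U \<and> A \<in> ob (Dom U u) \<and> A' \<in> ob (Cod U u)}"

definition comp_index ::
  "('uo, 'ua) cat \<Rightarrow> ('uo \<Rightarrow> 'x set) \<Rightarrow> ('ua \<times> 'ua \<times> 'x \<times> 'x \<times> 'x) set" where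
  "comp_index U ob = {(u', u, A, A', A''). u \<in> Arr U \<and> u' \<in> Arr U \<and> Dom U u' = Cod U u \<and>
     A \<in> ob (Dom U u) \<and> A' \<in> ob (Cod U u) \<and> A'' \<in> ob (Cod U u')}"

locale graded_category = R: cring R + U: category U
  for R :: "('k, 'r) ring_scheme" and U :: "('uo, 'ua) cat" +
  fixes a :: "('uo, 'ua, 'x, 'k, 'm) gcat"
  assumes gob_ext: "gob a \<in> extensional (Obj U)"
    and ghom_ext: "ghom a \<in> extensional (hom_index U (gob a))"
    and gcomp_ext: "gcomp a \<in> extensional (comp_index U (gob a))"
    and gid_ext: "gid a \<in> extensional (ob_index U (gob a))"
    and ghom_module: "t \<in> hom_index U (gob a) \<Longrightarrow> Module.module R (ghom a t)"
    and gcomp_bilinear: "(u', u, A, A', A'') \<in> comp_index U (gob a) \<Longrightarrow>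
      bilinear_map R (ghom a (u', A', A'')) (ghom a (u, A, A')) (ghom a (Cmp U u' u, A, A''))
        (gcomp a (u', u, A, A', A''))"
    and gid_closed: "(X, A) \<in> ob_index U (gob a) \<Longrightarrow>
      gid a (X, A) \<in> carrier (ghom a (Ident U X, A, A))"
    and gcomp_gid_right: "\<lbrakk>(u, A, A') \<in> hom_index U (gob a); f \<in> carrier (ghom a (u, A, A'))\<rbrakk> \<Longrightarrow>
      gcomp a (u, Ident U (Dom U u), A, A, A') f (gid a (Dom U u, A)) = f"
    and gcomp_gid_left: "\<lbrakk>(u, A, A') \<in> hom_index U (gob a); f \<in> carrier (ghom a (u, A, A'))\<rbrakk> \<Longrightarrow>
      gcomp a (Ident U (Cod U u), u, A, A', A') (gid a (Cod U u, A')) f = f"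
    and gcomp_assoc:
      "\<lbrakk>(u', u, A, A', A'') \<in> comp_index U (gob a); (u'', u', A', A'', A''') \<in> comp_index U (gob a);
        f \<in> carrier (ghom a (u, A, A')); g \<in> carrier (ghom a (u', A', A''));
        h \<in> carrier (ghom a (u'', A'', A'''))\<rbrakk> \<Longrightarrow>
      gcomp a (u'', Cmp U u' u, A, A'', A''') h (gcomp a (u', u, A, A', A'') g f) =
      gcomp a (Cmp U u'' u', u, A, A', A''') (gcomp a (u'', u', A', A'', A''') h g) f"

text \<open>
  Graded functors $(\varphi, F) : (V, b) \to (U, a)$. The component \<open>Psi\<close> is $\varphi$, so this
  selector is the functor $\Psi : \mathsf{Map} \to \mathsf{Cat}$ on morphisms; on objects,
  $\Psi(U, a) = U$.
\<close>

record ('vo, 'va, 'uo, 'ua, 'x, 'm) gfun =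
  Psi :: "('vo, 'va, 'uo, 'ua) func"
  gf_ob :: "'vo \<times> 'x \<Rightarrow> 'x"
  gf_hom :: "'va \<times> 'x \<times> 'x \<Rightarrow> 'm \<Rightarrow> 'm"

definition gf_index ::
  "('vo, 'va) cat \<Rightarrow> ('vo, 'va, 'uo, 'ua, 'x, 'm) gfun \<Rightarrow> 'va \<times> 'x \<times> 'x \<Rightarrow> 'ua \<times> 'x \<times> 'x" where
  "gf_index V F = (\<lambda>(v, B, B').
     (farr (Psi F) v, gf_ob F (Dom V v, B), gf_ob F (Cod V v, B')))"

locale graded_functor = B: graded_category R V b + A: graded_category R U a
  for R :: "('k, 'r) ring_scheme"
    and V :: "('vo, 'va) cat" and b :: "('vo, 'va, 'x, 'k, 'm) gcat"
    and U :: "('uo, 'ua) cat" and a :: "('uo, 'ua, 'x, 'k, 'm) gcat" +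
  fixes F :: "('vo, 'va, 'uo, 'ua, 'x, 'm) gfun"
  assumes Psi_functor: "cat_functor V U (Psi F)"
    and gf_ob_ext: "gf_ob F \<in> extensional (ob_index V (gob b))"
    and gf_ob_closed: "(Y, B) \<in> ob_index V (gob b) \<Longrightarrow> gf_ob F (Y, B) \<in> gob a (fob (Psi F) Y)"
    and gf_hom_ext: "gf_hom F \<in> extensional (hom_index V (gob b))"
    and gf_hom_ext': "t \<in> hom_index V (gob b) \<Longrightarrow> gf_hom F t \<in> extensional (carrier (ghom b t))"
    and gf_hom_linear: "t \<in> hom_index V (gob b) \<Longrightarrow>
      linear_map R (ghom b t) (ghom a (gf_index V F t)) (gf_hom F t)"
    and gf_hom_gid: "(Y, B) \<in> ob_index V (gob b) \<Longrightarrow>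
      gf_hom F (Ident V Y, B, B) (gid b (Y, B)) = gid a (fob (Psi F) Y, gf_ob F (Y, B))"
    and gf_hom_gcomp: "\<lbrakk>(v', v, B, B', B'') \<in> comp_index V (gob b);
        f \<in> carrier (ghom b (v, B, B')); g \<in> carrier (ghom b (v', B', B''))\<rbrakk> \<Longrightarrow>
      gf_hom F (Cmp V v' v, B, B'') (gcomp b (v', v, B, B', B'') g f) =
      gcomp a (farr (Psi F) v', farr (Psi F) v,
          gf_ob F (Dom V v, B), gf_ob F (Cod V v, B'), gf_ob F (Cod V v', B''))
        (gf_hom F (v', B', B'') g) (gf_hom F (v, B, B') f)"

definition id_gfun :: "('uo, 'ua) cat \<Rightarrow> ('uo, 'ua, 'x, 'k, 'm) gcat \<Rightarrow>
    ('uo, 'ua, 'uo, 'ua, 'x, 'm) gfun" where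
  "id_gfun U a =
     \<lparr>Psi = id_func U,
      gf_ob = \<lambda>(X, A)\<in>ob_index U (gob a). A,
      gf_hom = \<lambda>t\<in>hom_index U (gob a). \<lambda>f\<in>carrier (ghom a t). f\<rparr>"

text \<open>\<open>comp_gfun W c G F\<close> is \<open>G\<close> after \<open>F\<close>, where \<open>(W, c)\<close> is the source of \<open>F\<close>.\<close>

definition comp_gfun :: "('wo, 'wa) cat \<Rightarrow> ('wo, 'wa, 'x, 'k, 'm) gcat \<Rightarrow>
    ('vo, 'va, 'uo, 'ua, 'x, 'm) gfun \<Rightarrow> ('wo, 'wa, 'vo, 'va, 'x, 'm) gfun \<Rightarrow>
    ('wo, 'wa, 'uo, 'ua, 'x, 'm) gfun" where
  "comp_gfun W c G F =
     \<lparr>Psi = comp_func W (Psi G) (Psi F),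
      gf_ob = \<lambda>(X, C)\<in>ob_index W (gob c). gf_ob G (fob (Psi F) X, gf_ob F (X, C)),
      gf_hom = \<lambda>t\<in>hom_index W (gob c). \<lambda>f\<in>carrier (ghom c t).
        gf_hom G (gf_index W F t) (gf_hom F t f)\<rparr>"

text \<open>
  \<open>D : (V, b) \<rightarrow> (U, a)\<close> has the (unique) lifting property of a \<open>\<Psi>\<close>-cartesian morphism with
  respect to morphisms with source \<open>(W, c)\<close>. It is cartesian if this holds for all \<open>(W, c)\<close>;
  these are parameters here because their types are not determined by those of \<open>U\<close> and \<open>V\<close>.
\<close>

definition cartesian_wrt :: "('k, 'r) ring_scheme \<Rightarrow>
    ('wo, 'wa) cat \<Rightarrow> ('wo, 'wa, 'x, 'k, 'm) gcat \<Rightarrow>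
    ('vo, 'va) cat \<Rightarrow> ('vo, 'va, 'x, 'k, 'm) gcat \<Rightarrow>
    ('uo, 'ua) cat \<Rightarrow> ('uo, 'ua, 'x, 'k, 'm) gcat \<Rightarrow>
    ('vo, 'va, 'uo, 'ua, 'x, 'm) gfun \<Rightarrow> bool" where
  "cartesian_wrt R W c V b U a D \<longleftrightarrow>
     (\<forall>\<chi> H. cat_functor W V \<chi> \<and> graded_functor R W c U a H \<and> Psi H = comp_func W (Psi D) \<chi> \<longrightarrow>
        (\<exists>!G. graded_functor R W c V b G \<and> Psi G = \<chi> \<and> comp_gfun W c D G = H))"


section \<open>The pseudofunctor of graded categories\<close>

text \<open>\<open>Map' R U\<close> is the fibre of \<open>\<Psi>\<close> over \<open>U\<close>; arrows record their source and target.\<close>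

definition Map' :: "('k, 'r) ring_scheme \<Rightarrow> ('uo, 'ua) cat \<Rightarrow>
    (('uo, 'ua, 'x, 'k, 'm) gcat,
     ('uo, 'ua, 'x, 'k, 'm) gcat \<times> ('uo, 'ua, 'uo, 'ua, 'x, 'm) gfun \<times>
       ('uo, 'ua, 'x, 'k, 'm) gcat) cat" where
  "Map' R U =
     \<lparr>Obj = {a. graded_category R U a},
      Arr = {(a, F, b). graded_functor R U a U b F \<and> Psi F = id_func U},
      Dom = (\<lambda>(a, F, b). a),
      Cod = (\<lambda>(a, F, b). b),
      Ident = (\<lambda>a. (a, id_gfun U a, a)),
      Cmp = (\<lambda>(b', G, c) (a, F, b). (a, comp_gfun U a G F, c))\<rparr>"

text \<open>\<open>pull V \<phi> a\<close> is $a^\varphi$, and \<open>delta V \<phi> a\<close> is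
  $(\varphi, \delta^{\varphi, a}) : (V, a^\varphi) \to (U, a)$.\<close>

definition pull :: "('vo, 'va) cat \<Rightarrow> ('vo, 'va, 'uo, 'ua) func \<Rightarrow>
    ('uo, 'ua, 'x, 'k, 'm) gcat \<Rightarrow> ('vo, 'va, 'x, 'k, 'm) gcat" where
  "pull V \<phi> a =
     (let ob = (\<lambda>Y\<in>Obj V. gob a (fob \<phi> Y)) in
      \<lparr>gob = ob,
       ghom = \<lambda>(v, A, A')\<in>hom_index V ob. ghom a (farr \<phi> v, A, A'),
       gcomp = \<lambda>(v', v, A, A', A'')\<in>comp_index V ob. gcomp a (farr \<phi> v', farr \<phi> v, A, A', A''),
       gid = \<lambda>(Y, A)\<in>ob_index V ob. gid a (fob \<phi> Y, A)\<rparr>)"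

definition delta :: "('vo, 'va) cat \<Rightarrow> ('vo, 'va, 'uo, 'ua) func \<Rightarrow>
    ('uo, 'ua, 'x, 'k, 'm) gcat \<Rightarrow> ('vo, 'va, 'uo, 'ua, 'x, 'm) gfun" where
  "delta V \<phi> a =
     \<lparr>Psi = \<phi>,
      gf_ob = \<lambda>(Y, A)\<in>ob_index V (gob (pull V \<phi> a)). A,
      gf_hom = \<lambda>t\<in>hom_index V (gob (pull V \<phi> a)). \<lambda>f\<in>carrier (ghom (pull V \<phi> a) t). f\<rparr>"

text \<open>
  The remaining data of the pseudofunctor are determined by the chosen cartesian morphisms:
  $F^\varphi$ is the morphism over $1_V$ with
  $\delta^{\varphi, b} \circ F^\varphi = F \circ \delta^{\varphi, a}$ for \<open>F : a \<rightarrow> b\<close>; the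
  coherence morphisms $(a^\varphi)^\psi \to a^{\varphi\psi}$ and $a \to a^{1_U}$ are those over the
  identity that are compatible with the chosen cartesian morphisms.
\<close>

definition Map'_functor :: "('k, 'r) ring_scheme \<Rightarrow> ('vo, 'va) cat \<Rightarrow> ('uo, 'ua) cat \<Rightarrow>
    ('vo, 'va, 'uo, 'ua) func \<Rightarrow>
    (('uo, 'ua, 'x, 'k, 'm) gcat,
     ('uo, 'ua, 'x, 'k, 'm) gcat \<times> ('uo, 'ua, 'uo, 'ua, 'x, 'm) gfun \<times>
       ('uo, 'ua, 'x, 'k, 'm) gcat,
     ('vo, 'va, 'x, 'k, 'm) gcat,
     ('vo, 'va, 'x, 'k, 'm) gcat \<times> ('vo, 'va, 'vo, 'va, 'x, 'm) gfun \<times>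
       ('vo, 'va, 'x, 'k, 'm) gcat) func" where
  "Map'_functor R V U \<phi> =
     \<lparr>fob = \<lambda>a\<in>Obj (Map' R U). pull V \<phi> a,
      farr = \<lambda>(a, F, b)\<in>Arr (Map' R U).
        (pull V \<phi> a,
         THE G. graded_functor R V (pull V \<phi> a) V (pull V \<phi> b) G \<and> Psi G = id_func V \<and>
           comp_gfun V (pull V \<phi> a) (delta V \<phi> b) G = comp_gfun V (pull V \<phi> a) F (delta V \<phi> a),
         pull V \<phi> b)\<rparr>"

definition comp_coherence :: "('k, 'r) ring_scheme \<Rightarrow> ('wo, 'wa) cat \<Rightarrow> ('vo, 'va) cat \<Rightarrow>
    ('vo, 'va, 'uo, 'ua) func \<Rightarrow> ('wo, 'wa, 'vo, 'va) func \<Rightarrow> ('uo, 'ua, 'x, 'k, 'm) gcat \<Rightarrow>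
    ('wo, 'wa, 'x, 'k, 'm) gcat \<times> ('wo, 'wa, 'wo, 'wa, 'x, 'm) gfun \<times>
      ('wo, 'wa, 'x, 'k, 'm) gcat" where
  "comp_coherence R W V \<phi> \<psi> a =
     (let b = pull W \<psi> (pull V \<phi> a); c = pull W (comp_func W \<phi> \<psi>) a in
      (b,
       THE G. graded_functor R W b W c G \<and> Psi G = id_func W \<and>
         comp_gfun W b (delta W (comp_func W \<phi> \<psi>) a) G =
         comp_gfun W b (delta V \<phi> a) (delta W \<psi> (pull V \<phi> a)),
       c))"

definition unit_coherence :: "('k, 'r) ring_scheme \<Rightarrow> ('uo, 'ua) cat \<Rightarrow>
    ('uo, 'ua, 'x, 'k, 'm) gcat \<Rightarrow>
    ('uo, 'ua, 'x, 'k, 'm) gcat \<times> ('uo, 'ua, 'uo, 'ua, 'x, 'm) gfun \<times>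
      ('uo, 'ua, 'x, 'k, 'm) gcat" where
  "unit_coherence R U a =
     (let c = pull U (id_func U) a in
      (a,
       THE G. graded_functor R U a U c G \<and> Psi G = id_func U \<and>
         comp_gfun U a (delta U (id_func U) a) G = id_gfun U a,
       c))"


section \<open>Descent\<close>

text \<open>
  Since \<open>Map'\<close> is strictly functorial, the iterated restrictions of an object to a double or
  triple fibre product agree on the nose, and no coherence isomorphisms need to be inserted in
  the cocycle condition or in the canonical descent datum of an object over \<open>U\<close>.
\<close>

definition dbl :: "('i \<Rightarrow> ('vo, 'va) cat) \<Rightarrow> ('i \<Rightarrow> ('vo, 'va, 'uo, 'ua) func) \<Rightarrow> 'i \<Rightarrow> 'i \<Rightarrow>
    ('vo \<times> 'vo, 'va \<times> 'va) cat" where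
  "dbl V \<phi> i j = fprod (V i) (V j) (\<phi> i) (\<phi> j)"

definition tpl :: "('i \<Rightarrow> ('vo, 'va) cat) \<Rightarrow> ('i \<Rightarrow> ('vo, 'va, 'uo, 'ua) func) \<Rightarrow>
    'i \<Rightarrow> 'i \<Rightarrow> 'i \<Rightarrow> ('vo \<times> 'vo \<times> 'vo, 'va \<times> 'va \<times> 'va) cat" where
  "tpl V \<phi> i j l = fprod3 (V i) (V j) (V l) (\<phi> i) (\<phi> j) (\<phi> l)"

type_synonym ('i, 'vo, 'va, 'x, 'k, 'm) descent_datum =
  "('i \<Rightarrow> ('vo, 'va, 'x, 'k, 'm) gcat) \<times>
   ('i \<times> 'i \<Rightarrow>
     ('vo \<times> 'vo, 'va \<times> 'va, 'x, 'k, 'm) gcat \<times>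
     ('vo \<times> 'vo, 'va \<times> 'va, 'vo \<times> 'vo, 'va \<times> 'va, 'x, 'm) gfun \<times>
     ('vo \<times> 'vo, 'va \<times> 'va, 'x, 'k, 'm) gcat)"

type_synonym ('i, 'vo, 'va, 'x, 'k, 'm) descent_arrow =
  "('i, 'vo, 'va, 'x, 'k, 'm) descent_datum \<times>
   ('i \<Rightarrow> ('vo, 'va, 'x, 'k, 'm) gcat \<times> ('vo, 'va, 'vo, 'va, 'x, 'm) gfun \<times>
     ('vo, 'va, 'x, 'k, 'm) gcat) \<times>
   ('i, 'vo, 'va, 'x, 'k, 'm) descent_datum"

definition descent_data :: "('k, 'r) ring_scheme \<Rightarrow> 'i set \<Rightarrow> ('i \<Rightarrow> ('vo, 'va) cat) \<Rightarrow>
    ('i \<Rightarrow> ('vo, 'va, 'uo, 'ua) func) \<Rightarrow> ('i, 'vo, 'va, 'x, 'k, 'm) descent_datum set" where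
  "descent_data R I V \<phi> = {(b, \<theta>).
     b \<in> (\<Pi>\<^sub>E i\<in>I. Obj (Map' R (V i))) \<and>
     \<theta> \<in> extensional (I \<times> I) \<and>
     (\<forall>i\<in>I. \<forall>j\<in>I. let P = dbl V \<phi> i j in
        \<theta> (i, j) \<in> arrows (Map' R P)
          (fob (Map'_functor R P (V i) (pr1 P)) (b i))
          (fob (Map'_functor R P (V j) (pr2 P)) (b j)) \<and>
        iso_arr (Map' R P) (\<theta> (i, j))) \<and>
     (\<forall>i\<in>I. \<forall>j\<in>I. \<forall>l\<in>I. let T = tpl V \<phi> i j l in
        Cmp (Map' R T)
          (farr (Map'_functor R T (dbl V \<phi> j l) (pr23 T)) (\<theta> (j, l)))
          (farr (Map'_functor R T (dbl V \<phi> i j) (pr12 T)) (\<theta> (i, j))) =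
        farr (Map'_functor R T (dbl V \<phi> i l) (pr13 T)) (\<theta> (i, l)))}"

definition descent_arrows :: "('k, 'r) ring_scheme \<Rightarrow> 'i set \<Rightarrow> ('i \<Rightarrow> ('vo, 'va) cat) \<Rightarrow>
    ('i \<Rightarrow> ('vo, 'va, 'uo, 'ua) func) \<Rightarrow> ('i, 'vo, 'va, 'x, 'k, 'm) descent_arrow set" where
  "descent_arrows R I V \<phi> = {((b, \<theta>), f, (b', \<theta>')).
     (b, \<theta>) \<in> descent_data R I V \<phi> \<and> (b', \<theta>') \<in> descent_data R I V \<phi> \<and>
     f \<in> (\<Pi>\<^sub>E i\<in>I. arrows (Map' R (V i)) (b i) (b' i)) \<and>
     (\<forall>i\<in>I. \<forall>j\<in>I. let P = dbl V \<phi> i j in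
        Cmp (Map' R P) (\<theta>' (i, j)) (farr (Map'_functor R P (V i) (pr1 P)) (f i)) =
        Cmp (Map' R P) (farr (Map'_functor R P (V j) (pr2 P)) (f j)) (\<theta> (i, j)))}"

definition Des :: "('k, 'r) ring_scheme \<Rightarrow> 'i set \<Rightarrow> ('i \<Rightarrow> ('vo, 'va) cat) \<Rightarrow>
    ('i \<Rightarrow> ('vo, 'va, 'uo, 'ua) func) \<Rightarrow>
    (('i, 'vo, 'va, 'x, 'k, 'm) descent_datum, ('i, 'vo, 'va, 'x, 'k, 'm) descent_arrow) cat" where
  "Des R I V \<phi> =
     \<lparr>Obj = descent_data R I V \<phi>,
      Arr = descent_arrows R I V \<phi>,
      Dom = (\<lambda>(X, f, Y). X),
      Cod = (\<lambda>(X, f, Y). Y),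
      Ident = (\<lambda>X. (X, \<lambda>i\<in>I. Ident (Map' R (V i)) (fst X i), X)),
      Cmp = (\<lambda>(Y', g, Z) (X, f, Y). (X, \<lambda>i\<in>I. Cmp (Map' R (V i)) (g i) (f i), Z))\<rparr>"

definition canonical_datum :: "('k, 'r) ring_scheme \<Rightarrow> 'i set \<Rightarrow> ('i \<Rightarrow> ('vo, 'va) cat) \<Rightarrow>
    ('i \<Rightarrow> ('vo, 'va, 'uo, 'ua) func) \<Rightarrow> ('uo, 'ua) cat \<Rightarrow> ('uo, 'ua, 'x, 'k, 'm) gcat \<Rightarrow>
    ('i, 'vo, 'va, 'x, 'k, 'm) descent_datum" where
  "canonical_datum R I V \<phi> U a =
     (\<lambda>i\<in>I. fob (Map'_functor R (V i) U (\<phi> i)) a,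
      \<lambda>(i, j)\<in>I \<times> I. let P = dbl V \<phi> i j in
        Ident (Map' R P)
          (fob (Map'_functor R P (V i) (pr1 P)) (fob (Map'_functor R (V i) U (\<phi> i)) a)))"

definition comparison :: "('k, 'r) ring_scheme \<Rightarrow> 'i set \<Rightarrow> ('i \<Rightarrow> ('vo, 'va) cat) \<Rightarrow>
    ('i \<Rightarrow> ('vo, 'va, 'uo, 'ua) func) \<Rightarrow> ('uo, 'ua) cat \<Rightarrow>
    (('uo, 'ua, 'x, 'k, 'm) gcat,
     ('uo, 'ua, 'x, 'k, 'm) gcat \<times> ('uo, 'ua, 'uo, 'ua, 'x, 'm) gfun \<times>
       ('uo, 'ua, 'x, 'k, 'm) gcat,
     ('i, 'vo, 'va, 'x, 'k, 'm) descent_datum, ('i, 'vo, 'va, 'x, 'k, 'm) descent_arrow) func" where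
  "comparison R I V \<phi> U =
     \<lparr>fob = \<lambda>a\<in>Obj (Map' R U). canonical_datum R I V \<phi> U a,
      farr = \<lambda>f\<in>Arr (Map' R U).
        (canonical_datum R I V \<phi> U (Dom (Map' R U) f),
         \<lambda>i\<in>I. farr (Map'_functor R (V i) U (\<phi> i)) f,
         canonical_datum R I V \<phi> U (Cod (Map' R U) f))\<rparr>"

end

theory Submission
  imports Defs
begin

text \<open>
  Restriction along \<open>\<phi>\<close> only reindexes the data of a graded category: $a^\varphi$ at \<open>v\<close> is \<open>a\<close> at
  \<open>\<phi> v\<close>, and \<open>\<delta>\<close> consists of identities. A graded functor into \<open>a\<close> over \<open>\<phi> \<circ> \<chi>\<close> therefore is, component
  by component, the same thing as a graded functor into $a^\varphi$ over \<open>\<chi>\<close>; this is the cartesian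
  property (\<open>ex1_lift\<close>). Its uniqueness part evaluates the descriptions by which $F^\varphi$ and the
  coherence morphisms are defined (\<open>the_lift\<close>): $F^\varphi$ is \<open>F\<close> reindexed, the coherence morphisms
  are identities, and reindexing along a composite is reindexing twice (\<open>Map'_functor_comp\<close>).

  Descent rests on counting how many composable arrows of \<open>U\<close> enter an axiom. A chain of \<open>m\<close> arrows
  extends to an \<open>m\<close>-simplex of the nerve, so it lifts to a chain in one member of an \<open>n\<close>-cover as soon as
  \<open>m \<le> n\<close> (\<open>n_cover_lift_chain\<close>).

  A graded functor is a family of maps indexed by objects and arrows of \<open>U\<close>, and its axioms speak about
  at most two composable arrows. Compatible graded functors on the members of a cover agree wherever two
  lifts have the same image in \<open>U\<close>, so they determine a family of maps over \<open>U\<close>; every axiom is checked on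
  a lift of the pair of arrows involved (\<open>glue_gfun\<close>). Hence 2-covers suffice for full faithfulness.

  The axioms of a graded category speak about at most three composable arrows, associativity being
  the only one that needs three. For a descent datum \<open>(b, \<theta>)\<close>, the cocycle condition together with
  invertibility makes \<open>\<theta>\<close> a coherent system of identifications between the values of \<open>b\<close> at any
  two lifts of the same object or arrow: they compose, and they are identities on the diagonal
  (\<open>T_trans\<close>, \<open>T_refl\<close>). Choose one lift of every object and every arrow and take the value of \<open>b\<close> there;
  to compose two morphisms, transport them to a composable pair of lifts, compose in \<open>b\<close>, and transport
  the result back. This does not depend on the pair (\<open>tr_gmul\<close>), so the axioms may be checked on lifts,
  where they are those of \<open>b\<close> (\<open>glued_graded\<close>). The identifications themselves form an isomorphism between
  the restriction of the glued category and \<open>b\<close>. To avoid carrying the index of the cover along,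
  the gluing is done for the single functor from the disjoint union of the members to \<open>U\<close>.

  Full faithfulness and essential surjectivity give the equivalence.
\<close>

section \<open>Functors\<close>

lemma cat_functor_fob [simp]:
  "cat_functor C D F \<Longrightarrow> X \<in> Obj C \<Longrightarrow> fob F X \<in> Obj D"
  by (rule PiE_mem[OF cat_functor.fob_ext])

lemma cat_functor_farr [simp]:
  "cat_functor C D F \<Longrightarrow> f \<in> Arr C \<Longrightarrow> farr F f \<in> Arr D"
  by (rule PiE_mem[OF cat_functor.farr_ext])

lemma cat_functor_source: "cat_functor C D F \<Longrightarrow> category C"
  and cat_functor_target: "cat_functor C D F \<Longrightarrow> category D"
  by (auto simp: cat_functor_def)

lemmas category_simps [simp] = category.Dom_closed category.Cod_closed category.Ident_closed
  category.Dom_Ident category.Cod_Ident category.Cmp_closed category.Dom_Cmp category.Cod_Cmp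
  category.Cmp_Ident_left category.Cmp_Ident_right

lemmas functor_simps [simp] = cat_functor.farr_Dom cat_functor.farr_Cod cat_functor.farr_Ident
  cat_functor.farr_Cmp

lemmas functor_rules = cat_functor_fob cat_functor_farr functor_simps

lemma id_func_apply [simp]:
  "X \<in> Obj C \<Longrightarrow> fob (id_func C) X = X"
  "f \<in> Arr C \<Longrightarrow> farr (id_func C) f = f"
  by (simp_all add: id_func_def)

lemma comp_func_apply [simp]:
  "X \<in> Obj C \<Longrightarrow> fob (comp_func C G F) X = fob G (fob F X)"
  "f \<in> Arr C \<Longrightarrow> farr (comp_func C G F) f = farr G (farr F f)"
  by (simp_all add: comp_func_def)

lemma cat_functor_eqI:
  assumes "cat_functor C D F" "cat_functor C D' G"
    and "\<And>X. X \<in> Obj C \<Longrightarrow> fob F X = fob G X"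
    and "\<And>f. f \<in> Arr C \<Longrightarrow> farr F f = farr G f"
  shows "F = G"
proof (rule func.equality)
  show "fob F = fob G"
    using assms(3) cat_functor.fob_ext[OF assms(1)] cat_functor.fob_ext[OF assms(2)]
    by (intro extensionalityI[of _ "Obj C"]) (auto simp: PiE_def)
  show "farr F = farr G"
    using assms(4) cat_functor.farr_ext[OF assms(1)] cat_functor.farr_ext[OF assms(2)]
    by (intro extensionalityI[of _ "Arr C"]) (auto simp: PiE_def)
qed simp

lemma id_func_functor [simp, intro]: "category C \<Longrightarrow> cat_functor C C (id_func C)"
  by (auto simp: cat_functor_def cat_functor_axioms_def id_func_def)

lemma comp_func_functor [simp, intro]:
  assumes F: "cat_functor C D F" and G: "cat_functor D E G"
  shows "cat_functor C E (comp_func C G F)"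
proof -
  have C: "category C" and D: "category D" and E: "category E"
    using assms by (auto simp: cat_functor_def)
  show ?thesis
    unfolding cat_functor_def cat_functor_axioms_def comp_func_def
    using C D E F G by auto
qed

lemma comp_func_id_right [simp]: "cat_functor C D F \<Longrightarrow> comp_func C F (id_func C) = F"
  by (rule cat_functor_eqI[where D = D and D' = D]) (auto dest: cat_functor_source)

lemma comp_func_id_left [simp]: "cat_functor C D F \<Longrightarrow> comp_func C (id_func D) F = F"
  by (rule cat_functor_eqI[where D = D and D' = D]) (auto dest: cat_functor_target)

lemma comp_func_assoc:
  assumes "cat_functor B C F" "cat_functor C D G" "cat_functor D E H"
  shows "comp_func B H (comp_func B G F) = comp_func B (comp_func C H G) F"
  using assms by (intro cat_functor_eqI[where C = B and D = E and D' = E]) auto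

section \<open>Isomorphisms and equivalences\<close>

lemma Ident_iso:
  assumes "category C" "X \<in> Obj C"
  shows "Ident C X \<in> arrows C X X" "iso_arr C (Ident C X)"
proof -
  interpret category C by fact
  show *: "Ident C X \<in> arrows C X X" using assms by (simp add: arrows_def)
  have "Cmp C (Ident C X) (Ident C X) = Ident C X"
    using Cmp_Ident_left[OF Ident_closed[OF assms(2)]] assms by simp
  then show "iso_arr C (Ident C X)"
    unfolding iso_arr_def using assms * by (intro conjI bexI[of _ "Ident C X"]) simp_all
qed

lemma functor_iso:
  assumes F: "cat_functor C D F" and f: "iso_arr C f"
  shows "iso_arr D (farr F f)"
proof -
  interpret cat_functor C D F by fact
  obtain g where "f \<in> Arr C" "g \<in> arrows C (Cod C f) (Dom C f)" "Cmp C g f = Ident C (Dom C f)"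
    "Cmp C f g = Ident C (Cod C f)"
    using f by (auto simp: iso_arr_def)
  then show ?thesis
    using F farr_Cmp[of f g] farr_Cmp[of g f] unfolding iso_arr_def
    by (intro conjI bexI[of _ "farr F g"]) (auto simp: arrows_def farr_Dom farr_Cod farr_Ident
        C.category_axioms)
qed

text \<open>
  The standard argument: the axiom of choice provides for every \<open>Y\<close> an object \<open>g Y\<close> with an
  isomorphism \<open>e Y : F (g Y) \<rightarrow> Y\<close>, and full faithfulness transports arrows of \<open>D\<close> back along
  these.
\<close>

lemma fully_faithful_essentially_surjective_equivalence:
  assumes ff: "fully_faithful C D F"
    and ess: "\<And>Y. Y \<in> Obj D \<Longrightarrow> \<exists>X\<in>Obj C. \<exists>f\<in>arrows D (fob F X) Y. iso_arr D f"
  shows "cat_equivalence C D F"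
proof -
  interpret F: cat_functor C D F using ff by (simp add: fully_faithful_def)
  note [simp] = F.C.category_axioms F.D.category_axioms F.farr_Dom F.farr_Cod F.farr_Ident
    cat_functor_fob[OF F.cat_functor_axioms] cat_functor_farr[OF F.cat_functor_axioms]
  have bij: "bij_betw (farr F) (arrows C X Y) (arrows D (fob F X) (fob F Y))" if "X \<in> Obj C" "Y \<in> Obj C"
      for X Y
    using ff that by (simp add: fully_faithful_def)
  have "\<exists>X e e'. X \<in> Obj C \<and> e \<in> arrows D (fob F X) Y \<and> e' \<in> arrows D Y (fob F X) \<and>
      Cmp D e' e = Ident D (fob F X) \<and> Cmp D e e' = Ident D Y" if "Y \<in> Obj D" for Y
    using ess[OF that] by (fastforce simp: iso_arr_def arrows_def)
  then obtain g e e' where g [simp]: "\<And>Y. Y \<in> Obj D \<Longrightarrow> g Y \<in> Obj C"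
    and e: "\<And>Y. Y \<in> Obj D \<Longrightarrow> e Y \<in> arrows D (fob F (g Y)) Y"
    and e': "\<And>Y. Y \<in> Obj D \<Longrightarrow> e' Y \<in> arrows D Y (fob F (g Y))"
    and e'e [simp]: "\<And>Y. Y \<in> Obj D \<Longrightarrow> Cmp D (e' Y) (e Y) = Ident D (fob F (g Y))"
    and ee' [simp]: "\<And>Y. Y \<in> Obj D \<Longrightarrow> Cmp D (e Y) (e' Y) = Ident D Y"
    by metis
  have [simp]: "e Y \<in> Arr D" "Dom D (e Y) = fob F (g Y)" "Cod D (e Y) = Y"
    "e' Y \<in> Arr D" "Dom D (e' Y) = Y" "Cod D (e' Y) = fob F (g Y)" if "Y \<in> Obj D" for Y
    using e[OF that] e'[OF that] by (simp_all add: arrows_def)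
  \<comment> \<open>the unique arrow \<open>X \<rightarrow> Y\<close> that \<open>F\<close> maps to \<open>h\<close>\<close>
  define L where "L X Y h = inv_into (arrows C X Y) (farr F) h" for X Y h
  have L: "L X Y h \<in> Arr C" "Dom C (L X Y h) = X" "Cod C (L X Y h) = Y" "farr F (L X Y h) = h"
    if "X \<in> Obj C" "Y \<in> Obj C" "h \<in> Arr D" "Dom D h = fob F X" "Cod D h = fob F Y" for X Y h
  proof -
    have h: "h \<in> farr F ` arrows C X Y" using bij[OF that(1,2)] that by (auto simp: bij_betw_def arrows_def)
    show "L X Y h \<in> Arr C" "Dom C (L X Y h) = X" "Cod C (L X Y h) = Y" "farr F (L X Y h) = h"
      using inv_into_into[OF h] f_inv_into_f[OF h] by (simp_all add: L_def arrows_def)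
  qed
  have faithful: "f = f'" if "f \<in> Arr C" "f' \<in> Arr C" "Dom C f = Dom C f'" "Cod C f =
      Cod C f'" "farr F f = farr F f'" for f f'
  proof -
    have "inj_on (farr F) (arrows C (Dom C f) (Cod C f))" using bij that by (simp add: bij_betw_def)
    then show ?thesis using that by (auto simp: arrows_def inj_on_def)
  qed
  define G where "G = \<lparr>fob = \<lambda>Y\<in>Obj D. g Y,
    farr = \<lambda>h\<in>Arr D. L (g (Dom D h)) (g (Cod D h)) (Cmp D (e' (Cod D h)) (Cmp D h (e (Dom D h))))\<rparr>"
  have G_ob [simp]: "fob G Y = g Y" if "Y \<in> Obj D" for Y using that by (simp add: G_def)
  have G: "farr G h \<in> Arr C" "Dom C (farr G h) = g (Dom D h)" "Cod C (farr G h) = g (Cod D h)"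
    "farr F (farr G h) = Cmp D (e' (Cod D h)) (Cmp D h (e (Dom D h)))" if "h \<in> Arr D" for h
    using that L[of "g (Dom D h)" "g (Cod D h)" "Cmp D (e' (Cod D h)) (Cmp D h (e (Dom D h)))"]
        by (simp_all add: G_def)
  have assoc: "Cmp D (Cmp D h k) l = Cmp D h (Cmp D k l)"
    if "h \<in> Arr D" "k \<in> Arr D" "l \<in> Arr D" "Dom D h = Cod D k" "Dom D k = Cod D l" for h k l
    using that by (simp add: F.D.Cmp_assoc)
  have cancel: "Cmp D (e Y) (Cmp D (e' Y) h) = h" if "Y \<in> Obj D" "h \<in> Arr D" "Cod D h = Y" for Y h
    using that F.D.Cmp_Ident_left[of h] by (simp flip: assoc)
  have G_functor: "cat_functor D C G"
  proof (intro cat_functor.intro cat_functor_axioms.intro F.C.category_axioms F.D.category_axioms PiE_I)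
    show "farr G (Ident D Y) = Ident C (fob G Y)" if "Y \<in> Obj D" for Y
      using that F.D.Cmp_Ident_left[of "e Y"] G[of "Ident D Y"] by (intro faithful) simp_all
    show "farr G (Cmp D k h) = Cmp C (farr G k) (farr G h)"
      if hk: "h \<in> Arr D" "k \<in> Arr D" "Dom D k = Cod D h" for h k
    proof (rule faithful)
      show "farr F (farr G (Cmp D k h)) = farr F (Cmp C (farr G k) (farr G h))"
        using hk G[of "Cmp D k h"] G[OF hk(1)] G[OF hk(2)] F.farr_Cmp[of "farr G h" "farr G k"]
        by (simp add: assoc cancel)
    qed (use hk G[of "Cmp D k h"] G[OF hk(1)] G[OF hk(2)] in simp_all)
  qed (use G in \<open>simp_all add: G_def\<close>)
  have "naturally_isomorphic D D (comp_func D F G) (id_func D)"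
    unfolding naturally_isomorphic_def
  proof (intro exI[of _ e] conjI ballI)
    fix Y assume Y: "Y \<in> Obj D"
    then show "e Y \<in> arrows D (fob (comp_func D F G) Y) (fob (id_func D) Y)" by (simp add: arrows_def)
    show "iso_arr D (e Y)"
      unfolding iso_arr_def using Y by (intro conjI bexI[of _ "e' Y"]) (simp_all add: arrows_def)
  next
    fix h assume h: "h \<in> Arr D"
    then show "Cmp D (e (Cod D h)) (farr (comp_func D F G) h) = Cmp D (farr (id_func D) h) (e (Dom D h))"
      by (simp add: G cancel)
  qed
  moreover have "naturally_isomorphic C C (id_func C) (comp_func C G F)"
    unfolding naturally_isomorphic_def
  proof (intro exI[of _ "\<lambda>X. L X (g (fob F X)) (e' (fob F X))"] conjI ballI)
    fix X assume X: "X \<in> Obj C"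
    note l = L[of X "g (fob F X)" "e' (fob F X)"] and l' = L[of "g (fob F X)" X "e (fob F X)"]
    show "L X (g (fob F X)) (e' (fob F X)) \<in> arrows C (fob (id_func C) X) (fob (comp_func C G F) X)"
      using X l by (simp add: arrows_def)
    have "Cmp C (L (g (fob F X)) X (e (fob F X))) (L X (g (fob F X)) (e' (fob F X))) = Ident C X"
      using X l l' F.farr_Cmp[of "L X (g (fob F X)) (e' (fob F X))" "L (g (fob F X)) X (e (fob F X))"]
      by (intro faithful) simp_all
    moreover have "Cmp C (L X (g (fob F X)) (e' (fob F X))) (L (g (fob F X)) X (e (fob F X))) =
        Ident C (g (fob F X))"
      using X l l' F.farr_Cmp[of "L (g (fob F X)) X (e (fob F X))" "L X (g (fob F X)) (e' (fob F X))"]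
      by (intro faithful) simp_all
    ultimately show "iso_arr C (L X (g (fob F X)) (e' (fob F X)))"
      unfolding iso_arr_def using X l l'
      by (intro conjI bexI[of _ "L (g (fob F X)) X (e (fob F X))"]) (simp_all add: arrows_def)
  next
    fix f assume f: "f \<in> Arr C"
    let ?X = "Dom C f" and ?Y = "Cod C f"
    note l = L[of ?X "g (fob F ?X)" "e' (fob F ?X)"] and l' = L[of ?Y "g (fob F ?Y)" "e' (fob F ?Y)"]
    note Gf = G[of "farr F f"]
    have "Cmp C (L ?Y (g (fob F ?Y)) (e' (fob F ?Y))) f =
        Cmp C (farr G (farr F f)) (L ?X (g (fob F ?X)) (e' (fob F ?X)))"
    proof (rule faithful)
      show "farr F (Cmp C (L ?Y (g (fob F ?Y)) (e' (fob F ?Y))) f) =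
          farr F (Cmp C (farr G (farr F f)) (L ?X (g (fob F ?X)) (e' (fob F ?X))))"
        using f l l' Gf F.farr_Cmp[of f "L ?Y (g (fob F ?Y)) (e' (fob F ?Y))"]
          F.farr_Cmp[of "L ?X (g (fob F ?X)) (e' (fob F ?X))" "farr G (farr F f)"]
          F.D.Cmp_Ident_right[of "farr F f"]
        by (simp add: assoc)
    qed (use f l l' Gf in simp_all)
    then show "Cmp C (L (Cod C f) (g (fob F (Cod C f))) (e' (fob F (Cod C f)))) (farr (id_func C) f) =
        Cmp C (farr (comp_func C G F) f) (L (Dom C f) (g (fob F (Dom C f))) (e' (fob F (Dom C f))))"
      using f by simp
  qed
  ultimately show ?thesis
    unfolding cat_equivalence_def using G_functor F.cat_functor_axioms by blast
qed

section \<open>Graded functors\<close>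

lemma hom_index_iff [simp]:
  "(u, A, A') \<in> hom_index U ob \<longleftrightarrow> u \<in> Arr U \<and> A \<in> ob (Dom U u) \<and> A' \<in> ob (Cod U u)"
  by (simp add: hom_index_def)

lemma ob_index_iff [simp]: "(X, A) \<in> ob_index U ob \<longleftrightarrow> X \<in> Obj U \<and> A \<in> ob X"
  by (simp add: ob_index_def)

lemma comp_index_iff [simp]:
  "(u', u, A, A', A'') \<in> comp_index U ob \<longleftrightarrow> u \<in> Arr U \<and> u' \<in> Arr U \<and> Dom U u' = Cod U u \<and>
     A \<in> ob (Dom U u) \<and> A' \<in> ob (Cod U u) \<and> A'' \<in> ob (Cod U u')"
  by (simp add: comp_index_def)

lemma gf_index_apply [simp]:
  "gf_index V F (v, B, B') = (farr (Psi F) v, gf_ob F (Dom V v, B), gf_ob F (Cod V v, B'))"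
  by (simp add: gf_index_def)

lemma linear_map_closed: "linear_map R M N h \<Longrightarrow> x \<in> carrier M \<Longrightarrow> h x \<in> carrier N"
  by (auto simp: linear_map_def)

lemma linear_map_comp:
  assumes "linear_map R L M f" "linear_map R M N g"
  shows "linear_map R L N (\<lambda>x. g (f x))"
  using assms by (simp add: linear_map_def Pi_iff)

text \<open>
  The components of a graded functor are restricted to carriers. Their linearity is obtained from
  that of an unrestricted map, which works because carriers of modules are closed under the
  operations.
\<close>

lemma linear_map_cong:
  assumes "Module.module R M" "linear_map R M N h" "\<And>x. x \<in> carrier M \<Longrightarrow> h' x = h x"
  shows "linear_map R M N h'"
proof -
  interpret Module.module R M by fact
  show ?thesis using assms(2) by (auto simp: linear_map_def assms(3) Pi_iff)
qed

lemma linear_map_id: "linear_map R M M (\<lambda>x. x)"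
  by (simp add: linear_map_def)

lemma bilinear_map_closed:
  "bilinear_map R M N P h \<Longrightarrow> x \<in> carrier M \<Longrightarrow> y \<in> carrier N \<Longrightarrow> h x y \<in> carrier P"
  by (auto simp: bilinear_map_def linear_map_def)

context graded_category begin

declare U.category_axioms [simp] graded_category_axioms [simp]

lemma ghom_module':
  "u \<in> Arr U \<Longrightarrow> A \<in> gob a (Dom U u) \<Longrightarrow> A' \<in> gob a (Cod U u) \<Longrightarrow> Module.module R (ghom a (u, A, A'))"
  by (rule ghom_module) simp

lemma gcomp_closed:
  assumes "u \<in> Arr U" "u' \<in> Arr U" "Dom U u' = Cod U u"
    "A \<in> gob a (Dom U u)" "A' \<in> gob a (Cod U u)" "A'' \<in> gob a (Cod U u')"
    "g \<in> carrier (ghom a (u', A', A''))" "f \<in> carrier (ghom a (u, A, A'))"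
  shows "gcomp a (u', u, A, A', A'') g f \<in> carrier (ghom a (Cmp U u' u, A, A''))"
  using bilinear_map_closed[OF gcomp_bilinear] assms by auto

end

context graded_functor begin

lemmas Psi_simps [simp] = Psi_functor functor_rules[OF Psi_functor]
  comp_func_id_left[OF Psi_functor] comp_func_id_right[OF Psi_functor]

lemma gf_ob_closed' [simp]:
  "Y \<in> Obj V \<Longrightarrow> B \<in> gob b Y \<Longrightarrow> gf_ob F (Y, B) \<in> gob a (fob (Psi F) Y)"
  by (rule gf_ob_closed) simp

lemma gf_ob_Dom_Cod [simp]:
  "v \<in> Arr V \<Longrightarrow> B \<in> gob b (Dom V v) \<Longrightarrow> gf_ob F (Dom V v, B) \<in> gob a (Dom U (farr (Psi F) v))"
  "v \<in> Arr V \<Longrightarrow> B \<in> gob b (Cod V v) \<Longrightarrow> gf_ob F (Cod V v, B) \<in> gob a (Cod U (farr (Psi F) v))"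
  by simp_all

lemma gf_index_closed: "t \<in> hom_index V (gob b) \<Longrightarrow> gf_index V F t \<in> hom_index U (gob a)"
  by (cases t) simp

lemma gf_hom_closed:
  "t \<in> hom_index V (gob b) \<Longrightarrow> f \<in> carrier (ghom b t) \<Longrightarrow>
    gf_hom F t f \<in> carrier (ghom a (gf_index V F t))"
  by (rule linear_map_closed[OF gf_hom_linear])

lemma gf_hom_closed':
  "v \<in> Arr V \<Longrightarrow> B \<in> gob b (Dom V v) \<Longrightarrow> B' \<in> gob b (Cod V v) \<Longrightarrow> f \<in> carrier (ghom b (v, B, B')) \<Longrightarrow>
    gf_hom F (v, B, B') f \<in>
      carrier (ghom a (farr (Psi F) v, gf_ob F (Dom V v, B), gf_ob F (Cod V v, B')))"
  using gf_hom_closed[of "(v, B, B')"] by simp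

end

lemma gfun_eqI:
  assumes "graded_functor R V b U a F" "graded_functor R V b U' a' G"
    and "Psi F = Psi G"
    and "\<And>Y B. Y \<in> Obj V \<Longrightarrow> B \<in> gob b Y \<Longrightarrow> gf_ob F (Y, B) = gf_ob G (Y, B)"
    and "\<And>v B B' f. v \<in> Arr V \<Longrightarrow> B \<in> gob b (Dom V v) \<Longrightarrow> B' \<in> gob b (Cod V v) \<Longrightarrow>
      f \<in> carrier (ghom b (v, B, B')) \<Longrightarrow> gf_hom F (v, B, B') f = gf_hom G (v, B, B') f"
  shows "F = G"
proof (rule gfun.equality)
  show "gf_ob F = gf_ob G"
  proof (rule extensionalityI[of _ "ob_index V (gob b)"])
    fix t assume "t \<in> ob_index V (gob b)"
    then show "gf_ob F t = gf_ob G t" by (cases t) (simp add: assms(4))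
  qed (rule graded_functor.gf_ob_ext[OF assms(1)] graded_functor.gf_ob_ext[OF assms(2)])+
  show "gf_hom F = gf_hom G"
  proof (rule extensionalityI[of _ "hom_index V (gob b)"])
    fix t assume t: "t \<in> hom_index V (gob b)"
    show "gf_hom F t = gf_hom G t"
    proof (rule extensionalityI[of _ "carrier (ghom b t)"])
      fix f assume "f \<in> carrier (ghom b t)"
      then show "gf_hom F t f = gf_hom G t f" using t by (cases t) (simp add: assms(5))
    qed (rule graded_functor.gf_hom_ext'[OF assms(1) t] graded_functor.gf_hom_ext'[OF assms(2) t])+
  qed (rule graded_functor.gf_hom_ext[OF assms(1)] graded_functor.gf_hom_ext[OF assms(2)])+
qed (simp_all add: assms(3))

lemma graded_functorI:
  assumes "graded_category R V b" "graded_category R U a" "cat_functor V U (Psi F)"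
    and "gf_ob F \<in> extensional (ob_index V (gob b))"
    and "\<And>Y B. \<lbrakk>Y \<in> Obj V; B \<in> gob b Y\<rbrakk> \<Longrightarrow> gf_ob F (Y, B) \<in> gob a (fob (Psi F) Y)"
    and "gf_hom F \<in> extensional (hom_index V (gob b))"
    and "\<And>v B B'. \<lbrakk>v \<in> Arr V; B \<in> gob b (Dom V v); B' \<in> gob b (Cod V v)\<rbrakk> \<Longrightarrow>
      gf_hom F (v, B, B') \<in> extensional (carrier (ghom b (v, B, B')))"
    and "\<And>v B B'. \<lbrakk>v \<in> Arr V; B \<in> gob b (Dom V v); B' \<in> gob b (Cod V v)\<rbrakk> \<Longrightarrow>
      linear_map R (ghom b (v, B, B'))
        (ghom a (farr (Psi F) v, gf_ob F (Dom V v, B), gf_ob F (Cod V v, B'))) (gf_hom F (v, B, B'))"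
    and "\<And>Y B. \<lbrakk>Y \<in> Obj V; B \<in> gob b Y\<rbrakk> \<Longrightarrow>
      gf_hom F (Ident V Y, B, B) (gid b (Y, B)) = gid a (fob (Psi F) Y, gf_ob F (Y, B))"
    and "\<And>v' v B B' B'' f g. \<lbrakk>v \<in> Arr V; v' \<in> Arr V; Dom V v' = Cod V v;
        B \<in> gob b (Dom V v); B' \<in> gob b (Cod V v); B'' \<in> gob b (Cod V v');
        f \<in> carrier (ghom b (v, B, B')); g \<in> carrier (ghom b (v', B', B''))\<rbrakk> \<Longrightarrow>
      gf_hom F (Cmp V v' v, B, B'') (gcomp b (v', v, B, B', B'') g f) =
      gcomp a (farr (Psi F) v', farr (Psi F) v,
          gf_ob F (Dom V v, B), gf_ob F (Cod V v, B'), gf_ob F (Cod V v', B''))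
        (gf_hom F (v', B', B'') g) (gf_hom F (v, B, B') f)"
  shows "graded_functor R V b U a F"
  using assms by (auto intro!: graded_functor.intro graded_functor_axioms.intro
      simp: ob_index_def hom_index_def comp_index_def)

lemma id_gfun_apply [simp]:
  "Psi (id_gfun U a) = id_func U"
  "X \<in> Obj U \<Longrightarrow> A \<in> gob a X \<Longrightarrow> gf_ob (id_gfun U a) (X, A) = A"
  "u \<in> Arr U \<Longrightarrow> A \<in> gob a (Dom U u) \<Longrightarrow> A' \<in> gob a (Cod U u) \<Longrightarrow> f \<in> carrier (ghom a (u, A, A')) \<Longrightarrow>
    gf_hom (id_gfun U a) (u, A, A') f = f"
  by (simp_all add: id_gfun_def)

lemma id_gfun_graded [simp]:
  assumes "graded_category R U a" shows "graded_functor R U a U a (id_gfun U a)"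
proof -
  interpret graded_category R U a by fact
  show ?thesis
  proof (rule graded_functorI, goal_cases)
    case 8
    then show ?case
      by (simp, intro linear_map_cong[OF _ linear_map_id] ghom_module') auto
  qed (auto simp: id_gfun_def gid_closed gcomp_closed)
qed

lemma comp_gfun_Psi [simp]: "Psi (comp_gfun W c G F) = comp_func W (Psi G) (Psi F)"
  by (simp add: comp_gfun_def)

lemma comp_gfun_ob [simp]:
  "X \<in> Obj W \<Longrightarrow> C \<in> gob c X \<Longrightarrow>
    gf_ob (comp_gfun W c G F) (X, C) = gf_ob G (fob (Psi F) X, gf_ob F (X, C))"
  by (simp add: comp_gfun_def)

lemma comp_gfun_hom [simp]:
  "w \<in> Arr W \<Longrightarrow> C \<in> gob c (Dom W w) \<Longrightarrow> C' \<in> gob c (Cod W w) \<Longrightarrow> f \<in> carrier (ghom c (w, C, C')) \<Longrightarrow>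
    gf_hom (comp_gfun W c G F) (w, C, C') f =
      gf_hom G (farr (Psi F) w, gf_ob F (Dom W w, C), gf_ob F (Cod W w, C')) (gf_hom F (w, C, C') f)"
  by (simp add: comp_gfun_def)

lemma comp_gfun_graded:
  assumes F: "graded_functor R W c V b F" and G: "graded_functor R V b U a G"
  shows "graded_functor R W c U a (comp_gfun W c G F)"
proof -
  interpret F: graded_functor R W c V b F by fact
  interpret G: graded_functor R V b U a G by fact
  show ?thesis
  proof (rule graded_functorI, goal_cases)
    case (8 w C C')
    let ?t = "(w, C, C')"
    have t: "?t \<in> hom_index W (gob c)" using 8 by simp
    have lin: "linear_map R (ghom c ?t) (ghom a (gf_index V G (gf_index W F ?t)))
        (\<lambda>f. gf_hom G (gf_index W F ?t) (gf_hom F ?t f))"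
      using F.gf_hom_linear[OF t] G.gf_hom_linear[OF F.gf_index_closed[OF t]]
      by (rule linear_map_comp)
    show ?case
      by (rule linear_map_cong[OF F.B.ghom_module[OF t]]) (use 8 lin in auto)
  next
    case (9 X C)
    then show ?case
      using F.gf_hom_gid[of X C] G.gf_hom_gid[of "fob (Psi F) X" "gf_ob F (X, C)"]
      by (simp add: F.B.gid_closed)
  next
    case (10 w' w C C' C'' f g)
    have cl: "gf_hom F (w, C, C') f \<in> carrier (ghom b (gf_index W F (w, C, C')))"
      "gf_hom F (w', C', C'') g \<in> carrier (ghom b (gf_index W F (w', C', C'')))"
      by (rule F.gf_hom_closed; use 10 in simp)+
    have "gf_hom F (Cmp W w' w, C, C'') (gcomp c (w', w, C, C', C'') g f) =
      gcomp b (farr (Psi F) w', farr (Psi F) w,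
          gf_ob F (Dom W w, C), gf_ob F (Cod W w, C'), gf_ob F (Cod W w', C''))
        (gf_hom F (w', C', C'') g) (gf_hom F (w, C, C') f)"
      using 10 by (intro F.gf_hom_gcomp) auto
    then show ?case
      using 10 cl by (simp add: F.B.gcomp_closed G.gf_hom_gcomp)
  qed (auto simp: comp_gfun_def intro: comp_func_functor[OF F.Psi_functor G.Psi_functor])
qed

lemma comp_gfun_id_right [simp]:
  assumes "graded_functor R V b U a F" shows "comp_gfun V b F (id_gfun V b) = F"
proof -
  interpret graded_functor R V b U a F by fact
  show ?thesis
    by (rule gfun_eqI[OF comp_gfun_graded[OF id_gfun_graded assms] assms]) simp_all
qed

lemma comp_gfun_id_left [simp]:
  assumes "graded_functor R V b U a F" shows "comp_gfun V b (id_gfun U a) F = F"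
proof -
  interpret graded_functor R V b U a F by fact
  show ?thesis
    by (rule gfun_eqI[OF comp_gfun_graded[OF assms id_gfun_graded] assms])
       (simp_all add: gf_hom_closed' flip: Psi_simps(4,5))
qed

lemma comp_gfun_assoc:
  assumes F: "graded_functor R X d W c F" and G: "graded_functor R W c V b G"
    and H: "graded_functor R V b U a H"
  shows "comp_gfun X d H (comp_gfun X d G F) = comp_gfun X d (comp_gfun W c H G) F"
proof -
  interpret F: graded_functor R X d W c F by fact
  interpret G: graded_functor R W c V b G by fact
  interpret H: graded_functor R V b U a H by fact
  show ?thesis
    using comp_gfun_graded[OF comp_gfun_graded[OF F G] H]
      comp_gfun_graded[OF F comp_gfun_graded[OF G H]]
    by (rule gfun_eqI)
      (simp_all add: comp_func_assoc[OF F.Psi_functor G.Psi_functor H.Psi_functor] F.gf_hom_closed')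
qed

lemma Map'_sel:
  "Obj (Map' R U) = {a. graded_category R U a}"
  "(a, F, b) \<in> Arr (Map' R U) \<longleftrightarrow> graded_functor R U a U b F \<and> Psi F = id_func U"
  "Dom (Map' R U) (a, F, b) = a" "Cod (Map' R U) (a, F, b) = b"
  "Ident (Map' R U) a = (a, id_gfun U a, a)"
  "Cmp (Map' R U) (b', G, c) (a, F, b) = (a, comp_gfun U a G F, c)"
  by (simp_all add: Map'_def)

lemma Map'_category:
  assumes U: "category U" shows "category (Map' R U)"
proof (rule category.intro, goal_cases)
  case (6 f g) then show ?case
    using U by (cases f; cases g) (auto simp: Map'_sel intro: comp_gfun_graded)
next
  case (11 f g h) then show ?case
    by (cases f; cases g; cases h) (auto simp: Map'_sel intro!: comp_gfun_assoc)
qed (use U in \<open>auto simp: Map'_sel graded_functor_def split: prod.splits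
      intro!: comp_gfun_id_left comp_gfun_id_right intro: graded_functor.axioms(3)[OF id_gfun_graded]\<close>)

section \<open>Restriction along functors\<close>

lemma graded_categoryI:
  assumes "cring R" "category U"
    and "gob a \<in> extensional (Obj U)" "ghom a \<in> extensional (hom_index U (gob a))"
    and "gcomp a \<in> extensional (comp_index U (gob a))" "gid a \<in> extensional (ob_index U (gob a))"
    and "\<And>u A A'. \<lbrakk>u \<in> Arr U; A \<in> gob a (Dom U u); A' \<in> gob a (Cod U u)\<rbrakk> \<Longrightarrow>
      Module.module R (ghom a (u, A, A'))"
    and "\<And>u' u A A' A''. \<lbrakk>u \<in> Arr U; u' \<in> Arr U; Dom U u' = Cod U u;
        A \<in> gob a (Dom U u); A' \<in> gob a (Cod U u); A'' \<in> gob a (Cod U u')\<rbrakk> \<Longrightarrow>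
      bilinear_map R (ghom a (u', A', A'')) (ghom a (u, A, A')) (ghom a (Cmp U u' u, A, A''))
        (gcomp a (u', u, A, A', A''))"
    and "\<And>X A. \<lbrakk>X \<in> Obj U; A \<in> gob a X\<rbrakk> \<Longrightarrow> gid a (X, A) \<in> carrier (ghom a (Ident U X, A, A))"
    and "\<And>u A A' f. \<lbrakk>u \<in> Arr U; A \<in> gob a (Dom U u); A' \<in> gob a (Cod U u);
        f \<in> carrier (ghom a (u, A, A'))\<rbrakk> \<Longrightarrow>
      gcomp a (u, Ident U (Dom U u), A, A, A') f (gid a (Dom U u, A)) = f"
    and "\<And>u A A' f. \<lbrakk>u \<in> Arr U; A \<in> gob a (Dom U u); A' \<in> gob a (Cod U u);
        f \<in> carrier (ghom a (u, A, A'))\<rbrakk> \<Longrightarrow>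
      gcomp a (Ident U (Cod U u), u, A, A', A') (gid a (Cod U u, A')) f = f"
    and "\<And>u u' u'' A A' A'' A''' f g h. \<lbrakk>u \<in> Arr U; u' \<in> Arr U; u'' \<in> Arr U;
        Dom U u' = Cod U u; Dom U u'' = Cod U u'; A \<in> gob a (Dom U u); A' \<in> gob a (Cod U u);
        A'' \<in> gob a (Cod U u'); A''' \<in> gob a (Cod U u'');
        f \<in> carrier (ghom a (u, A, A')); g \<in> carrier (ghom a (u', A', A''));
        h \<in> carrier (ghom a (u'', A'', A'''))\<rbrakk> \<Longrightarrow>
      gcomp a (u'', Cmp U u' u, A, A'', A''') h (gcomp a (u', u, A, A', A'') g f) =
      gcomp a (Cmp U u'' u', u, A, A', A''') (gcomp a (u'', u', A', A'', A''') h g) f"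
  shows "graded_category R U a"
  using assms by (auto intro!: graded_category.intro graded_category_axioms.intro
      simp: ob_index_def hom_index_def comp_index_def)

lemma gcat_eqI:
  assumes a: "graded_category R U a" and b: "graded_category R U b"
    and ob: "\<And>X. X \<in> Obj U \<Longrightarrow> gob a X = gob b X"
    and hom: "\<And>u A A'. \<lbrakk>u \<in> Arr U; A \<in> gob a (Dom U u); A' \<in> gob a (Cod U u)\<rbrakk> \<Longrightarrow>
      ghom a (u, A, A') = ghom b (u, A, A')"
    and comp: "\<And>u' u A A' A''. \<lbrakk>u \<in> Arr U; u' \<in> Arr U; Dom U u' = Cod U u;
        A \<in> gob a (Dom U u); A' \<in> gob a (Cod U u); A'' \<in> gob a (Cod U u')\<rbrakk> \<Longrightarrow>
      gcomp a (u', u, A, A', A'') = gcomp b (u', u, A, A', A'')"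
    and id: "\<And>X A. \<lbrakk>X \<in> Obj U; A \<in> gob a X\<rbrakk> \<Longrightarrow> gid a (X, A) = gid b (X, A)"
  shows "a = b"
proof (rule gcat.equality)
  interpret a: graded_category R U a by fact
  interpret b: graded_category R U b by fact
  show gob: "gob a = gob b"
    by (rule extensionalityI[OF a.gob_ext b.gob_ext ob])
  show "ghom a = ghom b"
  proof (rule extensionalityI[OF a.ghom_ext])
    show "ghom a t = ghom b t" if "t \<in> hom_index U (gob a)" for t
      using that by (cases t) (simp add: hom)
  qed (simp add: gob b.ghom_ext)
  show "gcomp a = gcomp b"
  proof (rule extensionalityI[OF a.gcomp_ext])
    show "gcomp a t = gcomp b t" if "t \<in> comp_index U (gob a)" for t
      using that by (cases t) (simp add: comp)
  qed (simp add: gob b.gcomp_ext)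
  show "gid a = gid b"
  proof (rule extensionalityI[OF a.gid_ext])
    show "gid a t = gid b t" if "t \<in> ob_index U (gob a)" for t
      using that by (cases t) (simp add: id)
  qed (simp add: gob b.gid_ext)
qed simp

lemma gob_pull [simp]: "Y \<in> Obj V \<Longrightarrow> gob (pull V \<phi> a) Y = gob a (fob \<phi> Y)"
  by (simp add: pull_def Let_def)

lemma pull_apply [simp]:
  assumes "category V"
  shows "\<lbrakk>v \<in> Arr V; A \<in> gob a (fob \<phi> (Dom V v)); A' \<in> gob a (fob \<phi> (Cod V v))\<rbrakk> \<Longrightarrow>
      ghom (pull V \<phi> a) (v, A, A') = ghom a (farr \<phi> v, A, A')"
    and "\<lbrakk>v \<in> Arr V; v' \<in> Arr V; Dom V v' = Cod V v; A \<in> gob a (fob \<phi> (Dom V v));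
        A' \<in> gob a (fob \<phi> (Cod V v)); A'' \<in> gob a (fob \<phi> (Cod V v'))\<rbrakk> \<Longrightarrow>
      gcomp (pull V \<phi> a) (v', v, A, A', A'') = gcomp a (farr \<phi> v', farr \<phi> v, A, A', A'')"
    and "\<lbrakk>Y \<in> Obj V; A \<in> gob a (fob \<phi> Y)\<rbrakk> \<Longrightarrow> gid (pull V \<phi> a) (Y, A) = gid a (fob \<phi> Y, A)"
  using assms by (simp_all add: pull_def Let_def)

lemma pull_graded [simp]:
  assumes \<phi>: "cat_functor V U \<phi>" and a: "graded_category R U a"
  shows "graded_category R V (pull V \<phi> a)"
proof -
  interpret graded_category R U a by fact
  have V [simp]: "category V" using \<phi> by (rule cat_functor_source)
  note [simp] = functor_rules[OF \<phi>]
  have bil: "bilinear_map R (ghom a (farr \<phi> v', A', A'')) (ghom a (farr \<phi> v, A, A'))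
      (ghom a (Cmp U (farr \<phi> v') (farr \<phi> v), A, A'')) (gcomp a (farr \<phi> v', farr \<phi> v, A, A', A''))"
    if "v \<in> Arr V" "v' \<in> Arr V" "Dom V v' = Cod V v" "A \<in> gob a (fob \<phi> (Dom V v))"
      "A' \<in> gob a (fob \<phi> (Cod V v))" "A'' \<in> gob a (fob \<phi> (Cod V v'))" for v' v A A' A''
    using gcomp_bilinear[of "farr \<phi> v'" "farr \<phi> v" A A' A''] that by simp
  have right: "gcomp a (farr \<phi> v, Ident U (fob \<phi> (Dom V v)), A, A, A') f
      (gid a (fob \<phi> (Dom V v), A)) = f"
    and left: "gcomp a (Ident U (fob \<phi> (Cod V v)), farr \<phi> v, A, A', A')
      (gid a (fob \<phi> (Cod V v), A')) f = f"
    if "v \<in> Arr V" "A \<in> gob a (fob \<phi> (Dom V v))" "A' \<in> gob a (fob \<phi> (Cod V v))"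
      "f \<in> carrier (ghom a (farr \<phi> v, A, A'))" for v A A' f
    using gcomp_gid_right[of "farr \<phi> v" A A' f] gcomp_gid_left[of "farr \<phi> v" A A' f] that by simp_all
  show ?thesis
  proof (rule graded_categoryI, goal_cases)
    case (12 v v' v'' A A' A'' A''' f g h)
    then show ?case
      using gcomp_assoc[of "farr \<phi> v'" "farr \<phi> v" A A' A'' "farr \<phi> v''" A''' f g h] by simp
  qed (simp_all add: bil right left R.is_cring, simp_all add: pull_def Let_def gid_closed ghom_module')
qed

lemma pull_id [simp]:
  assumes "graded_category R U a" shows "pull U (id_func U) a = a"
proof -
  interpret graded_category R U a by fact
  show ?thesis
    by (rule gcat_eqI[OF pull_graded[OF id_func_functor assms] assms]) simp_all
qed

text \<open>
  The two sides are equal rather than merely isomorphic because restriction copies data of \<open>a\<close> and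
  is cut down to the same index sets. This is why no coherence isomorphisms occur below.
\<close>

lemma pull_pull:
  assumes \<phi>: "cat_functor V U \<phi>" and \<psi>: "cat_functor W V \<psi>" and a: "graded_category R U a"
  shows "pull W \<psi> (pull V \<phi> a) = pull W (comp_func W \<phi> \<psi>) a"
proof -
  have [simp]: "category W" "category V"
    using \<phi> \<psi> by (auto intro: cat_functor_source)
  note [simp] = functor_rules[OF \<psi>]
  show ?thesis
    by (rule gcat_eqI[OF pull_graded[OF \<psi> pull_graded[OF \<phi> a]]
          pull_graded[OF comp_func_functor[OF \<psi> \<phi>] a]]) simp_all
qed

lemma delta_apply [simp]:
  "Psi (delta V \<phi> a) = \<phi>"
  "Y \<in> Obj V \<Longrightarrow> A \<in> gob a (fob \<phi> Y) \<Longrightarrow> gf_ob (delta V \<phi> a) (Y, A) = A"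
  "category V \<Longrightarrow> v \<in> Arr V \<Longrightarrow> A \<in> gob a (fob \<phi> (Dom V v)) \<Longrightarrow> A' \<in> gob a (fob \<phi> (Cod V v)) \<Longrightarrow>
    f \<in> carrier (ghom a (farr \<phi> v, A, A')) \<Longrightarrow> gf_hom (delta V \<phi> a) (v, A, A') f = f"
  by (simp_all add: delta_def)

lemma delta_graded [simp]:
  assumes \<phi>: "cat_functor V U \<phi>" and a: "graded_category R U a"
  shows "graded_functor R V (pull V \<phi> a) U a (delta V \<phi> a)"
proof -
  interpret graded_category R U a by fact
  interpret p: graded_category R V "pull V \<phi> a" using assms by simp
  note [simp] = functor_rules[OF \<phi>]
  show ?thesis
  proof (rule graded_functorI, goal_cases)
    case (8 v A A')
    have lin: "linear_map R (ghom (pull V \<phi> a) (v, A, A')) (ghom a (farr \<phi> v, A, A')) (\<lambda>f. f)"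
      using 8 by (simp add: linear_map_id)
    have M: "Module.module R (ghom (pull V \<phi> a) (v, A, A'))"
      using 8 by (intro p.ghom_module') simp_all
    have "linear_map R (ghom (pull V \<phi> a) (v, A, A')) (ghom a (farr \<phi> v, A, A'))
        (gf_hom (delta V \<phi> a) (v, A, A'))"
      by (rule linear_map_cong[OF M lin]) (use 8 in simp)
    then show ?case using 8 by simp
  next
    case (10 v' v A A' A'' f g)
    then show ?case
      using gcomp_closed[of "farr \<phi> v" "farr \<phi> v'" A A' A'' g f] by simp
  qed (use \<phi> gid_closed in \<open>simp_all add: delta_def\<close>)
qed

text \<open>Since $\delta$ is given by identities, the factorisation of \<open>H\<close> through it has the same
  components as \<open>H\<close>.\<close>

definition lift :: "('wo, 'wa, 'vo, 'va) func \<Rightarrow> ('wo, 'wa, 'uo, 'ua, 'x, 'm) gfun \<Rightarrow>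
    ('wo, 'wa, 'vo, 'va, 'x, 'm) gfun" where
  "lift \<chi> H = \<lparr>Psi = \<chi>, gf_ob = gf_ob H, gf_hom = gf_hom H\<rparr>"

lemma lift_apply [simp]: "Psi (lift \<chi> H) = \<chi>" "gf_ob (lift \<chi> H) = gf_ob H" "gf_hom (lift \<chi> H) = gf_hom H"
  by (simp_all add: lift_def)

lemma lift_graded:
  assumes \<phi>: "cat_functor V U \<phi>" and \<chi>: "cat_functor W V \<chi>"
    and H: "graded_functor R W c U a H" and Psi_H: "Psi H = comp_func W \<phi> \<chi>"
  shows "graded_functor R W c V (pull V \<phi> a) (lift \<chi> H)"
proof -
  interpret H: graded_functor R W c U a H by fact
  have [simp]: "category V" using \<phi> by (rule cat_functor_source)
  note [simp] = functor_rules[OF \<chi>]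
  have ob: "gf_ob H (Y, C) \<in> gob a (fob \<phi> (fob \<chi> Y))" if "Y \<in> Obj W" "C \<in> gob c Y" for Y C
    using H.gf_ob_closed'[of Y C] that by (simp add: Psi_H)
  show ?thesis
  proof (rule graded_functorI, goal_cases)
    case (8 w C C')
    then show ?case
      using H.gf_hom_linear[of "(w, C, C')"] by (simp add: ob Psi_H)
  next
    case (9 Y C)
    then show ?case using H.gf_hom_gid[of Y C] by (simp add: ob Psi_H)
  next
    case (10 w' w C C' C'' f g)
    then show ?case using H.gf_hom_gcomp[of w' w C C' C'' f g] by (simp add: ob Psi_H)
  qed (use \<phi> \<chi> in \<open>simp_all add: ob H.gf_ob_ext H.gf_hom_ext H.gf_hom_ext'\<close>)
qed

text \<open>
  Composing with \<open>\<delta>\<close> changes a graded functor only over the base; both halves of the cartesian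
  property are read off from this.
\<close>

lemma comp_delta_apply:
  assumes \<phi>: "cat_functor V U \<phi>" and G: "graded_functor R W c V (pull V \<phi> a) G"
  shows "\<lbrakk>Y \<in> Obj W; C \<in> gob c Y\<rbrakk> \<Longrightarrow> gf_ob (comp_gfun W c (delta V \<phi> a) G) (Y, C) = gf_ob G (Y, C)"
    and "\<lbrakk>w \<in> Arr W; C \<in> gob c (Dom W w); C' \<in> gob c (Cod W w); f \<in> carrier (ghom c (w, C, C'))\<rbrakk> \<Longrightarrow>
      gf_hom (comp_gfun W c (delta V \<phi> a) G) (w, C, C') f = gf_hom G (w, C, C') f"
proof -
  interpret G: graded_functor R W c V "pull V \<phi> a" G by fact
  have ob: "gf_ob G (Y, C) \<in> gob a (fob \<phi> (fob (Psi G) Y))" if "Y \<in> Obj W" "C \<in> gob c Y" for Y C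
    using G.gf_ob_closed'[of Y C] that by simp
  show "gf_ob (comp_gfun W c (delta V \<phi> a) G) (Y, C) = gf_ob G (Y, C)"
    if "Y \<in> Obj W" "C \<in> gob c Y" for Y C
    using that by (simp add: ob)
  show "gf_hom (comp_gfun W c (delta V \<phi> a) G) (w, C, C') f = gf_hom G (w, C, C') f"
    if "w \<in> Arr W" "C \<in> gob c (Dom W w)" "C' \<in> gob c (Cod W w)" "f \<in> carrier (ghom c (w, C, C'))"
    for w C C' f
    using that G.gf_hom_closed'[OF that] by (simp add: ob)
qed

lemma delta_comp_lift:
  assumes \<phi>: "cat_functor V U \<phi>" and \<chi>: "cat_functor W V \<chi>"
    and H: "graded_functor R W c U a H" and Psi_H: "Psi H = comp_func W \<phi> \<chi>"
  shows "comp_gfun W c (delta V \<phi> a) (lift \<chi> H) = H"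
proof -
  have a: "graded_category R U a" using H by (simp add: graded_functor_def)
  note L = lift_graded[OF assms]
  show ?thesis
    by (rule gfun_eqI[OF comp_gfun_graded[OF L delta_graded[OF \<phi> a]] H])
      (simp_all only: comp_delta_apply[OF \<phi> L] lift_apply comp_gfun_Psi delta_apply Psi_H)
qed

lemma lift_delta_comp:
  assumes \<phi>: "cat_functor V U \<phi>" and a: "graded_category R U a"
    and G: "graded_functor R W c V (pull V \<phi> a) G"
  shows "lift (Psi G) (comp_gfun W c (delta V \<phi> a) G) = G"
proof -
  interpret G: graded_functor R W c V "pull V \<phi> a" G by fact
  show ?thesis
    by (rule gfun_eqI[OF lift_graded[OF \<phi> G.Psi_functor comp_gfun_graded[OF G delta_graded[OF \<phi> a]]] G])
       (simp_all only: comp_delta_apply[OF \<phi> G] lift_apply comp_gfun_Psi delta_apply)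
qed

lemma ex1_lift:
  assumes \<phi>: "cat_functor V U \<phi>" and \<chi>: "cat_functor W V \<chi>"
    and H: "graded_functor R W c U a H" and Psi_H: "Psi H = comp_func W \<phi> \<chi>"
  shows "\<exists>!G. graded_functor R W c V (pull V \<phi> a) G \<and> Psi G = \<chi> \<and> comp_gfun W c (delta V \<phi> a) G = H"
proof (rule ex1I[of _ "lift \<chi> H"])
  show "graded_functor R W c V (pull V \<phi> a) (lift \<chi> H) \<and> Psi (lift \<chi> H) = \<chi> \<and>
      comp_gfun W c (delta V \<phi> a) (lift \<chi> H) = H"
    using lift_graded[OF assms] delta_comp_lift[OF assms] by simp
  have a: "graded_category R U a" using H by (simp add: graded_functor_def)
  show "G = lift \<chi> H"
    if "graded_functor R W c V (pull V \<phi> a) G \<and> Psi G = \<chi> \<and> comp_gfun W c (delta V \<phi> a) G = H" for G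
    using lift_delta_comp[OF \<phi> a, of W c G] that by simp
qed

lemma delta_cartesian:
  assumes \<phi>: "cat_functor V U \<phi>"
  shows "cartesian_wrt R W c V (pull V \<phi> a) U a (delta V \<phi> a)"
  unfolding cartesian_wrt_def delta_apply by (intro allI impI ex1_lift[OF \<phi>]) simp_all

text \<open>
  To evaluate a definite description of a factorisation through \<open>\<delta>\<close>, it is enough to exhibit one.
\<close>

lemma the_lift:
  assumes "cat_functor V U \<phi>" "cat_functor W V (Psi G)" "graded_functor R W c U a H"
    and "graded_functor R W c V (pull V \<phi> a) G" "comp_gfun W c (delta V \<phi> a) G = H"
  shows "(THE G'. graded_functor R W c V (pull V \<phi> a) G' \<and> Psi G' = Psi G \<and>
      comp_gfun W c (delta V \<phi> a) G' = H) = G"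
  by (rule the1_equality[OF ex1_lift]) (use assms in auto)

section \<open>Strict functoriality\<close>

text \<open>
  This is $F^\varphi$. By the definition of \<open>lift\<close>, its components are those of \<open>F\<close> at the images
  under \<open>\<phi>\<close>.
\<close>

definition res_gfun :: "('vo, 'va) cat \<Rightarrow> ('vo, 'va, 'uo, 'ua) func \<Rightarrow> ('uo, 'ua, 'x, 'k, 'm) gcat \<Rightarrow>
    ('uo, 'ua, 'uo, 'ua, 'x, 'm) gfun \<Rightarrow> ('vo, 'va, 'vo, 'va, 'x, 'm) gfun" where
  "res_gfun V \<phi> a F = lift (id_func V) (comp_gfun V (pull V \<phi> a) F (delta V \<phi> a))"

lemma res_gfun_apply [simp]:
  assumes "category V"
  shows "Psi (res_gfun V \<phi> a F) = id_func V"
    and "\<lbrakk>Y \<in> Obj V; A \<in> gob a (fob \<phi> Y)\<rbrakk> \<Longrightarrow> gf_ob (res_gfun V \<phi> a F) (Y, A) = gf_ob F (fob \<phi> Y, A)"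
    and "\<lbrakk>v \<in> Arr V; A \<in> gob a (fob \<phi> (Dom V v)); A' \<in> gob a (fob \<phi> (Cod V v));
        f \<in> carrier (ghom a (farr \<phi> v, A, A'))\<rbrakk> \<Longrightarrow>
      gf_hom (res_gfun V \<phi> a F) (v, A, A') f = gf_hom F (farr \<phi> v, A, A') f"
  using assms by (simp_all add: res_gfun_def)

lemma
  assumes \<phi>: "cat_functor V U \<phi>" and F: "graded_functor R U a U b F" and Psi: "Psi F = id_func U"
  shows res_gfun_graded: "graded_functor R V (pull V \<phi> a) V (pull V \<phi> b) (res_gfun V \<phi> a F)"
    and delta_comp_res: "comp_gfun V (pull V \<phi> a) (delta V \<phi> b) (res_gfun V \<phi> a F) =
      comp_gfun V (pull V \<phi> a) F (delta V \<phi> a)"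
proof -
  have V: "category V" using \<phi> by (rule cat_functor_source)
  have a: "graded_category R U a" using F by (simp add: graded_functor_def)
  have "Psi (comp_gfun V (pull V \<phi> a) F (delta V \<phi> a)) = comp_func V \<phi> (id_func V)"
    using \<phi> by (simp add: Psi)
  note args = \<phi> id_func_functor[OF V] comp_gfun_graded[OF delta_graded[OF \<phi> a] F] this
  show "graded_functor R V (pull V \<phi> a) V (pull V \<phi> b) (res_gfun V \<phi> a F)"
    unfolding res_gfun_def by (rule lift_graded[OF args])
  show "comp_gfun V (pull V \<phi> a) (delta V \<phi> b) (res_gfun V \<phi> a F) =
      comp_gfun V (pull V \<phi> a) F (delta V \<phi> a)"
    unfolding res_gfun_def by (rule delta_comp_lift[OF args])
qed

lemma Map'_functor_ob [simp]:
  "graded_category R U a \<Longrightarrow> fob (Map'_functor R V U \<phi>) a = pull V \<phi> a"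
  by (simp add: Map'_functor_def Map'_sel)

lemma Map'_functor_arr:
  assumes \<phi>: "cat_functor V U \<phi>" and F: "graded_functor R U a U b F" and Psi: "Psi F = id_func U"
  shows "farr (Map'_functor R V U \<phi>) (a, F, b) = (pull V \<phi> a, res_gfun V \<phi> a F, pull V \<phi> b)"
proof -
  have V [simp]: "category V" using \<phi> by (rule cat_functor_source)
  have a: "graded_category R U a" using F by (simp add: graded_functor_def)
  have "(THE G. graded_functor R V (pull V \<phi> a) V (pull V \<phi> b) G \<and> Psi G = id_func V \<and>
      comp_gfun V (pull V \<phi> a) (delta V \<phi> b) G = comp_gfun V (pull V \<phi> a) F (delta V \<phi> a)) =
    res_gfun V \<phi> a F"
    using the_lift[OF \<phi> _ comp_gfun_graded[OF delta_graded[OF \<phi> a] F]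
        res_gfun_graded[OF assms] delta_comp_res[OF assms]] by simp
  then show ?thesis
    using F Psi by (simp add: Map'_functor_def Map'_sel)
qed

lemma Map'_arr_cases:
  assumes "f \<in> Arr (Map' R U)"
  obtains a F b where "f = (a, F, b)" "graded_functor R U a U b F" "Psi F = id_func U"
    "graded_category R U a" "graded_category R U b"
  using assms by (cases f) (auto simp: Map'_sel graded_functor_def)

lemma Map'_functor_functor [intro]:
  assumes \<phi>: "cat_functor V U \<phi>"
  shows "cat_functor (Map' R U) (Map' R V) (Map'_functor R V U \<phi>)"
proof -
  have V [simp]: "category V" and U [simp]: "category U"
    using \<phi> by (rule cat_functor_source, rule cat_functor_target)
  note [simp] = functor_rules[OF \<phi>]
  have arr: "farr (Map'_functor R V U \<phi>) f \<in> Arr (Map' R V)"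
    "Dom (Map' R V) (farr (Map'_functor R V U \<phi>) f) = fob (Map'_functor R V U \<phi>) (Dom (Map' R U) f)"
    "Cod (Map' R V) (farr (Map'_functor R V U \<phi>) f) = fob (Map'_functor R V U \<phi>) (Cod (Map' R U) f)"
    if f: "f \<in> Arr (Map' R U)" for f
    using f by (auto elim!: Map'_arr_cases simp: Map'_sel Map'_functor_arr[OF \<phi>] res_gfun_graded[OF \<phi>])
  show ?thesis
  proof (intro cat_functor.intro cat_functor_axioms.intro Map'_category U V arr)
    show "fob (Map'_functor R V U \<phi>) \<in> Obj (Map' R U) \<rightarrow>\<^sub>E Obj (Map' R V)"
      using \<phi> by (auto simp: Map'_functor_def Map'_sel intro!: pull_graded)
    show "farr (Map'_functor R V U \<phi>) \<in> Arr (Map' R U) \<rightarrow>\<^sub>E Arr (Map' R V)"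
      by (intro PiE_I arr(1)) (simp_all add: Map'_functor_def)
  next
    fix a assume "a \<in> Obj (Map' R U)"
    then have a: "graded_category R U a" by (simp add: Map'_sel)
    have "res_gfun V \<phi> a (id_gfun U a) = id_gfun V (pull V \<phi> a)"
      by (rule gfun_eqI[OF res_gfun_graded[OF \<phi> id_gfun_graded[OF a] id_gfun_apply(1)]
            id_gfun_graded[OF pull_graded[OF \<phi> a]]]) simp_all
    then show "farr (Map'_functor R V U \<phi>) (Ident (Map' R U) a) =
        Ident (Map' R V) (fob (Map'_functor R V U \<phi>) a)"
      using a by (simp add: Map'_sel Map'_functor_arr[OF \<phi>])
  next
    fix f g
    assume "f \<in> Arr (Map' R U)" "g \<in> Arr (Map' R U)" "Dom (Map' R U) g = Cod (Map' R U) f"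
    then obtain a F b G c where fg: "f = (a, F, b)" "g = (b, G, c)"
      and F: "graded_functor R U a U b F" "Psi F = id_func U"
      and G: "graded_functor R U b U c G" "Psi G = id_func U"
      by (auto elim!: Map'_arr_cases simp: Map'_sel)
    have GF: "graded_functor R U a U c (comp_gfun U a G F)" "Psi (comp_gfun U a G F) = id_func U"
      using comp_gfun_graded[OF F(1) G(1)] by (simp_all add: F(2) G(2))
    interpret F: graded_functor R U a U b F by (rule F)
    have ob: "gf_ob F (Y, A) \<in> gob b Y" if "Y \<in> Obj U" "A \<in> gob a Y" for Y A
      using F.gf_ob_closed'[of Y A] that F(2) by simp
    have hom: "gf_hom F (u, A, A') x \<in> carrier (ghom b (u, gf_ob F (Dom U u, A), gf_ob F (Cod U u, A')))"
      if "u \<in> Arr U" "A \<in> gob a (Dom U u)" "A' \<in> gob a (Cod U u)" "x \<in> carrier (ghom a (u, A, A'))"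
      for u A A' x
      using F.gf_hom_closed'[OF that] that F(2) by simp
    have hom': "gf_hom F (farr \<phi> v, A, A') x \<in>
        carrier (ghom b (farr \<phi> v, gf_ob F (fob \<phi> (Dom V v), A), gf_ob F (fob \<phi> (Cod V v), A')))"
      if "v \<in> Arr V" "A \<in> gob a (fob \<phi> (Dom V v))" "A' \<in> gob a (fob \<phi> (Cod V v))"
        "x \<in> carrier (ghom a (farr \<phi> v, A, A'))"
      for v A A' x
      using hom[of "farr \<phi> v" A A' x] that by simp
    have "res_gfun V \<phi> a (comp_gfun U a G F) =
        comp_gfun V (pull V \<phi> a) (res_gfun V \<phi> b G) (res_gfun V \<phi> a F)"
      by (rule gfun_eqI[OF res_gfun_graded[OF \<phi> GF]
            comp_gfun_graded[OF res_gfun_graded[OF \<phi> F] res_gfun_graded[OF \<phi> G]]])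
         (simp_all add: F(2) ob hom')
    then show "farr (Map'_functor R V U \<phi>) (Cmp (Map' R U) g f) =
        Cmp (Map' R V) (farr (Map'_functor R V U \<phi>) g) (farr (Map'_functor R V U \<phi>) f)"
      by (simp add: fg Map'_sel Map'_functor_arr[OF \<phi>] F G GF)
  qed
qed

lemma Map'_functor_id:
  assumes U: "category U"
  shows "Map'_functor R U U (id_func U) = id_func (Map' R U)"
proof (rule cat_functor_eqI[OF Map'_functor_functor[OF id_func_functor[OF U]]
      id_func_functor[OF Map'_category[OF U]]])
  fix f assume f: "f \<in> Arr (Map' R U)"
  then obtain a F b where fF: "f = (a, F, b)" and F: "graded_functor R U a U b F" "Psi F = id_func U"
    and ab: "graded_category R U a" "graded_category R U b"
    by (auto elim: Map'_arr_cases)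
  note r = res_gfun_graded[OF id_func_functor[OF U] F]
  have "res_gfun U (id_func U) a F = F"
    by (rule gfun_eqI[OF r[unfolded pull_id[OF ab(1)]] F(1)]) (simp_all add: U F)
  with f F ab show "farr (Map'_functor R U U (id_func U)) f = farr (id_func (Map' R U)) f"
    by (simp add: fF Map'_functor_arr[OF id_func_functor[OF U]])
qed (simp add: Map'_sel)

lemma Map'_functor_comp:
  assumes \<phi>: "cat_functor V U \<phi>" and \<psi>: "cat_functor W V \<psi>"
  shows "Map'_functor R W U (comp_func W \<phi> \<psi>) =
    comp_func (Map' R U) (Map'_functor R W V \<psi>) (Map'_functor R V U \<phi>)"
proof (rule cat_functor_eqI[OF Map'_functor_functor[OF comp_func_functor[OF \<psi> \<phi>]]
      comp_func_functor[OF Map'_functor_functor[OF \<phi>] Map'_functor_functor[OF \<psi>]]])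
  fix a assume "a \<in> Obj (Map' R U)"
  then show "fob (Map'_functor R W U (comp_func W \<phi> \<psi>)) a =
      fob (comp_func (Map' R U) (Map'_functor R W V \<psi>) (Map'_functor R V U \<phi>)) a"
    by (simp add: Map'_sel pull_graded[OF \<phi>] pull_pull[OF \<phi> \<psi>])
next
  fix f assume f: "f \<in> Arr (Map' R U)"
  then obtain a F b where fF: "f = (a, F, b)" and F: "graded_functor R U a U b F" "Psi F = id_func U"
    and ab: "graded_category R U a" "graded_category R U b"
    by (auto elim: Map'_arr_cases)
  have [simp]: "category V" "category W" using \<phi> \<psi> by (auto intro: cat_functor_source)
  note [simp] = functor_rules[OF \<psi>]
  note r = res_gfun_graded[OF \<phi> F]
  note rr = res_gfun_graded[OF \<psi> r res_gfun_apply(1)[OF \<open>category V\<close>]]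
  have "res_gfun W (comp_func W \<phi> \<psi>) a F = res_gfun W \<psi> (pull V \<phi> a) (res_gfun V \<phi> a F)"
    by (rule gfun_eqI[OF res_gfun_graded[OF comp_func_functor[OF \<psi> \<phi>] F]
          rr[unfolded pull_pull[OF \<phi> \<psi> ab(1)]]]) simp_all
  with f F r show "farr (Map'_functor R W U (comp_func W \<phi> \<psi>)) f =
      farr (comp_func (Map' R U) (Map'_functor R W V \<psi>) (Map'_functor R V U \<phi>)) f"
    by (simp add: fF Map'_functor_arr[OF \<phi>] Map'_functor_arr[OF comp_func_functor[OF \<psi> \<phi>]]
        Map'_functor_arr[OF \<psi>] pull_pull[OF \<phi> \<psi> ab(1)] pull_pull[OF \<phi> \<psi> ab(2)])
qed

lemma unit_coherence_eq_Ident: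
  assumes a: "graded_category R U a"
  shows "unit_coherence R U a = Ident (Map' R U) a"
proof -
  have U: "category U" using a by (simp add: graded_category_def)
  note id = id_func_functor[OF U]
  have "comp_gfun U a (delta U (id_func U) a) (id_gfun U a) = id_gfun U a"
    by (rule gfun_eqI[OF comp_gfun_graded[OF id_gfun_graded[OF a] delta_graded[OF id a, unfolded
        pull_id[OF a]]]
          id_gfun_graded[OF a]]) (simp_all add: U)
  then have "(THE G. graded_functor R U a U (pull U (id_func U) a) G \<and> Psi G = Psi (id_gfun U a) \<and>
      comp_gfun U a (delta U (id_func U) a) G = id_gfun U a) = id_gfun U a"
    by (intro the_lift[OF id]) (simp_all add: a U pull_id[OF a])
  then show ?thesis
    using a by (simp add: unit_coherence_def Map'_sel)
qed

lemma comp_coherence_eq_Ident: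
  assumes \<phi>: "cat_functor V U \<phi>" and \<psi>: "cat_functor W V \<psi>" and a: "graded_category R U a"
  shows "comp_coherence R W V \<phi> \<psi> a = Ident (Map' R W) (pull W (comp_func W \<phi> \<psi>) a)"
proof -
  let ?c = "pull W (comp_func W \<phi> \<psi>) a"
  have W [simp]: "category W" and V [simp]: "category V"
    using \<phi> \<psi> by (auto intro: cat_functor_source)
  note [simp] = functor_rules[OF \<psi>]
  note \<phi>\<psi> = comp_func_functor[OF \<psi> \<phi>]
  note c = pull_graded[OF \<phi>\<psi> a]
  note dd = comp_gfun_graded[OF delta_graded[OF \<psi> pull_graded[OF \<phi> a]] delta_graded[OF \<phi> a],
      unfolded pull_pull[OF \<phi> \<psi> a]]
  have "comp_gfun W ?c (delta W (comp_func W \<phi> \<psi>) a) (id_gfun W ?c) =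
      comp_gfun W ?c (delta V \<phi> a) (delta W \<psi> (pull V \<phi> a))"
    by (rule gfun_eqI[OF comp_gfun_graded[OF id_gfun_graded[OF c] delta_graded[OF \<phi>\<psi> a]] dd])
       (simp_all add: comp_func_id_right[OF \<phi>\<psi>])
  then have "(THE G. graded_functor R W ?c W ?c G \<and> Psi G = Psi (id_gfun W ?c) \<and>
      comp_gfun W ?c (delta W (comp_func W \<phi> \<psi>) a) G =
      comp_gfun W ?c (delta V \<phi> a) (delta W \<psi> (pull V \<phi> a))) = id_gfun W ?c"
    by (intro the_lift[OF \<phi>\<psi> _ dd]) (simp_all add: c)
  then show ?thesis
    by (simp add: comp_coherence_def Map'_sel Let_def pull_pull[OF \<phi> \<psi> a])
qed

section \<open>The descent category\<close>

text \<open>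
  Arrows with equal images have ends with equal images, so the ends of an arrow of a fibre product
  lie in the fibre product.
\<close>

lemma fob_Dom_eq:
  assumes "cat_functor C E F" "cat_functor D E G" "f \<in> Arr C" "g \<in> Arr D" "farr F f = farr G g"
  shows "fob F (Dom C f) = fob G (Dom D g)" "fob F (Cod C f) = fob G (Cod D g)"
  using assms by (metis cat_functor.farr_Dom, metis cat_functor.farr_Cod)

lemma fprod_category:
  assumes F: "cat_functor C E F" and G: "cat_functor D E G"
  shows "category (fprod C D F G)"
    and "cat_functor (fprod C D F G) C (pr1 (fprod C D F G))"
    and "cat_functor (fprod C D F G) D (pr2 (fprod C D F G))"
proof -
  have C: "category C" and D: "category D" using F G by (auto intro: cat_functor_source)
  show P: "category (fprod C D F G)"
    by (rule category.intro) (use C D F G in \<open>auto simp: fprod_def category.Cmp_assoc intro: fob_Dom_eq\<close>)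
  show "cat_functor (fprod C D F G) C (pr1 (fprod C D F G))"
    by (intro cat_functor.intro cat_functor_axioms.intro P C PiE_I)
      (use C D F G in \<open>auto simp: fprod_def pr1_def proj_func_def intro: fob_Dom_eq\<close>)
  show "cat_functor (fprod C D F G) D (pr2 (fprod C D F G))"
    by (intro cat_functor.intro cat_functor_axioms.intro P D PiE_I)
      (use C D F G in \<open>auto simp: fprod_def pr2_def proj_func_def intro: fob_Dom_eq\<close>)
qed

lemma fprod3_category:
  assumes F: "cat_functor C B F" and G: "cat_functor D B G" and H: "cat_functor E B H"
  defines "T \<equiv> fprod3 C D E F G H"
  shows "category T"
    and "cat_functor T (fprod C D F G) (pr12 T)"
    and "cat_functor T (fprod C E F H) (pr13 T)"
    and "cat_functor T (fprod D E G H) (pr23 T)"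
proof -
  have C: "category C" and D: "category D" and E: "category E"
    using F G H by (auto intro: cat_functor_source)
  show T: "category T"
    unfolding T_def
    by (rule category.intro) (use C D E F G H in \<open>auto simp: fprod3_def category.Cmp_assoc intro: fob_Dom_eq\<close>)
  show "cat_functor T (fprod C D F G) (pr12 T)"
    by (intro cat_functor.intro cat_functor_axioms.intro T fprod_category(1)[OF F G] PiE_I)
      (use C D E F G H in \<open>auto simp: T_def fprod_def fprod3_def pr12_def proj_func_def intro: fob_Dom_eq\<close>)
  show "cat_functor T (fprod C E F H) (pr13 T)"
    by (intro cat_functor.intro cat_functor_axioms.intro T fprod_category(1)[OF F H] PiE_I)
      (use C D E F G H in \<open>auto simp: T_def fprod_def fprod3_def pr13_def proj_func_def intro: fob_Dom_eq\<close>)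
  show "cat_functor T (fprod D E G H) (pr23 T)"
    by (intro cat_functor.intro cat_functor_axioms.intro T fprod_category(1)[OF G H] PiE_I)
      (use C D E F G H in \<open>auto simp: T_def fprod_def fprod3_def pr23_def proj_func_def intro: fob_Dom_eq\<close>)
qed

lemma fprod_square:
  assumes F: "cat_functor C E F" and G: "cat_functor D E G"
  defines "P \<equiv> fprod C D F G"
  shows "comp_func P F (pr1 P) = comp_func P G (pr2 P)"
  by (rule cat_functor_eqI[OF comp_func_functor[OF fprod_category(2)[OF F G] F, folded P_def]
        comp_func_functor[OF fprod_category(3)[OF F G] G, folded P_def]])
    (auto simp: P_def fprod_def pr1_def pr2_def proj_func_def comp_func_def)

text \<open>
  For the canonical datum, this turns the cocycle condition into a statement about a single
  identity arrow.
\<close>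

lemma fprod3_squares:
  assumes F: "cat_functor C B F" and G: "cat_functor D B G" and H: "cat_functor E B H"
  defines "T \<equiv> fprod3 C D E F G H"
  shows "comp_func T (comp_func (fprod D E G H) G (pr1 (fprod D E G H))) (pr23 T) =
      comp_func T (comp_func (fprod C D F G) F (pr1 (fprod C D F G))) (pr12 T)" (is "?f23 = ?f12")
    and "comp_func T (comp_func (fprod C E F H) F (pr1 (fprod C E F H))) (pr13 T) =
      comp_func T (comp_func (fprod C D F G) F (pr1 (fprod C D F G))) (pr12 T)" (is "?f13 = _")
proof -
  note T = fprod3_category[OF F G H, folded T_def]
  have f12: "cat_functor T B ?f12" and f13: "cat_functor T B ?f13" and f23: "cat_functor T B ?f23"
    by (rule comp_func_functor[OF T(2) comp_func_functor[OF fprod_category(2)[OF F G] F]]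
      comp_func_functor[OF T(3) comp_func_functor[OF fprod_category(2)[OF F H] F]]
      comp_func_functor[OF T(4) comp_func_functor[OF fprod_category(2)[OF G H] G]])+
  show "?f23 = ?f12"
    by (rule cat_functor_eqI[OF f23 f12])
      (auto simp: T_def fprod_def fprod3_def pr1_def pr12_def pr23_def proj_func_def comp_func_def)
  show "?f13 = ?f12"
    by (rule cat_functor_eqI[OF f13 f12])
      (auto simp: T_def fprod_def fprod3_def pr1_def pr12_def pr13_def proj_func_def comp_func_def)
qed

locale covering_family =
  fixes R :: "('k, 'r) ring_scheme" and I :: "'i set" and V :: "'i \<Rightarrow> ('vo, 'va) cat"
    and \<phi> :: "'i \<Rightarrow> ('vo, 'va, 'uo, 'ua) func" and U :: "('uo, 'ua) cat"
  assumes U [simp]: "category U"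
    and \<phi> [simp]: "i \<in> I \<Longrightarrow> cat_functor (V i) U (\<phi> i)"
begin

abbreviation Dbl where "Dbl \<equiv> dbl V \<phi>"
abbreviation Tpl where "Tpl \<equiv> tpl V \<phi>"

lemma V [simp]: "i \<in> I \<Longrightarrow> category (V i)"
  using \<phi> by (blast dest: cat_functor_source)

lemmas \<phi>_simps [simp] = cat_functor_fob[OF \<phi>] cat_functor_farr[OF \<phi>]
  cat_functor.farr_Ident[OF \<phi>] cat_functor.farr_Cmp[OF \<phi>]

lemma dbl [simp]:
  assumes "i \<in> I" "j \<in> I"
  shows "category (Dbl i j)"
    and "cat_functor (Dbl i j) (V i) (pr1 (Dbl i j))"
    and "cat_functor (Dbl i j) (V j) (pr2 (Dbl i j))"
  using assms fprod_category[OF \<phi> \<phi>] by (simp_all add: dbl_def)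

lemma dbl_square:
  "i \<in> I \<Longrightarrow> j \<in> I \<Longrightarrow> comp_func (Dbl i j) (\<phi> i) (pr1 (Dbl i j)) =
    comp_func (Dbl i j) (\<phi> j) (pr2 (Dbl i j))"
  using fprod_square[OF \<phi> \<phi>] by (simp add: dbl_def)

lemma tpl [simp]:
  assumes "i \<in> I" "j \<in> I" "l \<in> I"
  shows "category (Tpl i j l)"
    and "cat_functor (Tpl i j l) (Dbl i j) (pr12 (Tpl i j l))"
    and "cat_functor (Tpl i j l) (Dbl i l) (pr13 (Tpl i j l))"
    and "cat_functor (Tpl i j l) (Dbl j l) (pr23 (Tpl i j l))"
  using assms fprod3_category[OF \<phi> \<phi> \<phi>] by (simp_all add: dbl_def tpl_def)

lemma descent_dataD:
  assumes "(b, \<theta>) \<in> descent_data R I V \<phi>"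
  shows "i \<in> I \<Longrightarrow> b i \<in> Obj (Map' R (V i))"
    and "b \<in> extensional I" "\<theta> \<in> extensional (I \<times> I)"
    and "i \<in> I \<Longrightarrow> j \<in> I \<Longrightarrow> \<theta> (i, j) \<in> arrows (Map' R (Dbl i j))
          (fob (Map'_functor R (Dbl i j) (V i) (pr1 (Dbl i j))) (b i))
          (fob (Map'_functor R (Dbl i j) (V j) (pr2 (Dbl i j))) (b j))"
    and "i \<in> I \<Longrightarrow> j \<in> I \<Longrightarrow> iso_arr (Map' R (Dbl i j)) (\<theta> (i, j))"
    and "i \<in> I \<Longrightarrow> j \<in> I \<Longrightarrow> l \<in> I \<Longrightarrow> Cmp (Map' R (Tpl i j l))
          (farr (Map'_functor R (Tpl i j l) (Dbl j l) (pr23 (Tpl i j l))) (\<theta> (j, l)))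
          (farr (Map'_functor R (Tpl i j l) (Dbl i j) (pr12 (Tpl i j l))) (\<theta> (i, j))) =
        farr (Map'_functor R (Tpl i j l) (Dbl i l) (pr13 (Tpl i j l))) (\<theta> (i, l))"
  using assms by (auto simp: descent_data_def Let_def PiE_iff)

abbreviation res1 where
  "res1 i j \<equiv> Map'_functor R (Dbl i j) (V i) (pr1 (Dbl i j))"

abbreviation res2 where
  "res2 i j \<equiv> Map'_functor R (Dbl i j) (V j) (pr2 (Dbl i j))"

lemma res_functor [simp]:
  assumes "i \<in> I" "j \<in> I"
  shows "cat_functor (Map' R (V i)) (Map' R (Dbl i j)) (res1 i j)"
    and "cat_functor (Map' R (V j)) (Map' R (Dbl i j)) (res2 i j)"
  using assms by (auto intro!: Map'_functor_functor)

lemma Map'_cats [simp]: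
  "category (Map' R U)"
  "i \<in> I \<Longrightarrow> category (Map' R (V i))"
  "i \<in> I \<Longrightarrow> j \<in> I \<Longrightarrow> category (Map' R (Dbl i j))"
  by (simp_all add: Map'_category)

lemma descent_arrows_iff:
  "(X, f, Y) \<in> descent_arrows R I V \<phi> \<longleftrightarrow>
     X \<in> descent_data R I V \<phi> \<and> Y \<in> descent_data R I V \<phi> \<and> f \<in> extensional I \<and>
     (\<forall>i\<in>I. f i \<in> Arr (Map' R (V i)) \<and> Dom (Map' R (V i)) (f i) = fst X i \<and>
        Cod (Map' R (V i)) (f i) = fst Y i) \<and>
     (\<forall>i\<in>I. \<forall>j\<in>I. Cmp (Map' R (Dbl i j)) (snd Y (i, j)) (farr (res1 i j) (f i)) =
        Cmp (Map' R (Dbl i j)) (farr (res2 i j) (f j)) (snd X (i, j)))"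
  by (cases X; cases Y) (auto simp: descent_arrows_def Let_def PiE_iff arrows_def)

lemma transition:
  assumes "X \<in> descent_data R I V \<phi>" "i \<in> I" "j \<in> I"
  shows "snd X (i, j) \<in> Arr (Map' R (Dbl i j))"
    and "Dom (Map' R (Dbl i j)) (snd X (i, j)) = fob (res1 i j) (fst X i)"
    and "Cod (Map' R (Dbl i j)) (snd X (i, j)) = fob (res2 i j) (fst X j)"
    and "fst X i \<in> Obj (Map' R (V i))"
  using assms descent_dataD(1,4)[of "fst X" "snd X"] by (auto simp: arrows_def)

lemma Des_sel:
  "Obj (Des R I V \<phi>) = descent_data R I V \<phi>" "Arr (Des R I V \<phi>) = descent_arrows R I V \<phi>"
  "Dom (Des R I V \<phi>) (X, f, Y) = X" "Cod (Des R I V \<phi>) (X, f, Y) = Y"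
  "Ident (Des R I V \<phi>) X = (X, \<lambda>i\<in>I. Ident (Map' R (V i)) (fst X i), X)"
  "Cmp (Des R I V \<phi>) (Y', g, Z) (X, f, Y) = (X, \<lambda>i\<in>I. Cmp (Map' R (V i)) (g i) (f i), Z)"
  by (simp_all add: Des_def)

lemmas res_simps [simp] = functor_rules[OF res_functor(1)] functor_rules[OF res_functor(2)]

text \<open>
  Compatible families compose because their naturality squares over each double fibre product can
  be pasted.
\<close>

lemma Des_category: "category (Des R I V \<phi>)"
proof (rule category.intro, goal_cases)
  case (1 f) then show ?case by (cases f) (simp add: Des_sel descent_arrows_iff)
next
  case (2 f) then show ?case by (cases f) (simp add: Des_sel descent_arrows_iff)
next
  case (3 X)
  then have X: "X \<in> descent_data R I V \<phi>" by (simp add: Des_sel)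
  have "Cmp (Map' R (Dbl i j)) (snd X (i, j))
      (Ident (Map' R (Dbl i j)) (fob (res1 i j) (fst X i))) = snd X (i, j)"
    "Cmp (Map' R (Dbl i j)) (Ident (Map' R (Dbl i j)) (fob (res2 i j) (fst X j)))
      (snd X (i, j)) = snd X (i, j)" if "i \<in> I" "j \<in> I" for i j
    using category.Cmp_Ident_right[OF Map'_cats(3)[OF that] transition(1)[OF X that]]
      category.Cmp_Ident_left[OF Map'_cats(3)[OF that] transition(1)[OF X that]]
    by (simp_all only: transition[OF X that])
  then show ?case
    using transition(4)[OF X] by (simp add: Des_sel descent_arrows_iff X)
next
  case (6 f g)
  obtain X f' Y where f: "f = (X, f', Y)" by (cases f)
  obtain Y' g' Z where g: "g = (Y', g', Z)" by (cases g)
  have [simp]: "Y' = Y" using 6 by (simp add: f g Des_sel)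
  have A: "(X, f', Y) \<in> descent_arrows R I V \<phi>" "(Y, g', Z) \<in> descent_arrows R I V \<phi>"
    using 6 by (simp_all add: f g Des_sel)
  note A' = A[unfolded descent_arrows_iff]
  have XYZ: "X \<in> descent_data R I V \<phi>" "Y \<in> descent_data R I V \<phi>" "Z \<in> descent_data R I V \<phi>"
    using A' by auto
  have "Cmp (Map' R (Dbl i j)) (snd Z (i, j)) (farr (res1 i j) (Cmp (Map' R (V i)) (g' i) (f' i))) =
     Cmp (Map' R (Dbl i j)) (farr (res2 i j) (Cmp (Map' R (V j)) (g' j) (f' j))) (snd X (i, j))"
    if ij: "i \<in> I" "j \<in> I" for i j
  proof -
    interpret M: category "Map' R (Dbl i j)" using ij by simp
    note tX = transition[OF XYZ(1) ij] and tY = transition[OF XYZ(2) ij] and tZ = transition[OF XYZ(3) ij]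
    let ?c = "Cmp (Map' R (Dbl i j))"
    have "?c (snd Z (i, j)) (?c (farr (res1 i j) (g' i)) (farr (res1 i j) (f' i))) =
        ?c (?c (snd Z (i, j)) (farr (res1 i j) (g' i))) (farr (res1 i j) (f' i))"
      using ij A' tZ by (intro M.Cmp_assoc) simp_all
    also have "\<dots> = ?c (?c (farr (res2 i j) (g' j)) (snd Y (i, j))) (farr (res1 i j) (f' i))"
      using ij A' by simp
    also have "\<dots> = ?c (farr (res2 i j) (g' j)) (?c (snd Y (i, j)) (farr (res1 i j) (f' i)))"
      using ij A' tY by (intro M.Cmp_assoc[symmetric]) simp_all
    also have "\<dots> = ?c (farr (res2 i j) (g' j)) (?c (farr (res2 i j) (f' j)) (snd X (i, j)))"
      using ij A' by simp
    also have "\<dots> = ?c (?c (farr (res2 i j) (g' j)) (farr (res2 i j) (f' j))) (snd X (i, j))"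
      using ij A' tX by (intro M.Cmp_assoc) simp_all
    finally show ?thesis using ij A' by simp
  qed
  then show ?case
    using A' by (simp add: f g Des_sel descent_arrows_iff)
next
  case (9 f)
  then show ?case
    by (cases f) (auto simp: Des_sel descent_arrows_iff restrict_def extensional_def fun_eq_iff,
      metis Map'_cats(2) category.Cmp_Ident_right)
next
  case (10 f)
  then show ?case
    by (cases f) (auto simp: Des_sel descent_arrows_iff restrict_def extensional_def fun_eq_iff,
      metis Map'_cats(2) category.Cmp_Ident_left)
next
  case (11 f g h)
  then show ?case
    by (cases f; cases g; cases h)
      (auto simp: Des_sel descent_arrows_iff category.Cmp_assoc intro!: restrict_ext)
qed (auto simp: Des_sel split: prod.splits)

text \<open>
  Inverting the naturality square of a family of isomorphisms shows that the inverses form a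
  compatible family as well.
\<close>

lemma Des_iso:
  assumes f: "(X, f, Y) \<in> Arr (Des R I V \<phi>)" and iso: "\<And>i. i \<in> I \<Longrightarrow> iso_arr (Map' R (V i)) (f i)"
  shows "iso_arr (Des R I V \<phi>) (X, f, Y)"
proof -
  note f' = f[unfolded Des_sel descent_arrows_iff]
  have X: "X \<in> descent_data R I V \<phi>" and Y: "Y \<in> descent_data R I V \<phi>" using f' by auto
  have "\<exists>g. g \<in> Arr (Map' R (V i)) \<and> Dom (Map' R (V i)) g = fst Y i \<and> Cod (Map' R (V i)) g = fst X i \<and>
      Cmp (Map' R (V i)) g (f i) = Ident (Map' R (V i)) (fst X i) \<and>
      Cmp (Map' R (V i)) (f i) g = Ident (Map' R (V i)) (fst Y i)" if "i \<in> I" for i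
    using iso[OF that] f' that unfolding iso_arr_def arrows_def by fastforce
  then obtain g0 where g0: "\<And>i. i \<in> I \<Longrightarrow> g0 i \<in> Arr (Map' R (V i)) \<and>
      Dom (Map' R (V i)) (g0 i) = fst Y i \<and> Cod (Map' R (V i)) (g0 i) = fst X i \<and>
      Cmp (Map' R (V i)) (g0 i) (f i) = Ident (Map' R (V i)) (fst X i) \<and>
      Cmp (Map' R (V i)) (f i) (g0 i) = Ident (Map' R (V i)) (fst Y i)"
    by metis
  define g where "g = restrict g0 I"
  have g: "g i \<in> Arr (Map' R (V i))" "Dom (Map' R (V i)) (g i) = fst Y i"
    "Cod (Map' R (V i)) (g i) = fst X i"
    "Cmp (Map' R (V i)) (g i) (f i) = Ident (Map' R (V i)) (fst X i)"
    "Cmp (Map' R (V i)) (f i) (g i) = Ident (Map' R (V i)) (fst Y i)" if "i \<in> I" for i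
    using g0[OF that] that by (simp_all add: g_def)
  have "Cmp (Map' R (Dbl i j)) (snd X (i, j)) (farr (res1 i j) (g i)) =
     Cmp (Map' R (Dbl i j)) (farr (res2 i j) (g j)) (snd Y (i, j))"
    if ij: "i \<in> I" "j \<in> I" for i j
  proof -
    interpret M: category "Map' R (Dbl i j)" using ij by simp
    note tX = transition[OF X ij] and tY = transition[OF Y ij]
    have tj: "fst X j \<in> Obj (Map' R (V j))" "fst Y j \<in> Obj (Map' R (V j))"
      using transition(4)[OF X ij(2) ij(2)] transition(4)[OF Y ij(2) ij(2)] .
    let ?c = "Cmp (Map' R (Dbl i j))"
    let ?f1 = "farr (res1 i j) (f i)" and ?f2 = "farr (res2 i j) (f j)"
    let ?g1 = "farr (res1 i j) (g i)" and ?g2 = "farr (res2 i j) (g j)"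
    have gf: "?c ?g2 ?f2 = Ident (Map' R (Dbl i j)) (fob (res2 i j) (fst X j))"
      and fg: "?c ?f1 ?g1 = Ident (Map' R (Dbl i j)) (fob (res1 i j) (fst Y i))"
      using ij f' g tX(4) tY(4) tj by (simp_all flip: res_simps(6,12))
    have "?c (snd X (i, j)) ?g1 = ?c (?c (?c ?g2 ?f2) (snd X (i, j))) ?g1"
      using M.Cmp_Ident_left[OF tX(1)] by (simp add: gf tX(3))
    also have "\<dots> = ?c (?c ?g2 (?c ?f2 (snd X (i, j)))) ?g1"
      using ij f' g tX by (subst M.Cmp_assoc) simp_all
    also have "\<dots> = ?c (?c ?g2 (?c (snd Y (i, j)) ?f1)) ?g1"
      using ij f' by simp
    also have "\<dots> = ?c ?g2 (?c (snd Y (i, j)) (?c ?f1 ?g1))"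
      using ij f' g tX tY by (simp add: M.Cmp_assoc)
    also have "\<dots> = ?c ?g2 (snd Y (i, j))"
      using M.Cmp_Ident_right[OF tY(1)] by (simp add: fg tY(2))
    finally show ?thesis .
  qed
  then have "(Y, g, X) \<in> Arr (Des R I V \<phi>)"
    using X Y g by (simp add: Des_sel descent_arrows_iff g_def)
  moreover have "Cmp (Des R I V \<phi>) (Y, g, X) (X, f, Y) = Ident (Des R I V \<phi>) X"
    "Cmp (Des R I V \<phi>) (X, f, Y) (Y, g, X) = Ident (Des R I V \<phi>) Y"
    using g by (auto simp: Des_sel intro!: restrict_ext)
  ultimately show ?thesis
    using f unfolding iso_arr_def by (intro conjI bexI[of _ "(Y, g, X)"]) (simp_all add: Des_sel arrows_def)
qed

abbreviation canon where "canon \<equiv> canonical_datum R I V \<phi> U"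

lemma canonical_datum_apply [simp]:
  assumes "graded_category R U a"
  shows "i \<in> I \<Longrightarrow> fst (canon a) i = pull (V i) (\<phi> i) a"
    and "i \<in> I \<Longrightarrow> j \<in> I \<Longrightarrow> snd (canon a) (i, j) =
      Ident (Map' R (Dbl i j)) (pull (Dbl i j) (comp_func (Dbl i j) (\<phi> i) (pr1 (Dbl i j))) a)"
  using assms by (simp_all add: canonical_datum_def Let_def pull_graded[OF \<phi>] pull_pull[OF \<phi> dbl(2)])

text \<open>
  By strict functoriality, all restrictions of \<open>a\<close> to a double or triple fibre product are the
  restriction along one functor, so that every transition isomorphism is an identity arrow of one
  object.
\<close>

lemma canonical_datum_descent_data:
  assumes a: "graded_category R U a"
  shows "canon a \<in> descent_data R I V \<phi>"
proof -
  let ?X = "canon a"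
  have data: "fst ?X i \<in> Obj (Map' R (V i))" if "i \<in> I" for i
    using that a by (simp add: Map'_sel pull_graded[OF \<phi>])
  have tr: "snd ?X (i, j) \<in> arrows (Map' R (Dbl i j)) (fob (res1 i j) (fst ?X i)) (fob (res2 i j) (fst
      ?X j)) \<and>
      iso_arr (Map' R (Dbl i j)) (snd ?X (i, j))" if ij: "i \<in> I" "j \<in> I" for i j
  proof -
    let ?c = "pull (Dbl i j) (comp_func (Dbl i j) (\<phi> i) (pr1 (Dbl i j))) a"
    have c: "?c \<in> Obj (Map' R (Dbl i j))"
      using ij a by (auto simp: Map'_sel intro!: pull_graded[where U = U] comp_func_functor[where D = "V i"])
    have "fob (res1 i j) (fst ?X i) = ?c" "fob (res2 i j) (fst ?X j) = ?c"
      using ij a by (simp_all add: pull_graded[OF \<phi>] pull_pull[OF \<phi> dbl(2)] pull_pull[OF \<phi> dbl(3)]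
          dbl_square[OF ij])
    then show ?thesis
      using Ident_iso[OF Map'_cats(3)[OF ij] c] ij a by simp
  qed
  let ?\<phi> = "\<lambda>i j. comp_func (Dbl i j) (\<phi> i) (pr1 (Dbl i j))"
  have cocycle: "Cmp (Map' R (Tpl i j l))
        (farr (Map'_functor R (Tpl i j l) (Dbl j l) (pr23 (Tpl i j l))) (snd ?X (j, l)))
        (farr (Map'_functor R (Tpl i j l) (Dbl i j) (pr12 (Tpl i j l))) (snd ?X (i, j))) =
      farr (Map'_functor R (Tpl i j l) (Dbl i l) (pr13 (Tpl i j l))) (snd ?X (i, l))"
    if ijl: "i \<in> I" "j \<in> I" "l \<in> I" for i j l
  proof -
    let ?T = "Tpl i j l"
    let ?c = "pull ?T (comp_func ?T (?\<phi> i j) (pr12 ?T)) a"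
    have f: "cat_functor (Dbl i j) U (?\<phi> i j)" if "i \<in> I" "j \<in> I" for i j
      using comp_func_functor[OF dbl(2) \<phi>] that by blast
    have c: "?c \<in> Obj (Map' R ?T)"
      using a by (simp add: Map'_sel pull_graded[OF comp_func_functor[OF tpl(2)[OF ijl] f[OF ijl(1,2)]]])
    have restrict: "farr (Map'_functor R ?T (Dbl i j) p) (Ident (Map' R (Dbl i j)) (pull (Dbl i j) (?\<phi> i
        j) a)) =
        Ident (Map' R ?T) (pull ?T (comp_func ?T (?\<phi> i j) p) a)"
      if "i \<in> I" "j \<in> I" "cat_functor ?T (Dbl i j) p" for i j p
      using a by (simp add: cat_functor.farr_Ident[OF Map'_functor_functor[OF that(3)]] Map'_sel(1)
          pull_graded[OF f[OF that(1,2)]] pull_pull[OF f[OF that(1,2)] that(3)])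
    have "comp_func ?T (?\<phi> j l) (pr23 ?T) = comp_func ?T (?\<phi> i j) (pr12 ?T)"
      "comp_func ?T (?\<phi> i l) (pr13 ?T) = comp_func ?T (?\<phi> i j) (pr12 ?T)"
      using fprod3_squares[OF \<phi> \<phi> \<phi>, OF ijl] by (simp_all add: dbl_def tpl_def)
    then show ?thesis
      using ijl a category.Cmp_Ident_left[OF Map'_category category.Ident_closed[OF Map'_category c]]
        category.Cod_Ident[OF Map'_category c]
      by (simp add: restrict)
  qed
  have "fst ?X \<in> extensional I" "snd ?X \<in> extensional (I \<times> I)"
    by (simp_all add: canonical_datum_def)
  then show ?thesis
    using data tr cocycle
    by (subst prod.collapse[symmetric]) (simp only: descent_data_def Let_def mem_Collect_eq split
        PiE_iff, blast)
qed

lemma comparison_functor: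
  "cat_functor (Map' R U) (Des R I V \<phi>) (comparison R I V \<phi> U)"
proof (intro cat_functor.intro cat_functor_axioms.intro Map'_cats Des_category PiE_I)
  show "fob (comparison R I V \<phi> U) a \<in> Obj (Des R I V \<phi>)" if "a \<in> Obj (Map' R U)" for a
    using that canonical_datum_descent_data by (simp add: comparison_def Des_sel Map'_sel)
  have arr: "farr (comparison R I V \<phi> U) f =
      (canon (Dom (Map' R U) f),
       \<lambda>i\<in>I. farr (Map'_functor R (V i) U (\<phi> i)) f,
       canon (Cod (Map' R U) f))" if "f \<in> Arr (Map' R U)" for f
    using that by (simp add: comparison_def)
  have M: "cat_functor (Map' R U) (Map' R (V i)) (Map'_functor R (V i) U (\<phi> i))" if "i \<in> I" for i
    using that by (intro Map'_functor_functor) simp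
  show "farr (comparison R I V \<phi> U) f \<in> Arr (Des R I V \<phi>)" if f: "f \<in> Arr (Map' R U)" for f
  proof -
    let ?a = "Dom (Map' R U) f" and ?b = "Cod (Map' R U) f"
    have ab: "graded_category R U ?a" "graded_category R U ?b"
      using category.Dom_closed[OF Map'_cats(1) f] category.Cod_closed[OF Map'_cats(1) f]
          by (simp_all add: Map'_sel(1))
    have "Cmp (Map' R (Dbl i j)) (snd (canon ?b) (i, j))
         (farr (res1 i j) (farr (Map'_functor R (V i) U (\<phi> i)) f)) =
       Cmp (Map' R (Dbl i j)) (farr (res2 i j) (farr (Map'_functor R (V j) U (\<phi> j)) f))
         (snd (canon ?a) (i, j))" if ij: "i \<in> I" "j \<in> I" for i j
    proof -
      let ?P = "Dbl i j"
      let ?p = "comp_func ?P (\<phi> i) (pr1 ?P)"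
      have p: "cat_functor ?P U ?p" by (rule comp_func_functor[OF dbl(2)[OF ij] \<phi>[OF ij(1)]])
      interpret M: cat_functor "Map' R U" "Map' R ?P" "Map'_functor R ?P U ?p"
        by (rule Map'_functor_functor[OF p])
      let ?g = "farr (Map'_functor R ?P U ?p) f"
      have "farr (res1 i j) (farr (Map'_functor R (V i) U (\<phi> i)) f) = ?g"
        using f by (simp add: Map'_functor_comp[OF \<phi>[OF ij(1)] dbl(2)[OF ij]])
      moreover have "farr (res2 i j) (farr (Map'_functor R (V j) U (\<phi> j)) f) = ?g"
        using f by (simp add: Map'_functor_comp[OF \<phi>[OF ij(2)] dbl(3)[OF ij], folded dbl_square[OF ij]])
      moreover have "Dom (Map' R ?P) ?g = pull ?P ?p ?a" "Cod (Map' R ?P) ?g = pull ?P ?p ?b"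
        using f ab by (simp_all add: M.farr_Dom M.farr_Cod)
      ultimately show ?thesis
        using ij ab M.D.Cmp_Ident_left[of ?g] M.D.Cmp_Ident_right[of ?g] cat_functor_farr[OF
            M.cat_functor_axioms f]
        by simp
    qed
    then show ?thesis
      using f ab M
      by (simp add: canonical_datum_descent_data arr Des_sel descent_arrows_iff functor_rules[OF M])
  qed
  show "fob (comparison R I V \<phi> U) a = undefined" if "a \<notin> Obj (Map' R U)" for a
    using that by (simp add: comparison_def)
  show "farr (comparison R I V \<phi> U) f = undefined" if "f \<notin> Arr (Map' R U)" for f
    using that by (simp add: comparison_def)
  show "Dom (Des R I V \<phi>) (farr (comparison R I V \<phi> U) f) = fob (comparison R I V \<phi> U) (Dom (Map' R U) f)"
    "Cod (Des R I V \<phi>) (farr (comparison R I V \<phi> U) f) = fob (comparison R I V \<phi> U) (Cod (Map' R U) f)"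
    if f: "f \<in> Arr (Map' R U)" for f
    using f category.Dom_closed[OF Map'_cats(1) f] category.Cod_closed[OF Map'_cats(1) f]
    by (simp_all add: arr[OF f] Des_sel comparison_def)
  show "farr (comparison R I V \<phi> U) (Ident (Map' R U) a) =
      Ident (Des R I V \<phi>) (fob (comparison R I V \<phi> U) a)" if a: "a \<in> Obj (Map' R U)" for a
    using a by (auto simp: arr Des_sel comparison_def Map'_sel(1) cat_functor.farr_Ident[OF M] intro!:
        restrict_ext)
  show "farr (comparison R I V \<phi> U) (Cmp (Map' R U) g f) =
      Cmp (Des R I V \<phi>) (farr (comparison R I V \<phi> U) g) (farr (comparison R I V \<phi> U) f)"
    if "f \<in> Arr (Map' R U)" "g \<in> Arr (Map' R U)" "Dom (Map' R U) g = Cod (Map' R U) f" for f g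
    using that by (auto simp: arr Des_sel cat_functor.farr_Cmp[OF M] intro!: restrict_ext)
qed

end

section \<open>Lifting chains of arrows\<close>

text \<open>
  The composite of the \<open>d\<close> arrows \<open>e i, \<dots>, e (i + d - 1)\<close>; in a simplex with spine \<open>e\<close>, this is
  the value at the arrow from \<open>i\<close> to \<open>i + d\<close>.
\<close>

primrec path :: "('o, 'a) cat \<Rightarrow> (nat \<Rightarrow> 'o) \<Rightarrow> (nat \<Rightarrow> 'a) \<Rightarrow> nat \<Rightarrow> nat \<Rightarrow> 'a" where
  "path C X e i 0 = Ident C (X i)"
| "path C X e i (Suc d) = Cmp C (e (i + d)) (path C X e i d)"

text \<open>
  The values off the spine have to be composites of consecutive arrows; functoriality says that
  such a composite may be split at any point.
\<close>

lemma chain_simplex: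
  assumes C: "category C" and X: "\<And>k. k \<le> m \<Longrightarrow> X k \<in> Obj C"
    and e: "\<And>k. k < m \<Longrightarrow> e k \<in> Arr C \<and> Dom C (e k) = X k \<and> Cod C (e k) = X (Suc k)"
  shows "\<exists>\<sigma>\<in>nerve m C. \<forall>k<m. farr \<sigma> (k, Suc k) = e k"
proof -
  interpret category C by fact
  have path: "path C X e i d \<in> Arr C \<and> Dom C (path C X e i d) = X i \<and> Cod C (path C X e i d) = X (i + d)"
    if "i + d \<le> m" for i d
    using that by (induction d) (use C X e in auto)
  have path_add: "Cmp C (path C X e (i + d) d') (path C X e i d) = path C X e i (d + d')"
    if "i + d + d' \<le> m" for i d d'
    using that
  proof (induction d')
    case 0
    then show ?case
      using path[of i d] Cmp_Ident_left[of "path C X e i d"] by simp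
  next
    case (Suc d')
    then show ?case
      using path[of "i + d" d'] path[of i d] e[of "i + d + d'"]
        Cmp_assoc[of "path C X e i d" "path C X e (i + d) d'" "e (i + d + d')"]
      by (simp add: add.assoc)
  qed
  define \<sigma> where "\<sigma> = \<lparr>fob = \<lambda>k\<in>{0..m}. X k,
    farr = \<lambda>(i, j)\<in>Arr (ordinal m). path C X e i (j - i)\<rparr>"
  have ord: "category (ordinal m)"
    by (rule category.intro) (auto simp: ordinal_def)
  have "cat_functor (ordinal m) C \<sigma>"
  proof (intro cat_functor.intro cat_functor_axioms.intro ord C)
    show "farr \<sigma> (Cmp (ordinal m) g f) = Cmp C (farr \<sigma> g) (farr \<sigma> f)"
      if "f \<in> Arr (ordinal m)" "g \<in> Arr (ordinal m)" "Dom (ordinal m) g = Cod (ordinal m) f" for f g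
    proof -
      obtain i j j' l where fg: "f = (i, j)" "g = (j', l)" by (cases f; cases g)
      then have "j' = j" "i \<le> j" "j \<le> l" "l \<le> m" using that by (auto simp: ordinal_def)
      then show ?thesis
        using path_add[of i "j - i" "l - j"] by (auto simp: fg \<sigma>_def ordinal_def)
    qed
  qed (use path X in \<open>auto simp: \<sigma>_def ordinal_def split: if_splits\<close>)
  then have "\<sigma> \<in> nerve m C" by (simp add: nerve_def)
  moreover have "farr \<sigma> (k, Suc k) = e k" if "k < m" for k
    using that e[OF that] Cmp_Ident_right[of "e k"] by (simp add: \<sigma>_def ordinal_def)
  ultimately show ?thesis by blast
qed

text \<open>
  Complete the chain \<open>e\<close> to a simplex and lift that; the spine of the lift lies over \<open>e\<close>.
\<close>

lemma n_cover_lift_chain: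
  assumes cov: "n_cover n I V \<phi> U" and m: "enat m \<le> n"
    and X: "\<And>k. k \<le> m \<Longrightarrow> X k \<in> Obj U"
    and e: "\<And>k. k < m \<Longrightarrow> e k \<in> Arr U \<and> Dom U (e k) = X k \<and> Cod U (e k) = X (Suc k)"
  obtains i v where "i \<in> I" "\<And>k. k < m \<Longrightarrow> v k \<in> Arr (V i) \<and> farr (\<phi> i) (v k) = e k"
    "\<And>k. Suc k < m \<Longrightarrow> Dom (V i) (v (Suc k)) = Cod (V i) (v k)"
proof -
  have U: "category U" using cov by (simp add: n_cover_def)
  obtain \<sigma> where \<sigma>: "\<sigma> \<in> nerve m U" "\<And>k. k < m \<Longrightarrow> farr \<sigma> (k, Suc k) = e k"
    using chain_simplex[of U m X e] U X e by blast
  then obtain i \<tau> where i: "i \<in> I" and \<tau>: "\<tau> \<in> nerve m (V i)" "\<sigma> = nerve_map m (\<phi> i) \<tau>"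
    using cov m unfolding n_cover_def by blast
  interpret \<tau>: cat_functor "ordinal m" "V i" \<tau> using \<tau>(1) by (simp add: nerve_def)
  have o: "(k, Suc k) \<in> Arr (ordinal m)" if "k < m" for k
    using that by (simp add: ordinal_def)
  show thesis
  proof
    show "i \<in> I" by fact
    show "farr \<tau> (k, Suc k) \<in> Arr (V i) \<and> farr (\<phi> i) (farr \<tau> (k, Suc k)) = e k" if "k < m" for k
      using \<sigma>(2)[OF that] o[OF that] cat_functor_farr[OF \<tau>.cat_functor_axioms]
      by (simp add: \<tau>(2) nerve_map_def)
    show "Dom (V i) (farr \<tau> (Suc k, Suc (Suc k))) = Cod (V i) (farr \<tau> (k, Suc k))" if "Suc k < m" for k
      using that o by (simp add: \<tau>.farr_Dom \<tau>.farr_Cod) (simp add: ordinal_def)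
  qed
qed

lemma n_cover_lift2:
  assumes cov: "n_cover n I V \<phi> U" and n: "2 \<le> n"
    and u: "u \<in> Arr U" "u' \<in> Arr U" "Dom U u' = Cod U u"
  obtains i v v' where "i \<in> I" "v \<in> Arr (V i)" "v' \<in> Arr (V i)" "Dom (V i) v' = Cod (V i) v"
    "farr (\<phi> i) v = u" "farr (\<phi> i) v' = u'"
proof -
  have U: "category U" using cov by (simp add: n_cover_def)
  let ?X = "(!) [Dom U u, Cod U u, Cod U u']" and ?e = "(!) [u, u']"
  have m: "enat 2 \<le> n" using n by (simp add: numeral_eq_enat)
  have X: "?X k \<in> Obj U" if "k \<le> 2" for k
    using that U u by (auto simp: numeral_2_eq_2 le_Suc_eq)
  have e: "?e k \<in> Arr U \<and> Dom U (?e k) = ?X k \<and> Cod U (?e k) = ?X (Suc k)" if "k < 2" for k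
    using that u by (auto simp: numeral_2_eq_2 less_Suc_eq)
  from cov m X e show thesis
  proof (rule n_cover_lift_chain)
    fix i v assume "i \<in> I" and v: "\<And>k. k < 2 \<Longrightarrow> v k \<in> Arr (V i) \<and> farr (\<phi> i) (v k) = ?e k"
      and c: "\<And>k. Suc k < 2 \<Longrightarrow> Dom (V i) (v (Suc k)) = Cod (V i) (v k)"
    then show thesis
      using that[of i "v 0" "v 1"] v[of 0] v[of 1] c[of 0] by simp
  qed
qed

lemma n_cover_lift3:
  assumes cov: "n_cover n I V \<phi> U" and n: "3 \<le> n"
    and u: "u \<in> Arr U" "u' \<in> Arr U" "u'' \<in> Arr U" "Dom U u' = Cod U u" "Dom U u'' = Cod U u'"
  obtains i v v' v'' where "i \<in> I" "v \<in> Arr (V i)" "v' \<in> Arr (V i)" "v'' \<in> Arr (V i)"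
    "Dom (V i) v' = Cod (V i) v" "Dom (V i) v'' = Cod (V i) v'"
    "farr (\<phi> i) v = u" "farr (\<phi> i) v' = u'" "farr (\<phi> i) v'' = u''"
proof -
  have U: "category U" using cov by (simp add: n_cover_def)
  let ?X = "(!) [Dom U u, Cod U u, Cod U u', Cod U u'']" and ?e = "(!) [u, u', u'']"
  have m: "enat 3 \<le> n" using n by (simp add: numeral_eq_enat)
  have X: "?X k \<in> Obj U" if "k \<le> 3" for k
    using that U u by (auto simp: numeral_3_eq_3 le_Suc_eq)
  have e: "?e k \<in> Arr U \<and> Dom U (?e k) = ?X k \<and> Cod U (?e k) = ?X (Suc k)" if "k < 3" for k
    using that u by (auto simp: numeral_3_eq_3 less_Suc_eq)
  from cov m X e show thesis
  proof (rule n_cover_lift_chain)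
    fix i v assume "i \<in> I" and v: "\<And>k. k < 3 \<Longrightarrow> v k \<in> Arr (V i) \<and> farr (\<phi> i) (v k) = ?e k"
      and c: "\<And>k. Suc k < 3 \<Longrightarrow> Dom (V i) (v (Suc k)) = Cod (V i) (v k)"
    then show thesis
      using that[of i "v 0" "v 1" "v 2"] v[of 0] v[of 1] v[of 2] c[of 0] c[of 1]
      by (simp add: numeral_2_eq_2)
  qed
qed

section \<open>Prestack\<close>

text \<open>
  Pairs of composable arrows are all that the axioms of a graded functor involve. Composing with
  identities shows that single arrows and objects lift as well.
\<close>

locale pair_lifting_family = covering_family R I V \<phi> U
  for R :: "('k, 'r) ring_scheme" and I :: "'i set" and V :: "'i \<Rightarrow> ('vo, 'va) cat"
    and \<phi> :: "'i \<Rightarrow> ('vo, 'va, 'uo, 'ua) func" and U :: "('uo, 'ua) cat" +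
  assumes lift2: "\<lbrakk>u \<in> Arr U; u' \<in> Arr U; Dom U u' = Cod U u\<rbrakk> \<Longrightarrow>
    \<exists>i\<in>I. \<exists>v\<in>Arr (V i). \<exists>v'\<in>Arr (V i). Dom (V i) v' = Cod (V i) v \<and>
      farr (\<phi> i) v = u \<and> farr (\<phi> i) v' = u'"
begin

lemma lift1:
  assumes "u \<in> Arr U" shows "\<exists>i\<in>I. \<exists>v\<in>Arr (V i). farr (\<phi> i) v = u"
  using lift2[of u "Ident U (Cod U u)"] assms by fastforce

lemma lift0:
  assumes X: "X \<in> Obj U" shows "\<exists>i\<in>I. \<exists>Y\<in>Obj (V i). fob (\<phi> i) Y = X"
proof -
  obtain i v where "i \<in> I" "v \<in> Arr (V i)" "farr (\<phi> i) v = Ident U X"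
    using lift1[of "Ident U X"] X by auto
  then show ?thesis
    using X cat_functor.farr_Dom[OF \<phi>, of i v] by (intro bexI[of _ i] bexI[of _ "Dom (V i) v"]) auto
qed

lemma comparison_inj:
  assumes F: "graded_functor R U a U b F" "Psi F = id_func U"
    and G: "graded_functor R U a U b G" "Psi G = id_func U"
    and eq: "\<And>i. i \<in> I \<Longrightarrow> res_gfun (V i) (\<phi> i) a F = res_gfun (V i) (\<phi> i) a G"
  shows "F = G"
proof (rule gfun_eqI[OF F(1) G(1)])
  show "Psi F = Psi G" by (simp add: F G)
next
  fix X A assume "X \<in> Obj U" "A \<in> gob a X"
  then obtain i Y where i: "i \<in> I" "Y \<in> Obj (V i)" "fob (\<phi> i) Y = X" "A \<in> gob a (fob (\<phi> i) Y)"
    using lift0 by blast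
  then show "gf_ob F (X, A) = gf_ob G (X, A)"
    using res_gfun_apply(2)[OF V[OF i(1)] i(2,4), of F] res_gfun_apply(2)[OF V[OF i(1)] i(2,4), of G] eq
    by simp
next
  fix u A A' f assume *: "u \<in> Arr U" "A \<in> gob a (Dom U u)" "A' \<in> gob a (Cod U u)"
    "f \<in> carrier (ghom a (u, A, A'))"
  then obtain i v where i: "i \<in> I" "v \<in> Arr (V i)" "farr (\<phi> i) v = u"
    using lift1 by blast
  then have "A \<in> gob a (fob (\<phi> i) (Dom (V i) v))" "A' \<in> gob a (fob (\<phi> i) (Cod (V i) v))"
    using * cat_functor.farr_Dom[OF \<phi>, of i v] cat_functor.farr_Cod[OF \<phi>, of i v] by auto
  then show "gf_hom F (u, A, A') f = gf_hom G (u, A, A') f"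
    using res_gfun_apply(3)[OF V[OF i(1)] i(2), of A a "\<phi> i" A' f] * eq[OF i(1)] i
    by metis
qed

text \<open>
  Objects and arrows of \<open>U\<close> have many lifts; the agreement of the \<open>F i\<close> makes the value at a
  chosen lift equal to the value at any other. Each axiom for \<open>G\<close> thus is an axiom for some \<open>F i\<close>,
  at a lift adapted to the axiom; respecting composition needs a lift of a composable pair.
\<close>

lemma glue_gfun:
  assumes a: "graded_category R U a" and b: "graded_category R U b"
    and F: "\<And>i. i \<in> I \<Longrightarrow> graded_functor R (V i) (pull (V i) (\<phi> i) a) (V i) (pull (V i) (\<phi> i) b) (F i)"
    and Psi: "\<And>i. i \<in> I \<Longrightarrow> Psi (F i) = id_func (V i)"
    and agree_ob: "\<And>i j Y Z A. \<lbrakk>i \<in> I; j \<in> I; Y \<in> Obj (V i); Z \<in> Obj (V j); fob (\<phi> i) Y = fob (\<phi> j) Z;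
      A \<in> gob a (fob (\<phi> i) Y)\<rbrakk> \<Longrightarrow> gf_ob (F i) (Y, A) = gf_ob (F j) (Z, A)"
    and agree_hom: "\<And>i j v w A A' f. \<lbrakk>i \<in> I; j \<in> I; v \<in> Arr (V i); w \<in> Arr (V j); farr (\<phi> i) v = farr (\<phi> j) w;
      A \<in> gob a (fob (\<phi> i) (Dom (V i) v)); A' \<in> gob a (fob (\<phi> i) (Cod (V i) v));
      f \<in> carrier (ghom a (farr (\<phi> i) v, A, A'))\<rbrakk> \<Longrightarrow>
      gf_hom (F i) (v, A, A') f = gf_hom (F j) (w, A, A') f"
  obtains G where "graded_functor R U a U b G" "Psi G = id_func U"
    "\<And>i. i \<in> I \<Longrightarrow> res_gfun (V i) (\<phi> i) a G = F i"
proof -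
  interpret a: graded_category R U a by fact
  interpret b: graded_category R U b by fact
  obtain pi pY where p: "\<And>X. X \<in> Obj U \<Longrightarrow> pi X \<in> I \<and> pY X \<in> Obj (V (pi X)) \<and> fob (\<phi> (pi X)) (pY X) = X"
    using lift0 by metis
  obtain ei ev where ar: "\<And>u. u \<in> Arr U \<Longrightarrow> ei u \<in> I \<and> ev u \<in> Arr (V (ei u)) \<and> farr (\<phi> (ei u)) (ev u) = u"
    using lift1 by metis
  define G where "G = \<lparr>Psi = id_func U,
    gf_ob = \<lambda>(X, A)\<in>ob_index U (gob a). gf_ob (F (pi X)) (pY X, A),
    gf_hom = \<lambda>(u, A, A')\<in>hom_index U (gob a). \<lambda>f\<in>carrier (ghom a (u, A, A')).
      gf_hom (F (ei u)) (ev u, A, A') f\<rparr>"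
  have dom: "fob (\<phi> i) (Dom (V i) v) = Dom U (farr (\<phi> i) v)"
    and cod: "fob (\<phi> i) (Cod (V i) v) = Cod U (farr (\<phi> i) v)" if "i \<in> I" "v \<in> Arr (V i)" for i v
    using cat_functor.farr_Dom[OF \<phi>[OF that(1)] that(2)] cat_functor.farr_Cod[OF \<phi>[OF that(1)] that(2)]
    by simp_all
  have G_ob: "gf_ob G (fob (\<phi> i) Y, A) = gf_ob (F i) (Y, A)"
    if "i \<in> I" "Y \<in> Obj (V i)" "A \<in> gob a (fob (\<phi> i) Y)" for i Y A
    using that p[of "fob (\<phi> i) Y"] \<phi>[OF that(1)] by (auto simp: G_def intro!: agree_ob)
  have G_hom: "gf_hom G (farr (\<phi> i) v, A, A') f = gf_hom (F i) (v, A, A') f"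
    if "i \<in> I" "v \<in> Arr (V i)" "A \<in> gob a (Dom U (farr (\<phi> i) v))" "A' \<in> gob a (Cod U (farr (\<phi> i) v))"
      "f \<in> carrier (ghom a (farr (\<phi> i) v, A, A'))" for i v A A' f
  proof -
    have u: "farr (\<phi> i) v \<in> Arr U" using that(1,2) by simp
    show ?thesis
      using that u ar[OF u] by (auto simp: G_def dom cod intro!: agree_hom)
  qed
  have G: "graded_functor R U a U b G"
  proof (rule graded_functorI, goal_cases)
    case (5 X A)
    then obtain i Y where i: "i \<in> I" "Y \<in> Obj (V i)" "fob (\<phi> i) Y = X" using lift0 by blast
    then interpret F: graded_functor R "V i" "pull (V i) (\<phi> i) a" "V i" "pull (V i) (\<phi> i) b" "F i"
        using F by simp
    show ?case
      using F.gf_ob_closed'[of Y A] G_ob[of i Y A] i 5 Psi[OF i(1)] by (simp add: G_def)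
  next
    case (8 u A A')
    then obtain i v where i: "i \<in> I" "v \<in> Arr (V i)" "farr (\<phi> i) v = u" using lift1 by blast
    then interpret F: graded_functor R "V i" "pull (V i) (\<phi> i) a" "V i" "pull (V i) (\<phi> i) b" "F i"
        using F by simp
    have lin: "linear_map R (ghom a (u, A, A'))
        (ghom b (u, gf_ob (F i) (Dom (V i) v, A), gf_ob (F i) (Cod (V i) v, A'))) (gf_hom (F i) (v, A, A'))"
      using F.gf_hom_linear[of "(v, A, A')"] F.gf_ob_closed'[of "Dom (V i) v" A]
        F.gf_ob_closed'[of "Cod (V i) v" A'] 8 i Psi[OF i(1)]
      by (simp add: dom cod)
    have "gf_ob (F i) (Dom (V i) v, A) = gf_ob G (Dom U u, A)" "gf_ob (F i) (Cod (V i) v, A') =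
        gf_ob G (Cod U u, A')"
      using G_ob[of i "Dom (V i) v" A] G_ob[of i "Cod (V i) v" A'] i 8 by (simp_all add: dom cod)
    moreover have "linear_map R (ghom a (u, A, A'))
        (ghom b (u, gf_ob (F i) (Dom (V i) v, A), gf_ob (F i) (Cod (V i) v, A'))) (gf_hom G (u, A, A'))"
      by (rule linear_map_cong[OF a.ghom_module' lin]) (use 8 i G_hom[of i v A A'] in auto)
    ultimately show ?case using 8 by (simp add: G_def)
  next
    case (9 X A)
    then obtain i Y where i: "i \<in> I" "Y \<in> Obj (V i)" "fob (\<phi> i) Y = X" using lift0 by blast
    then interpret F: graded_functor R "V i" "pull (V i) (\<phi> i) a" "V i" "pull (V i) (\<phi> i) b" "F i"
        using F by simp
    have "farr (\<phi> i) (Ident (V i) Y) = Ident U X" using i cat_functor.farr_Ident[OF \<phi>] by simp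
    moreover have "gf_ob (F i) (Y, A) \<in> gob b X"
      using F.gf_ob_closed'[of Y A] i 9 Psi[OF i(1)] by simp
    ultimately show ?case
      using G_hom[of i "Ident (V i) Y" A A "gid a (X, A)"] F.gf_hom_gid[of Y A] i 9 G_ob[of i Y A]
          Psi[OF i(1)]
        a.gid_closed[of X A]
      by (simp add: G_def)
  next
    case (10 u' u A A' A'' f g)
    then obtain i v v' where i: "i \<in> I" "v \<in> Arr (V i)" "v' \<in> Arr (V i)" "Dom (V i) v' = Cod (V i) v"
      "farr (\<phi> i) v = u" "farr (\<phi> i) v' = u'" using lift2 by metis
    then interpret F: graded_functor R "V i" "pull (V i) (\<phi> i) a" "V i" "pull (V i) (\<phi> i) b" "F i"
        using F by simp
    have c: "farr (\<phi> i) (Cmp (V i) v' v) = Cmp U u' u"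
      using i cat_functor.farr_Cmp[OF \<phi>[OF i(1)] i(2,3,4)] by simp
    have obs: "gf_ob (F i) (Dom (V i) v, A) \<in> gob b (Dom U u)" "gf_ob (F i) (Cod (V i) v, A') \<in> gob b
        (Cod U u)"
      "gf_ob (F i) (Cod (V i) v', A'') \<in> gob b (Cod U u')"
      using F.gf_ob_closed'[of "Dom (V i) v" A] F.gf_ob_closed'[of "Cod (V i) v" A']
        F.gf_ob_closed'[of "Cod (V i) v'" A''] i 10 Psi[OF i(1)] by (simp_all add: dom cod)
    have "gf_hom (F i) (Cmp (V i) v' v, A, A'') (gcomp a (u', u, A, A', A'') g f) =
        gcomp b (u', u, gf_ob (F i) (Dom (V i) v, A), gf_ob (F i) (Cod (V i) v, A'), gf_ob (F i) (Cod (V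
            i) v', A''))
          (gf_hom (F i) (v', A', A'') g) (gf_hom (F i) (v, A, A') f)"
      using F.gf_hom_gcomp[of v' v A A' A'' f g] i 10 Psi[OF i(1)] obs
      by (simp add: dom cod)
    moreover have "gf_hom G (Cmp U u' u, A, A'') (gcomp a (u', u, A, A', A'') g f) =
        gf_hom (F i) (Cmp (V i) v' v, A, A'') (gcomp a (u', u, A, A', A'') g f)"
      using G_hom[of i "Cmp (V i) v' v" A A''] i 10 a.gcomp_closed[of u u' A A' A'' g f] c by simp
    moreover have "gf_ob (F i) (Dom (V i) v, A) = gf_ob G (Dom U u, A)" "gf_ob (F i) (Cod (V i) v, A') =
        gf_ob G (Cod U u, A')"
      "gf_ob (F i) (Cod (V i) v', A'') = gf_ob G (Cod U u', A'')"
      using G_ob[of i "Dom (V i) v" A] G_ob[of i "Cod (V i) v" A'] G_ob[of i "Cod (V i) v'" A''] i 10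
      by (simp_all add: dom cod)
    moreover have "gf_hom G (u, A, A') f = gf_hom (F i) (v, A, A') f" "gf_hom G (u', A', A'') g =
        gf_hom (F i) (v', A', A'') g"
      using G_hom[of i v A A' f] G_hom[of i v' A' A'' g] i 10 by simp_all
    ultimately show ?case using 10 by (simp add: G_def)
  qed (simp_all add: G_def)
  have G_hom': "gf_hom G (farr (\<phi> i) v, A, A') f = gf_hom (F i) (v, A, A') f"
    if "i \<in> I" "v \<in> Arr (V i)" "A \<in> gob a (fob (\<phi> i) (Dom (V i) v))"
      "A' \<in> gob a (fob (\<phi> i) (Cod (V i) v))" "f \<in> carrier (ghom a (farr (\<phi> i) v, A, A'))" for i v A A' f
    using that G_hom[of i v A A' f] by (simp add: dom cod)
  have "Psi G = id_func U" by (simp add: G_def)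
  then have "res_gfun (V i) (\<phi> i) a G = F i" if i: "i \<in> I" for i
    by (intro gfun_eqI[OF res_gfun_graded[OF \<phi>[OF i] G] F[OF i]])
       (use i Psi in \<open>simp_all add: G_ob G_hom'\<close>)
  with G show thesis by (intro that) (auto simp: G_def)
qed

text \<open>
  For morphisms between restrictions of objects over \<open>U\<close> the transition isomorphisms are
  identities. Compatibility then says that the restrictions to the double fibre product coincide,
  that is, that the components agree at any two lifts of the same object or arrow.
\<close>

lemma agree_over_base:
  assumes i: "i \<in> I" and j: "j \<in> I"
    and F: "graded_functor R (V i) a (V i) b F" "Psi F = id_func (V i)"
    and G: "graded_functor R (V j) c (V j) d G" "Psi G = id_func (V j)"
    and eq: "farr (res1 i j) (a, F, b) = farr (res2 i j) (c, G, d)"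
  shows "\<lbrakk>Y \<in> Obj (V i); Z \<in> Obj (V j); fob (\<phi> i) Y = fob (\<phi> j) Z; A \<in> gob a Y; A \<in> gob c Z\<rbrakk> \<Longrightarrow>
      gf_ob F (Y, A) = gf_ob G (Z, A)"
    and "\<lbrakk>v \<in> Arr (V i); w \<in> Arr (V j); farr (\<phi> i) v = farr (\<phi> j) w;
      A \<in> gob a (Dom (V i) v); A' \<in> gob a (Cod (V i) v); A \<in> gob c (Dom (V j) w); A' \<in> gob c (Cod (V j) w);
      f \<in> carrier (ghom a (v, A, A')); f \<in> carrier (ghom c (w, A, A'))\<rbrakk> \<Longrightarrow>
      gf_hom F (v, A, A') f = gf_hom G (w, A, A') f"
proof -
  let ?P = "Dbl i j"
  have res: "res_gfun ?P (pr1 ?P) a F = res_gfun ?P (pr2 ?P) c G"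
    using eq by (simp add: Map'_functor_arr[OF dbl(2)[OF i j] F] Map'_functor_arr[OF dbl(3)[OF i j] G])
  show "gf_ob F (Y, A) = gf_ob G (Z, A)"
    if "Y \<in> Obj (V i)" "Z \<in> Obj (V j)" "fob (\<phi> i) Y = fob (\<phi> j) Z" "A \<in> gob a Y" "A \<in> gob c Z"
  proof -
    have P: "(Y, Z) \<in> Obj ?P" using that by (simp add: dbl_def fprod_def)
    have pr: "fob (pr1 ?P) (Y, Z) = Y" "fob (pr2 ?P) (Y, Z) = Z"
      using P by (simp_all add: pr1_def pr2_def proj_func_def)
    show ?thesis
      using res_gfun_apply(2)[OF dbl(1)[OF i j] P, of A a "pr1 ?P" F]
        res_gfun_apply(2)[OF dbl(1)[OF i j] P, of A c "pr2 ?P" G] that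
      by (simp add: pr res)
  qed
  show "gf_hom F (v, A, A') f = gf_hom G (w, A, A') f"
    if v: "v \<in> Arr (V i)" "w \<in> Arr (V j)" "farr (\<phi> i) v = farr (\<phi> j) w" and
      "A \<in> gob a (Dom (V i) v)" "A' \<in> gob a (Cod (V i) v)" "A \<in> gob c (Dom (V j) w)" "A' \<in> gob c (Cod (V
          j) w)"
      "f \<in> carrier (ghom a (v, A, A'))" "f \<in> carrier (ghom c (w, A, A'))"
  proof -
    have P: "(v, w) \<in> Arr ?P" using that by (simp add: dbl_def fprod_def)
    have D: "Dom ?P (v, w) = (Dom (V i) v, Dom (V j) w)" "Cod ?P (v, w) = (Cod (V i) v, Cod (V j) w)"
      by (simp_all add: dbl_def fprod_def)
    have O: "Dom ?P (v, w) \<in> Obj ?P" "Cod ?P (v, w) \<in> Obj ?P"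
      using P i j by simp_all
    have pr: "farr (pr1 ?P) (v, w) = v" "farr (pr2 ?P) (v, w) = w"
      "fob (pr1 ?P) (Dom ?P (v, w)) = Dom (V i) v" "fob (pr2 ?P) (Dom ?P (v, w)) = Dom (V j) w"
      "fob (pr1 ?P) (Cod ?P (v, w)) = Cod (V i) v" "fob (pr2 ?P) (Cod ?P (v, w)) = Cod (V j) w"
      using P O by (simp_all add: pr1_def pr2_def proj_func_def, simp_all add: D)
    show ?thesis
      using res_gfun_apply(3)[OF dbl(1)[OF i j] P, of A a "pr1 ?P" A' f F]
        res_gfun_apply(3)[OF dbl(1)[OF i j] P, of A c "pr2 ?P" A' f G] that
      by (simp only: pr res)
  qed
qed

theorem comparison_fully_faithful:
  "fully_faithful (Map' R U) (Des R I V \<phi>)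
    (comparison R I V \<phi> U :: (('uo, 'ua, 'x, 'k, 'm) gcat, _, _, _) func)"
  unfolding fully_faithful_def
proof (intro conjI ballI comparison_functor)
  let ?K = "comparison R I V \<phi> U :: (('uo, 'ua, 'x, 'k, 'm) gcat, _, _, _) func"
  fix a b :: "('uo, 'ua, 'x, 'k, 'm) gcat"
  assume "a \<in> Obj (Map' R U)" "b \<in> Obj (Map' R U)"
  then have a: "graded_category R U a" and b: "graded_category R U b" by (simp_all add: Map'_sel)
  have K: "fob ?K c = canon c" if "graded_category R U c" for c
    using that by (simp add: comparison_def Map'_sel)
  have K_arr: "farr ?K (a, F, b) = (canon a,
       \<lambda>i\<in>I. (pull (V i) (\<phi> i) a, res_gfun (V i) (\<phi> i) a F, pull (V i) (\<phi> i) b), canon b)"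
    if "graded_functor R U a U b F" "Psi F = id_func U" for F
    using that by (auto simp: comparison_def Map'_sel Map'_functor_arr[OF \<phi>] intro!: restrict_ext)
  show "bij_betw (farr ?K) (arrows (Map' R U) a b) (arrows (Des R I V \<phi>) (fob ?K a) (fob ?K b))"
  proof (rule bij_betw_imageI)
    show "inj_on (farr ?K) (arrows (Map' R U) a b)"
    proof (rule inj_onI)
      fix f g assume *: "f \<in> arrows (Map' R U) a b" "g \<in> arrows (Map' R U) a b" "farr ?K f = farr ?K g"
      then obtain F G where fg: "f = (a, F, b)" "g = (a, G, b)"
        and F: "graded_functor R U a U b F" "Psi F = id_func U"
        and G: "graded_functor R U a U b G" "Psi G = id_func U"
        by (cases f; cases g) (auto simp: arrows_def Map'_sel)
      have "(\<lambda>i\<in>I. (pull (V i) (\<phi> i) a, res_gfun (V i) (\<phi> i) a F, pull (V i) (\<phi> i) b)) =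
          (\<lambda>i\<in>I. (pull (V i) (\<phi> i) a, res_gfun (V i) (\<phi> i) a G, pull (V i) (\<phi> i) b))"
        using *(3) by (simp add: fg K_arr F G)
      then have "res_gfun (V i) (\<phi> i) a F = res_gfun (V i) (\<phi> i) a G" if "i \<in> I" for i
        using that by (auto dest: fun_cong[where x = i])
      then show "f = g" using comparison_inj[OF F G] by (simp add: fg)
    qed
    show "farr ?K ` arrows (Map' R U) a b = arrows (Des R I V \<phi>) (fob ?K a) (fob ?K b)"
    proof (intro equalityI subsetI)
      fix g assume "g \<in> farr ?K ` arrows (Map' R U) a b"
      then obtain f where "f \<in> Arr (Map' R U)" "Dom (Map' R U) f = a" "Cod (Map' R U) f = b" "g = farr ?K f"
        by (auto simp: arrows_def)
      then show "g \<in> arrows (Des R I V \<phi>) (fob ?K a) (fob ?K b)"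
        by (simp add: arrows_def functor_rules[OF comparison_functor])
    next
      fix g assume "g \<in> arrows (Des R I V \<phi>) (fob ?K a) (fob ?K b)"
      then obtain f where g: "g = (canon a, f, canon b)"
        and "(canon a, f, canon b) \<in> descent_arrows R I V \<phi>"
        by (cases g) (auto simp: arrows_def Des_sel K a b)
      note f = this(2)[unfolded descent_arrows_iff]
      define F where "F i = fst (snd (f i))" for i
      have fF: "f i = (pull (V i) (\<phi> i) a, F i, pull (V i) (\<phi> i) b)"
        and F: "graded_functor R (V i) (pull (V i) (\<phi> i) a) (V i) (pull (V i) (\<phi> i) b) (F i)"
        and Psi: "Psi (F i) = id_func (V i)" if "i \<in> I" for i
        using f that a b by (cases "f i"; force simp: F_def Map'_sel)+
      \<comment> \<open>the transition isomorphisms are identities and drop out\<close>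
  have agree: "farr (res1 i j) (f i) = farr (res2 i j) (f j)" if ij: "i \<in> I" "j \<in> I" for i j
      proof -
        interpret M: category "Map' R (Dbl i j)" using ij by simp
        have "fob (res1 i j) (pull (V i) (\<phi> i) b) = pull (Dbl i j) (comp_func (Dbl i j) (\<phi> i) (pr1 (Dbl
            i j))) b"
          "fob (res2 i j) (pull (V j) (\<phi> j) a) = pull (Dbl i j) (comp_func (Dbl i j) (\<phi> i) (pr1 (Dbl i j))) a"
          using ij a b by (simp_all add: pull_graded[OF \<phi>] pull_pull[OF \<phi> dbl(2)] pull_pull[OF \<phi> dbl(3)]
            dbl_square[OF ij])
        then show ?thesis
          using f ij a b M.Cmp_Ident_left[of "farr (res1 i j) (f i)"] M.Cmp_Ident_right[of "farr (res2 i
              j) (f j)"]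
          by simp
      qed
      obtain G where G: "graded_functor R U a U b G" "Psi G = id_func U"
        and res: "\<And>i. i \<in> I \<Longrightarrow> res_gfun (V i) (\<phi> i) a G = F i"
      proof (rule glue_gfun[OF a b F Psi])
        fix i j Y Z A
        assume ij: "i \<in> I" "j \<in> I" and "Y \<in> Obj (V i)" "Z \<in> Obj (V j)" "fob (\<phi> i) Y = fob (\<phi> j) Z"
          "A \<in> gob a (fob (\<phi> i) Y)"
        then show "gf_ob (F i) (Y, A) = gf_ob (F j) (Z, A)"
          using agree_over_base(1)[OF ij F[OF ij(1)] Psi[OF ij(1)] F[OF ij(2)] Psi[OF ij(2)]] agree[OF ij]
          by (simp add: fF)
      next
        fix i j v w A A' x
        assume ij: "i \<in> I" "j \<in> I" and *: "v \<in> Arr (V i)" "w \<in> Arr (V j)" "farr (\<phi> i) v = farr (\<phi> j) w"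
          "A \<in> gob a (fob (\<phi> i) (Dom (V i) v))" "A' \<in> gob a (fob (\<phi> i) (Cod (V i) v))"
          "x \<in> carrier (ghom a (farr (\<phi> i) v, A, A'))"
        have "fob (\<phi> i) (Dom (V i) v) = fob (\<phi> j) (Dom (V j) w)" "fob (\<phi> i) (Cod (V i) v) =
            fob (\<phi> j) (Cod (V j) w)"
          using fob_Dom_eq[OF \<phi>[OF ij(1)] \<phi>[OF ij(2)] *(1,2,3)] .
        then show "gf_hom (F i) (v, A, A') x = gf_hom (F j) (w, A, A') x"
          using agree_over_base(2)[OF ij F[OF ij(1)] Psi[OF ij(1)] F[OF ij(2)] Psi[OF ij(2)], of v w A
              A' x] agree[OF ij] ij *
          by (simp add: fF)
      qed auto
      have "(\<lambda>i\<in>I. (pull (V i) (\<phi> i) a, res_gfun (V i) (\<phi> i) a G, pull (V i) (\<phi> i) b)) = f"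
        by (rule extensionalityI[of _ I]) (use f in \<open>simp_all add: res fF\<close>)
      then have "farr ?K (a, G, b) = g" by (simp add: g K_arr[OF G])
      then show "g \<in> farr ?K ` arrows (Map' R U) a b"
        using G by (intro image_eqI[of _ _ "(a, G, b)"]) (simp_all add: arrows_def Map'_sel)
    qed
  qed
qed

end

lemma n_cover_pair_lifting:
  assumes "n_cover n I V \<phi> U" "2 \<le> n"
  shows "pair_lifting_family I V \<phi> U"
proof (intro pair_lifting_family.intro covering_family.intro pair_lifting_family_axioms.intro)
  show "category U" "\<And>i. i \<in> I \<Longrightarrow> cat_functor (V i) U (\<phi> i)"
    using assms(1) by (simp_all add: n_cover_def)
  show "\<exists>i\<in>I. \<exists>v\<in>Arr (V i). \<exists>v'\<in>Arr (V i). Dom (V i) v' = Cod (V i) v \<and>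
      farr (\<phi> i) v = u \<and> farr (\<phi> i) v' = u'"
    if "u \<in> Arr U" "u' \<in> Arr U" "Dom U u' = Cod U u" for u u'
    using n_cover_lift2[OF assms that] by metis
qed

section \<open>Gluing graded categories\<close>

lemma linear_map_inv:
  assumes M: "Module.module R M" and f: "linear_map R M N f" and bij: "bij_betw f (carrier M) (carrier N)"
  shows "linear_map R N M (inv_into (carrier M) f)"
proof -
  interpret M: Module.module R M by fact
  let ?g = "inv_into (carrier M) f"
  have g: "?g y \<in> carrier M" "f (?g y) = y" if "y \<in> carrier N" for y
    using that bij by (auto simp: bij_betw_def inv_into_into f_inv_into_f)
  \<comment> \<open>uniqueness of preimages then moves the equations from \<open>N\<close> to \<open>M\<close>\<close>
  have gf: "?g (f x) = x" if "x \<in> carrier M" for x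
    using that bij by (simp add: bij_betw_def)
  have "?g (y \<oplus>\<^bsub>N\<^esub> z) = ?g y \<oplus>\<^bsub>M\<^esub> ?g z" if "y \<in> carrier N" "z \<in> carrier N" for y z
  proof -
    have "f (?g y \<oplus>\<^bsub>M\<^esub> ?g z) = y \<oplus>\<^bsub>N\<^esub> z" using f g that by (simp add: linear_map_def)
    then show ?thesis using gf[of "?g y \<oplus>\<^bsub>M\<^esub> ?g z"] g that by simp
  qed
  moreover have "?g (r \<odot>\<^bsub>N\<^esub> y) = r \<odot>\<^bsub>M\<^esub> ?g y" if "r \<in> carrier R" "y \<in> carrier N" for r y
  proof -
    have "f (r \<odot>\<^bsub>M\<^esub> ?g y) = r \<odot>\<^bsub>N\<^esub> y" using f g that by (simp add: linear_map_def)
    then show ?thesis using gf[of "r \<odot>\<^bsub>M\<^esub> ?g y"] g that by simp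
  qed
  ultimately show ?thesis using g by (simp add: linear_map_def)
qed

text \<open>
  The inverse consists of the inverse maps. It respects identities, composition and the module
  structure because its values are determined by their images under \<open>F\<close>, which do.
\<close>

lemma bijective_gfun_iso:
  assumes F: "graded_functor R U a U b F" and Psi: "Psi F = id_func U"
    and ob: "\<And>X. X \<in> Obj U \<Longrightarrow> bij_betw (\<lambda>A. gf_ob F (X, A)) (gob a X) (gob b X)"
    and hom: "\<And>u A A'. \<lbrakk>u \<in> Arr U; A \<in> gob a (Dom U u); A' \<in> gob a (Cod U u)\<rbrakk> \<Longrightarrow>
      bij_betw (gf_hom F (u, A, A')) (carrier (ghom a (u, A, A')))
        (carrier (ghom b (u, gf_ob F (Dom U u, A), gf_ob F (Cod U u, A'))))"
  shows "iso_arr (Map' R U) (a, F, b)"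
proof -
  interpret F: graded_functor R U a U b F by fact
  define o' where "o' X B = inv_into (gob a X) (\<lambda>A. gf_ob F (X, A)) B" for X B
  have o'[simp]: "o' X B \<in> gob a X" "gf_ob F (X, o' X B) = B" if "X \<in> Obj U" "B \<in> gob b X" for X B
    using ob[OF that(1)] that(2) f_inv_into_f[of B "\<lambda>A. gf_ob F (X, A)" "gob a X"]
    by (auto simp: o'_def bij_betw_def inv_into_into)
  have o'_ob [simp]: "o' X (gf_ob F (X, A)) = A" if "X \<in> Obj U" "A \<in> gob a X" for X A
    using ob[OF that(1)] that(2) inv_into_f_f[of "\<lambda>A. gf_ob F (X, A)" "gob a X" A]
    by (simp add: o'_def bij_betw_def)
  define h where "h u B B' = inv_into (carrier (ghom a (u, o' (Dom U u) B, o' (Cod U u) B')))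
    (gf_hom F (u, o' (Dom U u) B, o' (Cod U u) B'))" for u B B'
  have bij: "bij_betw (gf_hom F (u, o' (Dom U u) B, o' (Cod U u) B'))
      (carrier (ghom a (u, o' (Dom U u) B, o' (Cod U u) B'))) (carrier (ghom b (u, B, B')))"
    if "u \<in> Arr U" "B \<in> gob b (Dom U u)" "B' \<in> gob b (Cod U u)" for u B B'
    using hom[of u "o' (Dom U u) B" "o' (Cod U u) B'"] that by simp
  have h: "h u B B' y \<in> carrier (ghom a (u, o' (Dom U u) B, o' (Cod U u) B'))"
    "gf_hom F (u, o' (Dom U u) B, o' (Cod U u) B') (h u B B' y) = y"
    if "u \<in> Arr U" "B \<in> gob b (Dom U u)" "B' \<in> gob b (Cod U u)" "y \<in> carrier (ghom b (u, B, B'))" for u B B' y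
    using bij[OF that(1-3)] that(4) by (auto simp: h_def bij_betw_def inv_into_into f_inv_into_f)
  \<comment> \<open>equations for the inverse are verified after applying \<open>F\<close>\<close>
  have h_eq: "h u B B' y = x"
    if "u \<in> Arr U" "B \<in> gob b (Dom U u)" "B' \<in> gob b (Cod U u)"
      "x \<in> carrier (ghom a (u, o' (Dom U u) B, o' (Cod U u) B'))"
      "gf_hom F (u, o' (Dom U u) B, o' (Cod U u) B') x = y" for u B B' x y
    using bij[OF that(1-3)] that(4,5) by (auto simp: h_def bij_betw_def)
  define G where "G = \<lparr>Psi = id_func U, gf_ob = \<lambda>(X, B)\<in>ob_index U (gob b). o' X B,
    gf_hom = \<lambda>(u, B, B')\<in>hom_index U (gob b). \<lambda>y\<in>carrier (ghom b (u, B, B')). h u B B' y\<rparr>"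
  have G: "graded_functor R U b U a G"
  proof (rule graded_functorI, goal_cases)
    case (8 u B B')
    have lin: "linear_map R (ghom a (u, o' (Dom U u) B, o' (Cod U u) B')) (ghom b (u, B, B'))
        (gf_hom F (u, o' (Dom U u) B, o' (Cod U u) B'))"
      using F.gf_hom_linear[of "(u, o' (Dom U u) B, o' (Cod U u) B')"] 8 Psi by simp
    have h_lin: "linear_map R (ghom b (u, B, B')) (ghom a (u, o' (Dom U u) B, o' (Cod U u) B')) (h u B B')"
      unfolding h_def by (rule linear_map_inv[OF F.B.ghom_module' lin bij]) (use 8 in simp_all)
    have "linear_map R (ghom b (u, B, B')) (ghom a (u, o' (Dom U u) B, o' (Cod U u) B')) (gf_hom G (u,
        B, B'))"
      by (rule linear_map_cong[OF F.A.ghom_module' h_lin]) (use 8 in \<open>simp_all add: G_def\<close>)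
    then show ?case using 8 by (simp add: G_def)
  next
    case (9 X B)
    have "h (Ident U X) B B (gid b (X, B)) = gid a (X, o' X B)"
      using F.gf_hom_gid[of X "o' X B"] 9 Psi by (intro h_eq) (simp_all add: F.B.gid_closed)
    then show ?case using 9 by (simp add: G_def F.A.gid_closed)
  next
    case (10 u' u B B' B'' f g)
    note hf = h[of u B B' f] and hg = h[of u' B' B'' g]
    have "h (Cmp U u' u) B B'' (gcomp b (u', u, B, B', B'') g f) =
        gcomp a (u', u, o' (Dom U u) B, o' (Cod U u) B', o' (Cod U u') B'') (h u' B' B'' g) (h u B B' f)"
      using F.gf_hom_gcomp[of u' u "o' (Dom U u) B" "o' (Cod U u) B'" "o' (Cod U u') B''" "h u B B' f"
          "h u' B' B'' g"]
        10 hf hg Psi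
      by (intro h_eq) (simp_all add: F.B.gcomp_closed)
    then show ?case using 10 by (simp add: G_def F.A.gcomp_closed)
  qed (simp_all add: G_def)
  have PsiG: "Psi G = id_func U" by (simp add: G_def)
  have "comp_gfun U a G F = id_gfun U a"
    by (rule gfun_eqI[OF comp_gfun_graded[OF F G] id_gfun_graded[OF F.B.graded_category_axioms]])
       (use F.gf_hom_closed' F.gf_ob_closed' Psi in \<open>simp_all add: PsiG Psi\<close>, simp_all add: G_def Psi h_eq)
  moreover have "comp_gfun U b F G = id_gfun U b"
    by (rule gfun_eqI[OF comp_gfun_graded[OF G F] id_gfun_graded[OF F.A.graded_category_axioms]])
       (simp_all add: PsiG Psi, simp_all add: G_def h)
  ultimately show ?thesis
    using F G Psi PsiG unfolding iso_arr_def
    by (intro conjI bexI[of _ "(b, G, a)"]) (simp_all add: arrows_def Map'_sel)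
qed

lemma bilinear_map_comp:
  assumes "bilinear_map R M N P k" "linear_map R M' M f" "linear_map R N' N g" "linear_map R P P' h"
  shows "bilinear_map R M' N' P' (\<lambda>x y. h (k (f x) (g y)))"
  unfolding bilinear_map_def
proof (intro conjI ballI)
  fix x assume "x \<in> carrier M'"
  then have "f x \<in> carrier M" using assms(2) by (rule linear_map_closed[rotated])
  then have "linear_map R N P (k (f x))" using assms(1) by (simp add: bilinear_map_def)
  then show "linear_map R N' P' (\<lambda>y. h (k (f x) (g y)))"
    by (intro linear_map_comp[OF linear_map_comp[OF assms(3)] assms(4)])
next
  fix y assume "y \<in> carrier N'"
  then have "g y \<in> carrier N" using assms(3) by (rule linear_map_closed[rotated])
  then have "linear_map R M P (\<lambda>x. k x (g y))" using assms(1) by (simp add: bilinear_map_def)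
  then show "linear_map R M' P' (\<lambda>x. h (k (f x) (g y)))"
    using linear_map_comp[OF linear_map_comp[OF assms(2), of P "\<lambda>x. k x (g y)"] assms(4)] by simp
qed

text \<open>
  Descent data along one functor \<open>\<pi> : C \<rightarrow> U\<close>, in terms of elements: \<open>t p q\<close> identifies the objects
  of \<open>b\<close> over \<open>p\<close> with those over \<open>q\<close> whenever \<open>p\<close> and \<open>q\<close> have the same image, and \<open>s e f B B'\<close>
  identifies the morphisms \<open>B \<rightarrow> B'\<close> over \<open>e\<close> with those over \<open>f\<close> between the corresponding
  objects. Chains of three arrows have to lift, for the sake of associativity.
\<close>

locale gluing = \<pi>: cat_functor C U \<pi> + b: graded_category R C b
  for R :: "('k, 'r) ring_scheme" and C :: "('co, 'ca) cat" and U :: "('uo, 'ua) cat"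
    and \<pi> :: "('co, 'ca, 'uo, 'ua) func" and b :: "('co, 'ca, 'x, 'k, 'm) gcat" +
  fixes t :: "'co \<Rightarrow> 'co \<Rightarrow> 'x \<Rightarrow> 'x" and s :: "'ca \<Rightarrow> 'ca \<Rightarrow> 'x \<Rightarrow> 'x \<Rightarrow> 'm \<Rightarrow> 'm"
  assumes lift3: "\<lbrakk>u \<in> Arr U; u' \<in> Arr U; u'' \<in> Arr U; Dom U u' = Cod U u; Dom U u'' = Cod U u'\<rbrakk> \<Longrightarrow>
      \<exists>e\<in>Arr C. \<exists>e'\<in>Arr C. \<exists>e''\<in>Arr C. Dom C e' = Cod C e \<and> Dom C e'' = Cod C e' \<and>
        farr \<pi> e = u \<and> farr \<pi> e' = u' \<and> farr \<pi> e'' = u''"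
    and t_closed: "\<lbrakk>p \<in> Obj C; q \<in> Obj C; fob \<pi> p = fob \<pi> q; B \<in> gob b p\<rbrakk> \<Longrightarrow> t p q B \<in> gob b q"
    and t_trans: "\<lbrakk>p \<in> Obj C; q \<in> Obj C; r \<in> Obj C; fob \<pi> p = fob \<pi> q; fob \<pi> q = fob \<pi> r; B \<in> gob b p\<rbrakk> \<Longrightarrow>
      t q r (t p q B) = t p r B"
    and t_refl: "\<lbrakk>p \<in> Obj C; B \<in> gob b p\<rbrakk> \<Longrightarrow> t p p B = B"
    and s_linear: "\<lbrakk>e \<in> Arr C; f \<in> Arr C; farr \<pi> e = farr \<pi> f; B \<in> gob b (Dom C e); B' \<in> gob b (Cod C e)\<rbrakk> \<Longrightarrow>
      linear_map R (ghom b (e, B, B'))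
        (ghom b (f, t (Dom C e) (Dom C f) B, t (Cod C e) (Cod C f) B')) (s e f B B')"
    and s_trans: "\<lbrakk>e \<in> Arr C; f \<in> Arr C; g \<in> Arr C; farr \<pi> e = farr \<pi> f; farr \<pi> f = farr \<pi> g;
        B \<in> gob b (Dom C e); B' \<in> gob b (Cod C e); x \<in> carrier (ghom b (e, B, B'))\<rbrakk> \<Longrightarrow>
      s f g (t (Dom C e) (Dom C f) B) (t (Cod C e) (Cod C f) B') (s e f B B' x) = s e g B B' x"
    and s_refl: "\<lbrakk>e \<in> Arr C; B \<in> gob b (Dom C e); B' \<in> gob b (Cod C e); x \<in> carrier (ghom b (e, B, B'))\<rbrakk> \<Longrightarrow>
      s e e B B' x = x"
    and s_gid: "\<lbrakk>p \<in> Obj C; q \<in> Obj C; fob \<pi> p = fob \<pi> q; B \<in> gob b p\<rbrakk> \<Longrightarrow>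
      s (Ident C p) (Ident C q) B B (gid b (p, B)) = gid b (q, t p q B)"
    and s_gcomp: "\<lbrakk>e \<in> Arr C; e' \<in> Arr C; Dom C e' = Cod C e; f \<in> Arr C; f' \<in> Arr C; Dom C f' = Cod C f;
        farr \<pi> e = farr \<pi> f; farr \<pi> e' = farr \<pi> f';
        B \<in> gob b (Dom C e); B' \<in> gob b (Cod C e); B'' \<in> gob b (Cod C e');
        x \<in> carrier (ghom b (e, B, B')); y \<in> carrier (ghom b (e', B', B''))\<rbrakk> \<Longrightarrow>
      s (Cmp C e' e) (Cmp C f' f) B B'' (gcomp b (e', e, B, B', B'') y x) =
      gcomp b (f', f, t (Dom C e) (Dom C f) B, t (Cod C e) (Cod C f) B', t (Cod C e') (Cod C f') B'')
        (s e' f' B' B'' y) (s e f B B' x)"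
begin

lemmas \<pi>_simps [simp] = cat_functor_fob[OF \<pi>.cat_functor_axioms] cat_functor_farr[OF \<pi>.cat_functor_axioms]
  \<pi>.farr_Dom \<pi>.farr_Cod \<pi>.farr_Ident \<pi>.farr_Cmp \<pi>.D.category_axioms

lemma ex_lift2: "\<lbrakk>u \<in> Arr U; u' \<in> Arr U; Dom U u' = Cod U u\<rbrakk> \<Longrightarrow>
  \<exists>e e'. e \<in> Arr C \<and> e' \<in> Arr C \<and> Dom C e' = Cod C e \<and> farr \<pi> e = u \<and> farr \<pi> e' = u'"
  using lift3[of u u' "Ident U (Cod U u')"] by fastforce

lemma ex_lift1: "u \<in> Arr U \<Longrightarrow> \<exists>e. e \<in> Arr C \<and> farr \<pi> e = u"
  using ex_lift2[of u "Ident U (Cod U u)"] by auto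

lemma ex_lift0:
  assumes "X \<in> Obj U" shows "\<exists>q. q \<in> Obj C \<and> fob \<pi> q = X"
proof -
  obtain e where "e \<in> Arr C" "farr \<pi> e = Ident U X" using ex_lift1[of "Ident U X"] assms by auto
  then show ?thesis using assms \<pi>.farr_Dom[of e] by (intro exI[of _ "Dom C e"]) simp
qed

text \<open>
  The chosen lifts, at which the glued category takes its values.
\<close>

definition pt where "pt X = (SOME q. q \<in> Obj C \<and> fob \<pi> q = X)"
definition ed where "ed u = (SOME e. e \<in> Arr C \<and> farr \<pi> e = u)"

lemma pt [simp]: "X \<in> Obj U \<Longrightarrow> pt X \<in> Obj C" "X \<in> Obj U \<Longrightarrow> fob \<pi> (pt X) = X"
  using someI_ex[OF ex_lift0[of X]] by (simp_all add: pt_def)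

lemma ed [simp]: "u \<in> Arr U \<Longrightarrow> ed u \<in> Arr C" "u \<in> Arr U \<Longrightarrow> farr \<pi> (ed u) = u"
  using someI_ex[OF ex_lift1[of u]] by (simp_all add: ed_def)

lemma fob_over:
  assumes "e \<in> Arr C" "farr \<pi> e = u" shows "fob \<pi> (Dom C e) = Dom U u" "fob \<pi> (Cod C e) = Cod U u"
  using assms by auto

text \<open>
  An object of the glued category over \<open>X\<close> is an object of \<open>b\<close> over \<open>pt X\<close>. Every lift \<open>q\<close> of \<open>X\<close>
  sees it as an object of \<open>b\<close> over \<open>q\<close>, its value at \<open>q\<close>; the values at different lifts correspond
  under \<open>t\<close> (\<open>t_val\<close>).
\<close>

definition val :: "'co \<Rightarrow> 'x \<Rightarrow> 'x" where "val q A = t (pt (fob \<pi> q)) q A"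

lemma val_closed [simp]: "q \<in> Obj C \<Longrightarrow> A \<in> gob b (pt (fob \<pi> q)) \<Longrightarrow> val q A \<in> gob b q"
  by (simp add: val_def t_closed)

lemma t_val [simp]:
  "\<lbrakk>q \<in> Obj C; r \<in> Obj C; fob \<pi> q = fob \<pi> r; A \<in> gob b (pt (fob \<pi> r))\<rbrakk> \<Longrightarrow> t q r (val q A) = val r A"
  by (simp add: val_def t_trans)

text \<open>
  Likewise, a morphism \<open>A \<rightarrow> A'\<close> of the glued category has a value at every lift \<open>e\<close> of its degree,
  an element of \<open>hom_at e A A'\<close>, and \<open>tr e f A A'\<close> passes from the value at \<open>e\<close> to the value at
  \<open>f\<close>. The predicate \<open>over u A A' e\<close> collects the conditions under which this makes sense. Since
  objects are named by their values at the chosen lifts, transport leaves \<open>A\<close> and \<open>A'\<close> unchanged,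
  and no transported objects appear in the following laws.
\<close>

definition hom_at :: "'ca \<Rightarrow> 'x \<Rightarrow> 'x \<Rightarrow> ('k, 'm) module" where
  "hom_at e A A' = ghom b (e, val (Dom C e) A, val (Cod C e) A')"

definition tr :: "'ca \<Rightarrow> 'ca \<Rightarrow> 'x \<Rightarrow> 'x \<Rightarrow> 'm \<Rightarrow> 'm" where
  "tr e f A A' = s e f (val (Dom C e) A) (val (Cod C e) A')"

definition over :: "'ua \<Rightarrow> 'x \<Rightarrow> 'x \<Rightarrow> 'ca \<Rightarrow> bool" where
  "over u A A' e \<longleftrightarrow> e \<in> Arr C \<and> farr \<pi> e = u \<and> A \<in> gob b (pt (Dom U u)) \<and> A' \<in> gob b (pt (Cod U u))"

lemma overD:
  assumes "over u A A' e"
  shows "e \<in> Arr C" "farr \<pi> e = u" "u \<in> Arr U" "fob \<pi> (Dom C e) = Dom U u" "fob \<pi> (Cod C e) = Cod U u"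
    "val (Dom C e) A \<in> gob b (Dom C e)" "val (Cod C e) A' \<in> gob b (Cod C e)"
  using assms fob_over[of e u] by (auto simp: over_def)

lemma over_t:
  assumes "over u A A' e" "over u A A' f"
  shows "t (Dom C e) (Dom C f) (val (Dom C e) A) = val (Dom C f) A"
    "t (Cod C e) (Cod C f) (val (Cod C e) A') = val (Cod C f) A'"
  using overD[OF assms(1)] overD[OF assms(2)] assms by (simp_all add: over_def)

lemma hom_module: "over u A A' e \<Longrightarrow> Module.module R (hom_at e A A')"
  unfolding hom_at_def by (rule b.ghom_module') (simp_all add: overD)

lemma tr_linear:
  assumes "over u A A' e" "over u A A' f"
  shows "linear_map R (hom_at e A A') (hom_at f A A') (tr e f A A')"
  using s_linear[of e f "val (Dom C e) A" "val (Cod C e) A'"] over_t[OF assms] overD[OF assms(1)]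
      overD[OF assms(2)]
  by (simp add: hom_at_def tr_def)

lemma tr_closed: "\<lbrakk>over u A A' e; over u A A' f; x \<in> carrier (hom_at e A A')\<rbrakk> \<Longrightarrow>
    tr e f A A' x \<in> carrier (hom_at f A A')"
  by (rule linear_map_closed[OF tr_linear])

lemma tr_trans:
  assumes "over u A A' e" "over u A A' f" "over u A A' g" "x \<in> carrier (hom_at e A A')"
  shows "tr f g A A' (tr e f A A' x) = tr e g A A' x"
  using s_trans[of e f g "val (Dom C e) A" "val (Cod C e) A'" x] over_t[OF assms(1,2)] assms(4)
    overD[OF assms(1)] overD[OF assms(2)] overD[OF assms(3)]
  by (simp add: hom_at_def tr_def)

lemma tr_refl: "\<lbrakk>over u A A' e; x \<in> carrier (hom_at e A A')\<rbrakk> \<Longrightarrow> tr e e A A' x = x"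
  by (simp add: hom_at_def tr_def s_refl overD)

definition idt :: "'co \<Rightarrow> 'x \<Rightarrow> 'm" where "idt q A = gid b (q, val q A)"

definition mul :: "'ca \<Rightarrow> 'ca \<Rightarrow> 'x \<Rightarrow> 'x \<Rightarrow> 'x \<Rightarrow> 'm \<Rightarrow> 'm \<Rightarrow> 'm" where
  "mul e' e A A' A'' = gcomp b (e', e, val (Dom C e) A, val (Cod C e) A', val (Cod C e') A'')"

lemma over_Ident: "q \<in> Obj C \<Longrightarrow> A \<in> gob b (pt (fob \<pi> q)) \<Longrightarrow> over (Ident U (fob \<pi> q)) A A (Ident C q)"
  by (simp add: over_def)

lemma over_Cmp:
  "over u A A' e \<Longrightarrow> over u' A' A'' e' \<Longrightarrow> Dom C e' = Cod C e \<Longrightarrow> over (Cmp U u' u) A A'' (Cmp C e' e)"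
  using \<pi>.farr_Dom[of e'] \<pi>.farr_Cod[of e] by (auto simp: over_def)

lemma idt_closed: "q \<in> Obj C \<Longrightarrow> A \<in> gob b (pt (fob \<pi> q)) \<Longrightarrow> idt q A \<in> carrier (hom_at (Ident C q) A A)"
  by (simp add: idt_def hom_at_def b.gid_closed)

lemma tr_idt:
  "\<lbrakk>q \<in> Obj C; r \<in> Obj C; fob \<pi> q = fob \<pi> r; A \<in> gob b (pt (fob \<pi> r))\<rbrakk> \<Longrightarrow>
    tr (Ident C q) (Ident C r) A A (idt q A) = idt r A"
  by (simp add: idt_def tr_def s_gid)

lemma mul_bilinear:
  assumes "over u A A' e" "over u' A' A'' e'" "Dom C e' = Cod C e"
  shows "bilinear_map R (hom_at e' A' A'') (hom_at e A A') (hom_at (Cmp C e' e) A A'') (mul e' e A A' A'')"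
  using b.gcomp_bilinear[of e' e "val (Dom C e) A" "val (Cod C e) A'" "val (Cod C e') A''"] assms(3)
    overD[OF assms(1)] overD[OF assms(2)]
  by (simp add: hom_at_def mul_def)

lemma mul_closed:
  assumes "over u A A' e" "over u' A' A'' e'" "Dom C e' = Cod C e"
    "y \<in> carrier (hom_at e' A' A'')" "x \<in> carrier (hom_at e A A')"
  shows "mul e' e A A' A'' y x \<in> carrier (hom_at (Cmp C e' e) A A'')"
  using bilinear_map_closed[OF mul_bilinear[OF assms(1-3)]] assms(4,5) by blast

lemma tr_mul:
  assumes "over u A A' e" "over u' A' A'' e'" "Dom C e' = Cod C e"
    "over u A A' f" "over u' A' A'' f'" "Dom C f' = Cod C f"
    "y \<in> carrier (hom_at e' A' A'')" "x \<in> carrier (hom_at e A A')"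
  shows "tr (Cmp C e' e) (Cmp C f' f) A A'' (mul e' e A A' A'' y x) =
    mul f' f A A' A'' (tr e' f' A' A'' y) (tr e f A A' x)"
  using s_gcomp[of e e' f f' "val (Dom C e) A" "val (Cod C e) A'" "val (Cod C e') A''" x y] assms
    over_t[OF assms(1,4)] over_t[OF assms(2,5)] overD[OF assms(1)] overD[OF assms(2)] overD[OF assms(4)]
        overD[OF assms(5)]
  by (simp add: hom_at_def mul_def tr_def)

lemma mul_idt_right:
  assumes "over u A A' e" "x \<in> carrier (hom_at e A A')"
  shows "mul e (Ident C (Dom C e)) A A A' x (idt (Dom C e) A) = x"
  using b.gcomp_gid_right[of e "val (Dom C e) A" "val (Cod C e) A'" x] overD[OF assms(1)] assms
  by (simp add: mul_def idt_def hom_at_def)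

lemma mul_idt_left:
  assumes "over u A A' e" "x \<in> carrier (hom_at e A A')"
  shows "mul (Ident C (Cod C e)) e A A' A' (idt (Cod C e) A') x = x"
  using b.gcomp_gid_left[of e "val (Dom C e) A" "val (Cod C e) A'" x] overD[OF assms(1)] assms
  by (simp add: mul_def idt_def hom_at_def)

lemma mul_assoc:
  assumes "over u A A' e" "over u' A' A'' e'" "over u'' A'' A''' e''" "Dom C e' = Cod C e" "Dom C e'' =
      Cod C e'"
    "x \<in> carrier (hom_at e A A')" "y \<in> carrier (hom_at e' A' A'')" "z \<in> carrier (hom_at e'' A'' A''')"
  shows "mul e'' (Cmp C e' e) A A'' A''' z (mul e' e A A' A'' y x) =
    mul (Cmp C e'' e') e A A' A''' (mul e'' e' A' A'' A''' z y) x"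
  using b.gcomp_assoc[of e' e "val (Dom C e) A" "val (Cod C e) A'" "val (Cod C e') A''" e'' "val (Cod C
      e'') A'''" x y z]
    overD[OF assms(1)] overD[OF assms(2)] overD[OF assms(3)] assms
  by (simp add: mul_def hom_at_def)

definition lift2 :: "'ua \<Rightarrow> 'ua \<Rightarrow> 'ca \<times> 'ca" where
  "lift2 u' u = (SOME (e', e). e \<in> Arr C \<and> e' \<in> Arr C \<and> Dom C e' = Cod C e \<and> farr \<pi> e = u \<and> farr \<pi> e' = u')"

lemma lift2:
  assumes "u \<in> Arr U" "u' \<in> Arr U" "Dom U u' = Cod U u"
  shows "fst (lift2 u' u) \<in> Arr C" "snd (lift2 u' u) \<in> Arr C"
    "Dom C (fst (lift2 u' u)) = Cod C (snd (lift2 u' u))"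
    "farr \<pi> (snd (lift2 u' u)) = u" "farr \<pi> (fst (lift2 u' u)) = u'"
proof -
  have "\<exists>p. case p of (e', e) \<Rightarrow> e \<in> Arr C \<and> e' \<in> Arr C \<and> Dom C e' = Cod C e \<and> farr \<pi> e = u \<and> farr \<pi> e' = u'"
    using ex_lift2[OF assms] by auto
  from someI_ex[OF this] show "fst (lift2 u' u) \<in> Arr C" "snd (lift2 u' u) \<in> Arr C"
    "Dom C (fst (lift2 u' u)) = Cod C (snd (lift2 u' u))"
    "farr \<pi> (snd (lift2 u' u)) = u" "farr \<pi> (fst (lift2 u' u)) = u'"
    unfolding lift2_def by (auto split: prod.splits)
qed

text \<open>
  Composition in the glued category is composition in \<open>b\<close> of the values at a composable pair of
  lifts. The chosen lifts \<open>ed u'\<close> and \<open>ed u\<close> need not be composable, so the pair is chosen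
  separately.
\<close>

definition gmul :: "'ua \<Rightarrow> 'ua \<Rightarrow> 'x \<Rightarrow> 'x \<Rightarrow> 'x \<Rightarrow> 'm \<Rightarrow> 'm \<Rightarrow> 'm" where
  "gmul u' u A A' A'' y x = (let (e', e) = lift2 u' u in
     tr (Cmp C e' e) (ed (Cmp U u' u)) A A'' (mul e' e A A' A'' (tr (ed u') e' A' A'' y)
       (tr (ed u) e A A' x)))"

definition gidt :: "'uo \<Rightarrow> 'x \<Rightarrow> 'm" where
  "gidt X A = tr (Ident C (pt X)) (ed (Ident U X)) A A (idt (pt X) A)"

definition glued :: "('uo, 'ua, 'x, 'k, 'm) gcat" where
  "glued = (let ob = \<lambda>X\<in>Obj U. gob b (pt X) in
     \<lparr>gob = ob,
      ghom = \<lambda>(u, A, A')\<in>hom_index U ob. hom_at (ed u) A A',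
      gcomp = \<lambda>(u', u, A, A', A'')\<in>comp_index U ob. gmul u' u A A' A'',
      gid = \<lambda>(X, A)\<in>ob_index U ob. gidt X A\<rparr>)"

lemma glued_apply [simp]:
  "X \<in> Obj U \<Longrightarrow> gob glued X = gob b (pt X)"
  "over u A A' e \<Longrightarrow> ghom glued (u, A, A') = hom_at (ed u) A A'"
  "over u A A' e \<Longrightarrow> over u' A' A'' e' \<Longrightarrow> Dom U u' = Cod U u \<Longrightarrow> gcomp glued (u', u, A, A', A'') =
      gmul u' u A A' A''"
  "X \<in> Obj U \<Longrightarrow> A \<in> gob b (pt X) \<Longrightarrow> gid glued (X, A) = gidt X A"
  by (auto simp: glued_def Let_def over_def)

lemma tr_inj:
  assumes "over u A A' e" "over u A A' f" "x \<in> carrier (hom_at e A A')" "y \<in> carrier (hom_at e A A')"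
    and "tr e f A A' x = tr e f A A' y"
  shows "x = y"
  using assms tr_trans[OF assms(1,2,1)] tr_refl[OF assms(1)] by metis

lemma over_lift2:
  assumes "over u A A' e" "over u' A' A'' e'" "Dom U u' = Cod U u"
  obtains f f' where "lift2 u' u = (f', f)" "over u A A' f" "over u' A' A'' f'" "Dom C f' = Cod C f"
  using lift2[OF overD(3)[OF assms(1)] overD(3)[OF assms(2)] assms(3)] assms
  by (cases "lift2 u' u") (auto simp: over_def)

lemma over_ed': "over u A A' e \<Longrightarrow> over u A A' (ed u)"
  by (auto simp: over_def)

lemma gmul_bilinear:
  assumes "over u A A' e" "over u' A' A'' e'" "Dom U u' = Cod U u"
  shows "bilinear_map R (hom_at (ed u') A' A'') (hom_at (ed u) A A') (hom_at (ed (Cmp U u' u)) A A'')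
    (gmul u' u A A' A'')"
proof -
  obtain f f' where l: "lift2 u' u = (f', f)" and f: "over u A A' f" "over u' A' A'' f'" "Dom C f' = Cod C f"
    using assms by (rule over_lift2)
  note c = over_Cmp[OF f]
  have "gmul u' u A A' A'' = (\<lambda>y x. tr (Cmp C f' f) (ed (Cmp U u' u)) A A''
      (mul f' f A A' A'' (tr (ed u') f' A' A'' y) (tr (ed u) f A A' x)))"
    by (intro ext) (simp add: gmul_def l)
  then show ?thesis
    using bilinear_map_comp[OF mul_bilinear[OF f] tr_linear[OF over_ed'[OF f(2)] f(2)]
        tr_linear[OF over_ed'[OF f(1)] f(1)] tr_linear[OF c over_ed'[OF c]]] by simp
qed

lemma gmul_closed:
  assumes "over u A A' e" "over u' A' A'' e'" "Dom U u' = Cod U u"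
    "y \<in> carrier (hom_at (ed u') A' A'')" "x \<in> carrier (hom_at (ed u) A A')"
  shows "gmul u' u A A' A'' y x \<in> carrier (hom_at (ed (Cmp U u' u)) A A'')"
  using bilinear_map_closed[OF gmul_bilinear[OF assms(1-3)]] assms(4,5) by blast

text \<open>
  The value of a composite at \<open>Cmp C e' e\<close> is the composite of the values at \<open>e'\<close> and \<open>e\<close>, for
  every composable pair of lifts and not only for the chosen one, because transport respects
  composition in \<open>b\<close>.
\<close>

lemma tr_gmul:
  assumes e: "over u A A' e" "over u' A' A'' e'" "Dom C e' = Cod C e"
    and y: "y \<in> carrier (hom_at (ed u') A' A'')" and x: "x \<in> carrier (hom_at (ed u) A A')"
  shows "tr (ed (Cmp U u' u)) (Cmp C e' e) A A'' (gmul u' u A A' A'' y x) =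
    mul e' e A A' A'' (tr (ed u') e' A' A'' y) (tr (ed u) e A A' x)"
proof -
  have "Dom U u' = Cod U u" using overD[OF e(1)] overD[OF e(2)] e(3) by metis
  with e(1,2) obtain f f' where l: "lift2 u' u = (f', f)"
    and f: "over u A A' f" "over u' A' A'' f'" "Dom C f' = Cod C f"
    by (rule over_lift2)
  note y' = tr_closed[OF over_ed'[OF f(2)] f(2) y] and x' = tr_closed[OF over_ed'[OF f(1)] f(1) x]
  note cf = over_Cmp[OF f] and ce = over_Cmp[OF e]
  have "tr (ed (Cmp U u' u)) (Cmp C e' e) A A'' (gmul u' u A A' A'' y x) =
      tr (Cmp C f' f) (Cmp C e' e) A A'' (mul f' f A A' A'' (tr (ed u') f' A' A'' y) (tr (ed u) f A A' x))"
    using tr_trans[OF cf over_ed'[OF cf] ce mul_closed[OF f y' x']] by (simp add: gmul_def l)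
  also have "\<dots> = mul e' e A A' A'' (tr f' e' A' A'' (tr (ed u') f' A' A'' y)) (tr f e A A' (tr (ed u) f
      A A' x))"
    by (rule tr_mul[OF f e y' x'])
  finally show ?thesis
    using tr_trans[OF over_ed'[OF f(2)] f(2) e(2) y] tr_trans[OF over_ed'[OF f(1)] f(1) e(1) x] by simp
qed

lemma gidt_closed: "X \<in> Obj U \<Longrightarrow> A \<in> gob b (pt X) \<Longrightarrow> gidt X A \<in> carrier (hom_at (ed (Ident U X)) A A)"
  unfolding gidt_def
  using tr_closed[OF over_Ident[of "pt X" A] over_ed'[OF over_Ident[of "pt X" A]] idt_closed[of "pt X"
      A]] by simp

lemma tr_gidt:
  assumes "q \<in> Obj C" "A \<in> gob b (pt (fob \<pi> q))"
  shows "tr (ed (Ident U (fob \<pi> q))) (Ident C q) A A (gidt (fob \<pi> q) A) = idt q A"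
proof -
  let ?p = "pt (fob \<pi> q)"
  have p: "?p \<in> Obj C" "fob \<pi> ?p = fob \<pi> q" using assms by simp_all
  have o: "over (Ident U (fob \<pi> q)) A A (Ident C ?p)" using over_Ident[of ?p A] p assms by simp
  show ?thesis
    using tr_trans[OF o over_ed'[OF o] over_Ident[OF assms] idt_closed[of ?p A]] tr_idt[of ?p q A] p assms
    by (simp add: gidt_def)
qed

text \<open>
  An equation between morphisms of the glued category may be tested on their values at one lift
  (\<open>tr_inj\<close>). For a unit law this is the chosen lift together with an identity arrow of \<open>C\<close>; for
  associativity it is the composite of a lift of all three arrows. There, \<open>tr_gmul\<close> and \<open>tr_gidt\<close>
  reduce the equation to the corresponding law of \<open>b\<close>.
\<close>

lemma glued_graded: "graded_category R U glued"
proof (rule graded_categoryI, goal_cases)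
  case 1 show ?case by (rule b.R.is_cring)
next
  case (7 u A A')
  then have "over u A A' (ed u)" by (simp add: over_def)
  then show ?case using hom_module by (simp add: glued_apply(2)[of u A A' "ed u"])
next
  case (8 u' u A A' A'')
  then have o: "over u A A' (ed u)" "over u' A' A'' (ed u')" by (simp_all add: over_def)
  have "over (Cmp U u' u) A A'' (ed (Cmp U u' u))" using 8 by (simp add: over_def)
  with o show ?case
    using gmul_bilinear[OF o 8(3)] 8(3) by simp
next
  case (9 X A)
  then have "over (Ident U X) A A (ed (Ident U X))" by (simp add: over_def)
  with 9 show ?case by (simp add: gidt_closed)
next
  case (10 u A A' f)
  then have o: "over u A A' (ed u)" by (simp add: over_def)
  let ?q = "Dom C (ed u)"
  have q: "?q \<in> Obj C" "fob \<pi> ?q = Dom U u" "A \<in> gob b (pt (fob \<pi> ?q))"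
    using 10 overD[OF o] by simp_all
  have i: "over (Ident U (Dom U u)) A A (Ident C ?q)" using over_Ident[OF q(1,3)] q by simp
  have f: "f \<in> carrier (hom_at (ed u) A A')" using 10 o by simp
  have g: "gidt (Dom U u) A \<in> carrier (hom_at (ed (Ident U (Dom U u))) A A)"
    using 10 by (intro gidt_closed) simp_all
  have "tr (ed u) (ed u) A A' (gmul u (Ident U (Dom U u)) A A A' f (gidt (Dom U u) A)) = f"
    using tr_gmul[OF i o _ f g] tr_gidt[OF q(1,3)] tr_refl[OF o f] mul_idt_right[OF o f] 10 q
    by simp
  then show ?case
    using 10 o i tr_refl[OF o] gmul_closed[OF i o _ f g] by simp
next
  case (11 u A A' f)
  then have o: "over u A A' (ed u)" by (simp add: over_def)
  let ?q = "Cod C (ed u)"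
  have q: "?q \<in> Obj C" "fob \<pi> ?q = Cod U u" "A' \<in> gob b (pt (fob \<pi> ?q))"
    using 11 overD[OF o] by simp_all
  have i: "over (Ident U (Cod U u)) A' A' (Ident C ?q)" using over_Ident[OF q(1,3)] q by simp
  have f: "f \<in> carrier (hom_at (ed u) A A')" using 11 o by simp
  have g: "gidt (Cod U u) A' \<in> carrier (hom_at (ed (Ident U (Cod U u))) A' A')"
    using 11 by (intro gidt_closed) simp_all
  have "tr (ed u) (ed u) A A' (gmul (Ident U (Cod U u)) u A A' A' (gidt (Cod U u) A') f) = f"
    using tr_gmul[OF o i _ g f] tr_gidt[OF q(1,3)] tr_refl[OF o f] mul_idt_left[OF o f] 11 q
    by simp
  then show ?case
    using 11 o i tr_refl[OF o] gmul_closed[OF o i _ g f] by simp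
next
  case (12 u u' u'' A A' A'' A''' f g h)
  then obtain e e' e'' where e: "e \<in> Arr C" "e' \<in> Arr C" "e'' \<in> Arr C" "Dom C e' = Cod C e" "Dom C e'' =
      Cod C e'"
      "farr \<pi> e = u" "farr \<pi> e' = u'" "farr \<pi> e'' = u''"
    using lift3[of u u' u''] by blast
  have o: "over u A A' e" "over u' A' A'' e'" "over u'' A'' A''' e''" using 12 e by (simp_all add: over_def)
  note ed = over_ed'[OF o(1)] over_ed'[OF o(2)] over_ed'[OF o(3)]
  note c = over_Cmp[OF o(1,2) e(4)] over_Cmp[OF o(2,3) e(5)]
  have fgh: "f \<in> carrier (hom_at (ed u) A A')" "g \<in> carrier (hom_at (ed u') A' A'')" "h \<in> carrier
      (hom_at (ed u'') A'' A''')"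
    using 12 o by simp_all
  have fgh': "tr (ed u) e A A' f \<in> carrier (hom_at e A A')" "tr (ed u') e' A' A'' g \<in> carrier (hom_at e'
      A' A'')"
    "tr (ed u'') e'' A'' A''' h \<in> carrier (hom_at e'' A'' A''')"
    using tr_closed[OF ed(1) o(1)] tr_closed[OF ed(2) o(2)] tr_closed[OF ed(3) o(3)] fgh by blast+
  note gf = gmul_closed[OF o(1,2) 12(4) fgh(2,1)] and hg = gmul_closed[OF o(2,3) 12(5) fgh(3,2)]
  have d: "Dom C e'' = Cod C (Cmp C e' e)" "Dom C (Cmp C e'' e') = Cod C e"
    "Dom U u'' = Cod U (Cmp U u' u)" "Dom U (Cmp U u'' u') = Cod U u" using e 12 by simp_all
  note c3 = over_Cmp[OF c(1) o(3) d(1)] over_Cmp[OF o(1) c(2) d(2)]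
  have eqU: "Cmp U u'' (Cmp U u' u) = Cmp U (Cmp U u'' u') u" using 12 by (intro \<pi>.D.Cmp_assoc)
  have eqC: "Cmp C e'' (Cmp C e' e) = Cmp C (Cmp C e'' e') e" using e by (intro \<pi>.C.Cmp_assoc)
  let ?u = "Cmp U (Cmp U u'' u') u" and ?e = "Cmp C (Cmp C e'' e') e"
  have L: "gmul u'' (Cmp U u' u) A A'' A''' h (gmul u' u A A' A'' g f) \<in> carrier (hom_at (ed ?u) A A''')"
    using gmul_closed[OF c(1) o(3) d(3) fgh(3) gf] by (simp add: eqU)
  have K: "gmul (Cmp U u'' u') u A A' A''' (gmul u'' u' A' A'' A''' h g) f \<in> carrier (hom_at (ed ?u) A A''')"
    by (rule gmul_closed[OF o(1) c(2) d(4) hg fgh(1)])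
  have "tr (ed ?u) ?e A A''' (gmul u'' (Cmp U u' u) A A'' A''' h (gmul u' u A A' A'' g f)) =
      mul e'' (Cmp C e' e) A A'' A''' (tr (ed u'') e'' A'' A''' h)
        (mul e' e A A' A'' (tr (ed u') e' A' A'' g) (tr (ed u) e A A' f))"
    using tr_gmul[OF c(1) o(3) d(1) fgh(3) gf] tr_gmul[OF o(1,2) e(4) fgh(2,1)] by (simp add: eqU eqC)
  also have "\<dots> = mul (Cmp C e'' e') e A A' A''' (mul e'' e' A' A'' A''' (tr (ed u'') e'' A'' A''' h) (tr
      (ed u') e' A' A'' g))
      (tr (ed u) e A A' f)"
    by (rule mul_assoc[OF o e(4,5) fgh'])
  also have "\<dots> = tr (ed ?u) ?e A A''' (gmul (Cmp U u'' u') u A A' A''' (gmul u'' u' A' A'' A''' h g) f)"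
    using tr_gmul[OF o(1) c(2) d(2) hg fgh(1)] tr_gmul[OF o(2,3) e(5) fgh(3,2)] by simp
  finally have "gmul u'' (Cmp U u' u) A A'' A''' h (gmul u' u A A' A'' g f) =
      gmul (Cmp U u'' u') u A A' A''' (gmul u'' u' A' A'' A''' h g) f"
    by (intro tr_inj[OF over_ed'[OF c3(2)] c3(2) L K])
  then show ?case
    using 12 glued_apply(3)[OF o(1,2)] glued_apply(3)[OF o(2,3)] glued_apply(3)[OF c(1) o(3)]
        glued_apply(3)[OF o(1) c(2)]
    by simp
qed (simp_all add: glued_def Let_def)

text \<open>
  Evaluation at lifts. That it is a graded functor is the content of \<open>tr_gmul\<close> and \<open>tr_gidt\<close>.
\<close>

definition glued_iso :: "('co, 'ca, 'co, 'ca, 'x, 'm) gfun" where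
  "glued_iso = \<lparr>Psi = id_func C,
    gf_ob = \<lambda>(q, A)\<in>ob_index C (gob (pull C \<pi> glued)). val q A,
    gf_hom = \<lambda>(e, A, A')\<in>hom_index C (gob (pull C \<pi> glued)).
      \<lambda>x\<in>carrier (ghom (pull C \<pi> glued) (e, A, A')). tr (ed (farr \<pi> e)) e A A' x\<rparr>"

lemma over_self: "e \<in> Arr C \<Longrightarrow> A \<in> gob b (pt (fob \<pi> (Dom C e))) \<Longrightarrow> A' \<in> gob b (pt (fob \<pi> (Cod C e))) \<Longrightarrow>
  over (farr \<pi> e) A A' e"
  by (simp add: over_def)

lemmas ghom_glued_over [simp] = glued_apply(2)[OF over_self]

lemma glued_iso_apply [simp]:
  "q \<in> Obj C \<Longrightarrow> A \<in> gob b (pt (fob \<pi> q)) \<Longrightarrow> gf_ob glued_iso (q, A) = val q A"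
  "e \<in> Arr C \<Longrightarrow> A \<in> gob b (pt (fob \<pi> (Dom C e))) \<Longrightarrow> A' \<in> gob b (pt (fob \<pi> (Cod C e))) \<Longrightarrow>
    x \<in> carrier (hom_at (ed (farr \<pi> e)) A A') \<Longrightarrow> gf_hom glued_iso (e, A, A') x = tr (ed (farr \<pi> e)) e A A' x"
  by (simp_all add: glued_iso_def)

lemma glued_iso_graded: "graded_functor R C (pull C \<pi> glued) C b glued_iso"
proof (rule graded_functorI, goal_cases)
  case 1 show ?case by (rule pull_graded[OF \<pi>.cat_functor_axioms glued_graded])
next
  case (8 e A A')
  then have o: "over (farr \<pi> e) A A' e" by (intro over_self) simp_all
  have "linear_map R (hom_at (ed (farr \<pi> e)) A A') (hom_at e A A') (gf_hom glued_iso (e, A, A'))"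
    by (rule linear_map_cong[OF hom_module[OF over_ed'[OF o]] tr_linear[OF over_ed'[OF o] o]]) (use 8 in simp)
  then show ?case using 8 by (simp add: hom_at_def[of e] glued_iso_def[THEN arg_cong[where f = Psi]])
next
  case (9 q A)
  then have A: "A \<in> gob b (pt (fob \<pi> q))" by simp
  then show ?case
    using 9 tr_gidt[OF 9(1) A] gidt_closed[of "fob \<pi> q" A]
    by (simp add: idt_def glued_iso_def[THEN arg_cong[where f = Psi]])
next
  case (10 e' e A A' A'' f g)
  then have o: "over (farr \<pi> e) A A' e" "over (farr \<pi> e') A' A'' e'" by (auto intro!: over_self)
  have fg: "f \<in> carrier (hom_at (ed (farr \<pi> e)) A A')" "g \<in> carrier (hom_at (ed (farr \<pi> e')) A' A'')"
    using 10 by simp_all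
  have d: "Dom U (farr \<pi> e') = Cod U (farr \<pi> e)" using 10 by simp
  show ?case
    using 10 tr_gmul[OF o 10(3) fg(2,1)] gmul_closed[OF o d fg(2,1)] fg glued_apply(3)[OF o d]
    by (simp add: mul_def glued_iso_def[THEN arg_cong[where f = Psi]])
qed (simp_all add: glued_iso_def)

lemma glued_iso_iso: "iso_arr (Map' R C) (pull C \<pi> glued, glued_iso, b)"
proof (rule bijective_gfun_iso[OF glued_iso_graded])
  show "Psi glued_iso = id_func C" by (simp add: glued_iso_def)
  show "bij_betw (\<lambda>A. gf_ob glued_iso (q, A)) (gob (pull C \<pi> glued) q) (gob b q)" if q: "q \<in> Obj C" for q
    by (rule bij_betw_byWitness[where f' = "t q (pt (fob \<pi> q))"])
       (use q in \<open>auto simp: val_def t_trans t_refl t_closed\<close>)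
  show "bij_betw (gf_hom glued_iso (e, A, A')) (carrier (ghom (pull C \<pi> glued) (e, A, A')))
      (carrier (ghom b (e, gf_ob glued_iso (Dom C e, A), gf_ob glued_iso (Cod C e, A'))))"
    if e: "e \<in> Arr C" "A \<in> gob (pull C \<pi> glued) (Dom C e)" "A' \<in> gob (pull C \<pi> glued) (Cod C e)" for e A A'
  proof -
    have o: "over (farr \<pi> e) A A' e" using e by (intro over_self) simp_all
    note o' = over_ed'[OF o]
    have "bij_betw (gf_hom glued_iso (e, A, A')) (carrier (hom_at (ed (farr \<pi> e)) A A')) (carrier
        (hom_at e A A'))"
      by (rule bij_betw_byWitness[where f' = "tr e (ed (farr \<pi> e)) A A'"])
         (use e in \<open>auto simp: tr_closed[OF o o'] tr_closed[OF o' o] tr_trans[OF o o' o] tr_trans[OF o' o o']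
            tr_refl[OF o] tr_refl[OF o']\<close>)
    then show ?thesis using e by (simp add: hom_at_def[of e])
  qed
qed

text \<open>
  Passing from the value at one lift to the value at another is transport, which is the
  compatibility with the descent data.
\<close>

lemma glued_iso_compat:
  "\<lbrakk>p \<in> Obj C; q \<in> Obj C; fob \<pi> p = fob \<pi> q; A \<in> gob glued (fob \<pi> p)\<rbrakk> \<Longrightarrow>
    t p q (gf_ob glued_iso (p, A)) = gf_ob glued_iso (q, A)"
  "\<lbrakk>e \<in> Arr C; f \<in> Arr C; farr \<pi> e = farr \<pi> f; A \<in> gob glued (fob \<pi> (Dom C e));
      A' \<in> gob glued (fob \<pi> (Cod C e));
     x \<in> carrier (ghom glued (farr \<pi> e, A, A'))\<rbrakk> \<Longrightarrow>
    s e f (gf_ob glued_iso (Dom C e, A)) (gf_ob glued_iso (Cod C e, A')) (gf_hom glued_iso (e, A, A') x) =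
    gf_hom glued_iso (f, A, A') x"
proof -
  show "t p q (gf_ob glued_iso (p, A)) = gf_ob glued_iso (q, A)"
    if "p \<in> Obj C" "q \<in> Obj C" "fob \<pi> p = fob \<pi> q" "A \<in> gob glued (fob \<pi> p)"
    using that by simp
  show "s e f (gf_ob glued_iso (Dom C e, A)) (gf_ob glued_iso (Cod C e, A')) (gf_hom glued_iso (e, A, A') x) =
      gf_hom glued_iso (f, A, A') x"
    if ef: "e \<in> Arr C" "f \<in> Arr C" "farr \<pi> e = farr \<pi> f" and A: "A \<in> gob glued (fob \<pi> (Dom C e))"
      "A' \<in> gob glued (fob \<pi> (Cod C e))" and x: "x \<in> carrier (ghom glued (farr \<pi> e, A, A'))"
  proof -
    have o: "over (farr \<pi> e) A A' e" using ef A by (intro over_self) simp_all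
    then have o': "over (farr \<pi> e) A A' f" using ef by (simp add: over_def)
    have fd: "fob \<pi> (Dom C e) = fob \<pi> (Dom C f)" "fob \<pi> (Cod C e) = fob \<pi> (Cod C f)"
      using overD[OF o] overD[OF o'] by simp_all
    have x': "x \<in> carrier (hom_at (ed (farr \<pi> e)) A A')" using x o by simp
    show ?thesis
      using ef A x' fd tr_trans[OF over_ed'[OF o] o o' x'] by (simp add: tr_def[of e])
  qed
qed

end

section \<open>Stack\<close>

text \<open>
  The disjoint union of the members of a cover, with which a family of functors to \<open>U\<close> becomes a
  single functor, \<open>copair\<close>, that has the same lifts of chains.
\<close>

definition coprod :: "'i set \<Rightarrow> ('i \<Rightarrow> ('vo, 'va) cat) \<Rightarrow> ('i \<times> 'vo, 'i \<times> 'va) cat" where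
  "coprod I V = \<lparr>Obj = Sigma I (\<lambda>i. Obj (V i)), Arr = Sigma I (\<lambda>i. Arr (V i)),
     Dom = (\<lambda>(i, v). (i, Dom (V i) v)), Cod = (\<lambda>(i, v). (i, Cod (V i) v)),
     Ident = (\<lambda>(i, Y). (i, Ident (V i) Y)), Cmp = (\<lambda>(i', v') (i, v). (i, Cmp (V i) v' v))\<rparr>"

lemma coprod_sel [simp]:
  "(i, Y) \<in> Obj (coprod I V) \<longleftrightarrow> i \<in> I \<and> Y \<in> Obj (V i)"
  "(i, v) \<in> Arr (coprod I V) \<longleftrightarrow> i \<in> I \<and> v \<in> Arr (V i)"
  "Dom (coprod I V) (i, v) = (i, Dom (V i) v)" "Cod (coprod I V) (i, v) = (i, Cod (V i) v)"
  "Ident (coprod I V) (i, Y) = (i, Ident (V i) Y)"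
  "Cmp (coprod I V) (i', v') (i, v) = (i, Cmp (V i) v' v)"
  by (auto simp: coprod_def)

lemma coprod_category:
  assumes V: "\<And>i. i \<in> I \<Longrightarrow> category (V i)"
  shows "category (coprod I V)"
proof (rule category.intro, goal_cases)
  case (11 f g h)
  then show ?case using V by (cases f; cases g; cases h) (auto simp: category.Cmp_assoc)
qed (use V in auto)

definition copair :: "'i set \<Rightarrow> ('i \<Rightarrow> ('vo, 'va) cat) \<Rightarrow> ('i \<Rightarrow> ('vo, 'va, 'uo, 'ua) func) \<Rightarrow>
    ('i \<times> 'vo, 'i \<times> 'va, 'uo, 'ua) func" where
  "copair I V \<phi> = \<lparr>fob = \<lambda>(i, Y)\<in>Obj (coprod I V). fob (\<phi> i) Y,
     farr = \<lambda>(i, v)\<in>Arr (coprod I V). farr (\<phi> i) v\<rparr>"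

definition incl :: "('i \<Rightarrow> ('vo, 'va) cat) \<Rightarrow> 'i \<Rightarrow> ('vo, 'va, 'i \<times> 'vo, 'i \<times> 'va) func" where
  "incl V i = \<lparr>fob = \<lambda>Y\<in>Obj (V i). (i, Y), farr = \<lambda>v\<in>Arr (V i). (i, v)\<rparr>"

lemma copair_apply [simp]:
  "i \<in> I \<Longrightarrow> Y \<in> Obj (V i) \<Longrightarrow> fob (copair I V \<phi>) (i, Y) = fob (\<phi> i) Y"
  "i \<in> I \<Longrightarrow> v \<in> Arr (V i) \<Longrightarrow> farr (copair I V \<phi>) (i, v) = farr (\<phi> i) v"
  "Y \<in> Obj (V i) \<Longrightarrow> fob (incl V i) Y = (i, Y)"
  "v \<in> Arr (V i) \<Longrightarrow> farr (incl V i) v = (i, v)"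
  by (auto simp: copair_def incl_def)

lemma copair_functor:
  assumes U: "category U" and \<phi>: "\<And>i. i \<in> I \<Longrightarrow> cat_functor (V i) U (\<phi> i)"
  shows "cat_functor (coprod I V) U (copair I V \<phi>)"
proof -
  have V: "category (V i)" if "i \<in> I" for i using \<phi>[OF that] by (rule cat_functor_source)
  note [simp] = V functor_rules[OF \<phi>]
  show ?thesis
  proof (intro cat_functor.intro cat_functor_axioms.intro coprod_category V U PiE_I)
    show "fob (copair I V \<phi>) p = undefined" if "p \<notin> Obj (coprod I V)" for p
      using that by (simp add: copair_def)
    show "farr (copair I V \<phi>) e = undefined" if "e \<notin> Arr (coprod I V)" for e
      using that by (simp add: copair_def)
  qed auto
qed

lemma incl_functor:
  assumes V: "\<And>i. i \<in> I \<Longrightarrow> category (V i)" and i: "i \<in> I"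
  shows "cat_functor (V i) (coprod I V) (incl V i)"
  by (intro cat_functor.intro cat_functor_axioms.intro coprod_category V i PiE_I)
    (use V i in \<open>auto simp: incl_def\<close>)

definition coprod_gcat :: "'i set \<Rightarrow> ('i \<Rightarrow> ('vo, 'va) cat) \<Rightarrow> ('i \<Rightarrow> ('vo, 'va, 'x, 'k, 'm) gcat) \<Rightarrow>
    ('i \<times> 'vo, 'i \<times> 'va, 'x, 'k, 'm) gcat" where
  "coprod_gcat I V b = (let ob = \<lambda>(i, Y)\<in>Obj (coprod I V). gob (b i) Y in
     \<lparr>gob = ob,
      ghom = \<lambda>((i, v), B, B')\<in>hom_index (coprod I V) ob. ghom (b i) (v, B, B'),
      gcomp = \<lambda>((i', v'), (i, v), B, B', B'')\<in>comp_index (coprod I V) ob. gcomp (b i) (v', v, B, B', B''),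
      gid = \<lambda>((i, Y), B)\<in>ob_index (coprod I V) ob. gid (b i) (Y, B)\<rparr>)"

lemma coprod_gcat_apply [simp]:
  assumes "i \<in> I" "category (V i)"
  shows "Y \<in> Obj (V i) \<Longrightarrow> gob (coprod_gcat I V b) (i, Y) = gob (b i) Y"
    and "\<lbrakk>v \<in> Arr (V i); B \<in> gob (b i) (Dom (V i) v); B' \<in> gob (b i) (Cod (V i) v)\<rbrakk> \<Longrightarrow>
      ghom (coprod_gcat I V b) ((i, v), B, B') = ghom (b i) (v, B, B')"
    and "\<lbrakk>v \<in> Arr (V i); v' \<in> Arr (V i); Dom (V i) v' = Cod (V i) v; B \<in> gob (b i) (Dom (V i) v);
        B' \<in> gob (b i) (Cod (V i) v); B'' \<in> gob (b i) (Cod (V i) v')\<rbrakk> \<Longrightarrow>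
      gcomp (coprod_gcat I V b) ((i, v'), (i, v), B, B', B'') = gcomp (b i) (v', v, B, B', B'')"
    and "\<lbrakk>Y \<in> Obj (V i); B \<in> gob (b i) Y\<rbrakk> \<Longrightarrow> gid (coprod_gcat I V b) ((i, Y), B) = gid (b i) (Y, B)"
  using assms by (simp_all add: coprod_gcat_def Let_def)

lemma coprod_gcat_graded:
  assumes R: "cring R" and b: "\<And>i. i \<in> I \<Longrightarrow> graded_category R (V i) (b i)"
  shows "graded_category R (coprod I V) (coprod_gcat I V b)"
proof -
  have V [simp]: "category (V i)" if "i \<in> I" for i using b[OF that] by (simp add: graded_category_def)
  show ?thesis
  proof (rule graded_categoryI, goal_cases)
    case 1 show ?case by (rule R)
  next
    case 2 show ?case by (rule coprod_category) simp
  next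
    case (7 e A A')
    then show ?case by (cases e) (auto intro: graded_category.ghom_module'[OF b])
  next
    case (8 e' e A A' A'')
    obtain i v j v' where e: "e = (i, v)" "e' = (j, v')" by (cases e; cases e')
    with 8 have "j = i" by simp
    then show ?case
      using 8 graded_category.gcomp_bilinear[OF b, of i v' v A A' A''] by (auto simp: e)
  next
    case (9 p A)
    then show ?case by (cases p) (auto intro: graded_category.gid_closed[OF b])
  next
    case (10 e A A' f)
    obtain i v where e: "e = (i, v)" by (cases e)
    show ?case using 10 graded_category.gcomp_gid_right[OF b, of i v A A' f] by (auto simp: e)
  next
    case (11 e A A' f)
    obtain i v where e: "e = (i, v)" by (cases e)
    show ?case using 11 graded_category.gcomp_gid_left[OF b, of i v A A' f] by (auto simp: e)
  next
    case (12 e e' e'' A A' A'' A''' f g h)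
    obtain i v j v' l v'' where e: "e = (i, v)" "e' = (j, v')" "e'' = (l, v'')"
        by (cases e; cases e'; cases e'')
    with 12 have [simp]: "j = i" "l = i" by simp_all
    show ?case
      using 12 graded_category.gcomp_assoc[OF b, of i v' v A A' A'' v'' A''' f g h] by (auto simp: e)
  qed (simp_all add: coprod_gcat_def Let_def)
qed

lemma pull_incl:
  assumes R: "cring R" and b: "\<And>i. i \<in> I \<Longrightarrow> graded_category R (V i) (b i)" and i: "i \<in> I"
  shows "pull (V i) (incl V i) (coprod_gcat I V b) = b i"
proof -
  have V [simp]: "category (V i)" if "i \<in> I" for i using b[OF that] by (simp add: graded_category_def)
  show ?thesis
  proof (rule gcat_eqI)
    show "graded_category R (V i) (pull (V i) (incl V i) (coprod_gcat I V b))"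
      by (rule pull_graded[of _ "coprod I V"], rule incl_functor) (use i coprod_gcat_graded[OF R b] in
          simp_all)
  qed (use i b in simp_all)
qed

text \<open>
  Components of an isomorphism have left inverses.
\<close>

lemma Map'_iso_inj:
  assumes "iso_arr (Map' R U) (a, F, b)"
  shows "\<lbrakk>X \<in> Obj U; A \<in> gob a X; A' \<in> gob a X; gf_ob F (X, A) = gf_ob F (X, A')\<rbrakk> \<Longrightarrow> A = A'"
    and "\<lbrakk>u \<in> Arr U; A \<in> gob a (Dom U u); A' \<in> gob a (Cod U u); x \<in> carrier (ghom a (u, A, A'));
      y \<in> carrier (ghom a (u, A, A')); gf_hom F (u, A, A') x = gf_hom F (u, A, A') y\<rbrakk> \<Longrightarrow> x = y"
proof -
  obtain G where GF: "comp_gfun U a G F = id_gfun U a"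
    using assms by (auto simp: iso_arr_def arrows_def Map'_sel)
  have ob: "gf_ob G (fob (Psi F) X, gf_ob F (X, A)) = A" if "X \<in> Obj U" "A \<in> gob a X" for X A
    using that comp_gfun_ob[of X U A a G F] by (simp add: GF)
  have hom: "gf_hom G (farr (Psi F) u, gf_ob F (Dom U u, A), gf_ob F (Cod U u, A')) (gf_hom F (u, A, A')
      x) = x"
    if "u \<in> Arr U" "A \<in> gob a (Dom U u)" "A' \<in> gob a (Cod U u)" "x \<in> carrier (ghom a (u, A, A'))" for u A A' x
    using that comp_gfun_hom[of u U A a A' x G F] by (simp add: GF)
  show "A = A'" if "X \<in> Obj U" "A \<in> gob a X" "A' \<in> gob a X" "gf_ob F (X, A) = gf_ob F (X, A')"
    using that ob by metis
  show "x = y" if "u \<in> Arr U" "A \<in> gob a (Dom U u)" "A' \<in> gob a (Cod U u)" "x \<in> carrier (ghom a (u, A, A'))"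
      "y \<in> carrier (ghom a (u, A, A'))" "gf_hom F (u, A, A') x = gf_hom F (u, A, A') y"
    using that hom by metis
qed

text \<open>
  The components of the transition isomorphisms, rewritten from the double fibre products to pairs
  of lifts, form the identifications \<open>t\<close> and \<open>s\<close> that are required for gluing.
\<close>

locale descent = covering_family R I V \<phi> U
  for R :: "('k, 'r) ring_scheme" and I :: "'i set" and V :: "'i \<Rightarrow> ('vo, 'va) cat"
    and \<phi> :: "'i \<Rightarrow> ('vo, 'va, 'uo, 'ua) func" and U :: "('uo, 'ua) cat" +
  fixes b :: "'i \<Rightarrow> ('vo, 'va, 'x, 'k, 'm) gcat" and \<theta>
  assumes R: "cring R" and datum: "(b, \<theta>) \<in> descent_data R I V \<phi>"
    and lift3: "\<lbrakk>u \<in> Arr U; u' \<in> Arr U; u'' \<in> Arr U; Dom U u' = Cod U u; Dom U u'' = Cod U u'\<rbrakk> \<Longrightarrow>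
      \<exists>i\<in>I. \<exists>v\<in>Arr (V i). \<exists>v'\<in>Arr (V i). \<exists>v''\<in>Arr (V i).
        Dom (V i) v' = Cod (V i) v \<and> Dom (V i) v'' = Cod (V i) v' \<and>
        farr (\<phi> i) v = u \<and> farr (\<phi> i) v' = u' \<and> farr (\<phi> i) v'' = u''"
begin

abbreviation b1 where "b1 i j \<equiv> pull (Dbl i j) (pr1 (Dbl i j)) (b i)"
abbreviation b2 where "b2 i j \<equiv> pull (Dbl i j) (pr2 (Dbl i j)) (b j)"

lemma b_graded [simp]: "i \<in> I \<Longrightarrow> graded_category R (V i) (b i)"
  using descent_dataD(1)[OF datum] by (simp add: Map'_sel)

definition T where "T i j = fst (snd (\<theta> (i, j)))"

lemma theta_eq:
  assumes "i \<in> I" "j \<in> I"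
  shows "\<theta> (i, j) = (b1 i j, T i j, b2 i j)"
    and "graded_functor R (Dbl i j) (b1 i j)
      (Dbl i j) (b2 i j) (T i j)"
    and "Psi (T i j) = id_func (Dbl i j)"
  using descent_dataD(4)[OF datum assms] assms
  by (cases "\<theta> (i, j)"; simp add: arrows_def Map'_sel T_def)+

lemma dbl_sel:
  "Obj (Dbl i j) = {(Y, Z). Y \<in> Obj (V i) \<and> Z \<in> Obj (V j) \<and> fob (\<phi> i) Y = fob (\<phi> j) Z}"
  "Arr (Dbl i j) = {(v, w). v \<in> Arr (V i) \<and> w \<in> Arr (V j) \<and> farr (\<phi> i) v = farr (\<phi> j) w}"
  "Dom (Dbl i j) (v, w) = (Dom (V i) v, Dom (V j) w)" "Cod (Dbl i j) (v, w) = (Cod (V i) v, Cod (V j) w)"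
  "Ident (Dbl i j) (Y, Z) = (Ident (V i) Y, Ident (V j) Z)"
  "Cmp (Dbl i j) (v', w') (v, w) = (Cmp (V i) v' v, Cmp (V j) w' w)"
  by (auto simp: dbl_def fprod_def)

lemma pr_apply:
  "p \<in> Obj (Dbl i j) \<Longrightarrow> fob (pr1 (Dbl i j)) p = fst p"
  "p \<in> Obj (Dbl i j) \<Longrightarrow> fob (pr2 (Dbl i j)) p = snd p"
  "e \<in> Arr (Dbl i j) \<Longrightarrow> farr (pr1 (Dbl i j)) e = fst e"
  "e \<in> Arr (Dbl i j) \<Longrightarrow> farr (pr2 (Dbl i j)) e = snd e"
  by (simp_all add: pr1_def pr2_def proj_func_def)

lemma over_eq:
  assumes "i \<in> I" "j \<in> I" "v \<in> Arr (V i)" "w \<in> Arr (V j)" "farr (\<phi> i) v = farr (\<phi> j) w"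
  shows "fob (\<phi> i) (Dom (V i) v) = fob (\<phi> j) (Dom (V j) w)" "fob (\<phi> i) (Cod (V i) v) =
      fob (\<phi> j) (Cod (V j) w)"
  using fob_Dom_eq[OF \<phi>[OF assms(1)] \<phi>[OF assms(2)] assms(3-5)] .

lemma T_ob:
  assumes ij: "i \<in> I" "j \<in> I" and "Y \<in> Obj (V i)" "Z \<in> Obj (V j)" "fob (\<phi> i) Y =
      fob (\<phi> j) Z" "B \<in> gob (b i) Y"
  shows "gf_ob (T i j) ((Y, Z), B) \<in> gob (b j) Z"
proof -
  interpret T: graded_functor R "Dbl i j" "b1 i j"
    "Dbl i j" "b2 i j" "T i j"
    by (rule theta_eq(2)[OF ij])
  have "(Y, Z) \<in> Obj (Dbl i j)" using assms by (simp add: dbl_sel)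
  then show ?thesis
    using T.gf_ob_closed'[of "(Y, Z)" B] assms by (simp add: theta_eq(3)[OF ij] pr_apply)
qed

lemma T_linear:
  assumes ij: "i \<in> I" "j \<in> I" and v: "v \<in> Arr (V i)" "w \<in> Arr (V j)" "farr (\<phi> i) v = farr (\<phi> j) w"
    and "B \<in> gob (b i) (Dom (V i) v)" "B' \<in> gob (b i) (Cod (V i) v)"
  shows "linear_map R (ghom (b i) (v, B, B'))
    (ghom (b j) (w, gf_ob (T i j) ((Dom (V i) v, Dom (V j) w), B), gf_ob (T i j) ((Cod (V i) v, Cod (V
        j) w), B')))
    (gf_hom (T i j) ((v, w), B, B'))"
proof -
  interpret T: graded_functor R "Dbl i j" "b1 i j"
    "Dbl i j" "b2 i j" "T i j"
    by (rule theta_eq(2)[OF ij])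
  have P: "(v, w) \<in> Arr (Dbl i j)" using assms by (simp add: dbl_sel)
  have O: "(Dom (V i) v, Dom (V j) w) \<in> Obj (Dbl i j)" "(Cod (V i) v, Cod (V j) w) \<in> Obj (Dbl i j)"
    using assms over_eq[OF ij v] by (simp_all add: dbl_sel)
  show ?thesis
    using T.gf_hom_linear[of "((v, w), B, B')"] assms P O over_eq[OF ij v]
    by (simp add: theta_eq(3)[OF ij] pr_apply dbl_sel(3,4) T_ob)
qed

lemma T_gid:
  assumes ij: "i \<in> I" "j \<in> I" and "Y \<in> Obj (V i)" "Z \<in> Obj (V j)" "fob (\<phi> i) Y =
      fob (\<phi> j) Z" "B \<in> gob (b i) Y"
  shows "gf_hom (T i j) ((Ident (V i) Y, Ident (V j) Z), B, B) (gid (b i) (Y, B)) =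
    gid (b j) (Z, gf_ob (T i j) ((Y, Z), B))"
proof -
  interpret T: graded_functor R "Dbl i j" "b1 i j"
    "Dbl i j" "b2 i j" "T i j"
    by (rule theta_eq(2)[OF ij])
  have "(Y, Z) \<in> Obj (Dbl i j)" using assms by (simp add: dbl_sel)
  then show ?thesis
    using T.gf_hom_gid[of "(Y, Z)" B] assms by (simp add: theta_eq(3)[OF ij] pr_apply dbl_sel(5) T_ob)
qed

lemma T_gcomp:
  assumes ij: "i \<in> I" "j \<in> I" and v: "v \<in> Arr (V i)" "w \<in> Arr (V j)" "farr (\<phi> i) v = farr (\<phi> j) w"
    and v': "v' \<in> Arr (V i)" "w' \<in> Arr (V j)" "farr (\<phi> i) v' = farr (\<phi> j) w'"
    and d: "Dom (V i) v' = Cod (V i) v" "Dom (V j) w' = Cod (V j) w"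
    and B: "B \<in> gob (b i) (Dom (V i) v)" "B' \<in> gob (b i) (Cod (V i) v)" "B'' \<in> gob (b i) (Cod (V i) v')"
    and xy: "x \<in> carrier (ghom (b i) (v, B, B'))" "y \<in> carrier (ghom (b i) (v', B', B''))"
  shows "gf_hom (T i j) ((Cmp (V i) v' v, Cmp (V j) w' w), B, B'') (gcomp (b i) (v', v, B, B', B'') y x) =
    gcomp (b j) (w', w, gf_ob (T i j) ((Dom (V i) v, Dom (V j) w), B), gf_ob (T i j) ((Cod (V i) v, Cod
        (V j) w), B'),
        gf_ob (T i j) ((Cod (V i) v', Cod (V j) w'), B''))
      (gf_hom (T i j) ((v', w'), B', B'') y) (gf_hom (T i j) ((v, w), B, B') x)"
proof -
  interpret T: graded_functor R "Dbl i j" "b1 i j"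
    "Dbl i j" "b2 i j" "T i j"
    by (rule theta_eq(2)[OF ij])
  have P: "(v, w) \<in> Arr (Dbl i j)" "(v', w') \<in> Arr (Dbl i j)" using assms by (simp_all add: dbl_sel)
  have O: "(Dom (V i) v, Dom (V j) w) \<in> Obj (Dbl i j)" "(Cod (V i) v, Cod (V j) w) \<in> Obj (Dbl i j)"
    "(Cod (V i) v', Cod (V j) w') \<in> Obj (Dbl i j)"
    using assms over_eq[OF ij v] over_eq[OF ij v'] by (simp_all add: dbl_sel)
  show ?thesis
    using T.gf_hom_gcomp[of "(v', w')" "(v, w)" B B' B'' x y] assms P O over_eq[OF ij v] over_eq[OF ij v']
    by (simp add: theta_eq(3)[OF ij] pr_apply dbl_sel(3,4,6) T_ob)
qed

lemma tpl_sel: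
  "Obj (Tpl i j l) = {(Y, Z, W). Y \<in> Obj (V i) \<and> Z \<in> Obj (V j) \<and> W \<in> Obj (V l) \<and>
    fob (\<phi> i) Y = fob (\<phi> j) Z \<and> fob (\<phi> j) Z = fob (\<phi> l) W}"
  "Arr (Tpl i j l) = {(u, v, w). u \<in> Arr (V i) \<and> v \<in> Arr (V j) \<and> w \<in> Arr (V l) \<and>
    farr (\<phi> i) u = farr (\<phi> j) v \<and> farr (\<phi> j) v = farr (\<phi> l) w}"
  "Dom (Tpl i j l) (u, v, w) = (Dom (V i) u, Dom (V j) v, Dom (V l) w)"
  "Cod (Tpl i j l) (u, v, w) = (Cod (V i) u, Cod (V j) v, Cod (V l) w)"
  by (auto simp: tpl_def fprod3_def)

lemma tpl_pr_apply:
  "(Y, Z, W) \<in> Obj (Tpl i j l) \<Longrightarrow> fob (pr12 (Tpl i j l)) (Y, Z, W) = (Y, Z)"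
  "(Y, Z, W) \<in> Obj (Tpl i j l) \<Longrightarrow> fob (pr13 (Tpl i j l)) (Y, Z, W) = (Y, W)"
  "(Y, Z, W) \<in> Obj (Tpl i j l) \<Longrightarrow> fob (pr23 (Tpl i j l)) (Y, Z, W) = (Z, W)"
  "(u, v, w) \<in> Arr (Tpl i j l) \<Longrightarrow> farr (pr12 (Tpl i j l)) (u, v, w) = (u, v)"
  "(u, v, w) \<in> Arr (Tpl i j l) \<Longrightarrow> farr (pr13 (Tpl i j l)) (u, v, w) = (u, w)"
  "(u, v, w) \<in> Arr (Tpl i j l) \<Longrightarrow> farr (pr23 (Tpl i j l)) (u, v, w) = (v, w)"
  by (simp_all add: pr12_def pr13_def pr23_def proj_func_def)

lemma T_cocycle:
  assumes ijl: "i \<in> I" "j \<in> I" "l \<in> I"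
  shows "comp_gfun (Tpl i j l) (pull (Tpl i j l) (pr12 (Tpl i j l)) (b1 i j))
      (res_gfun (Tpl i j l) (pr23 (Tpl i j l)) (b1 j l) (T j l))
      (res_gfun (Tpl i j l) (pr12 (Tpl i j l)) (b1 i j) (T i j)) =
    res_gfun (Tpl i j l) (pr13 (Tpl i j l)) (b1 i l) (T i l)"
  using descent_dataD(6)[OF datum ijl]
  unfolding theta_eq(1)[OF ijl(1,2)] theta_eq(1)[OF ijl(2,3)] theta_eq(1)[OF ijl(1,3)]
    Map'_functor_arr[OF tpl(2)[OF ijl] theta_eq(2,3)[OF ijl(1,2)]]
    Map'_functor_arr[OF tpl(3)[OF ijl] theta_eq(2,3)[OF ijl(1,3)]]
    Map'_functor_arr[OF tpl(4)[OF ijl] theta_eq(2,3)[OF ijl(2,3)]]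
    Map'_sel prod.inject
  by (elim conjE)

lemma T_trans:
  assumes ijl: "i \<in> I" "j \<in> I" "l \<in> I" and Y: "Y \<in> Obj (V i)" "Z \<in> Obj (V j)" "W \<in> Obj (V l)"
    "fob (\<phi> i) Y = fob (\<phi> j) Z" "fob (\<phi> j) Z = fob (\<phi> l) W" and B: "B \<in> gob (b i) Y"
  shows "gf_ob (T j l) ((Z, W), gf_ob (T i j) ((Y, Z), B)) = gf_ob (T i l) ((Y, W), B)"
proof -
  have P: "(Y, Z) \<in> Obj (Dbl i j)" "(Z, W) \<in> Obj (Dbl j l)" "(Y, W) \<in> Obj (Dbl i l)"
    and t: "(Y, Z, W) \<in> Obj (Tpl i j l)" using Y by (simp_all add: dbl_sel tpl_sel)
  show ?thesis
    using arg_cong[OF T_cocycle[OF ijl], of "\<lambda>F. gf_ob F ((Y, Z, W), B)"] ijl P t B T_ob[OF ijl(1,2)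
        Y(1,2,4) B]
    by (simp add: tpl_pr_apply pr_apply)
qed

lemma T_hom:
  assumes "i \<in> I" "j \<in> I" "v \<in> Arr (V i)" "w \<in> Arr (V j)" "farr (\<phi> i) v = farr (\<phi> j) w"
    "B \<in> gob (b i) (Dom (V i) v)" "B' \<in> gob (b i) (Cod (V i) v)" "x \<in> carrier (ghom (b i) (v, B, B'))"
  shows "gf_hom (T i j) ((v, w), B, B') x \<in> carrier (ghom (b j) (w, gf_ob (T i j) ((Dom (V i) v, Dom (V
      j) w), B),
    gf_ob (T i j) ((Cod (V i) v, Cod (V j) w), B')))"
  using linear_map_closed[OF T_linear[OF assms(1-7)] assms(8)] .

lemma T_hom_trans:
  assumes ijl: "i \<in> I" "j \<in> I" "l \<in> I" and u: "u \<in> Arr (V i)" "v \<in> Arr (V j)" "w \<in> Arr (V l)"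
    "farr (\<phi> i) u = farr (\<phi> j) v" "farr (\<phi> j) v = farr (\<phi> l) w"
    and B: "B \<in> gob (b i) (Dom (V i) u)" "B' \<in> gob (b i) (Cod (V i) u)" and x: "x \<in> carrier (ghom (b i)
        (u, B, B'))"
  shows "gf_hom (T j l) ((v, w), gf_ob (T i j) ((Dom (V i) u, Dom (V j) v), B), gf_ob (T i j) ((Cod (V
      i) u, Cod (V j) v), B'))
      (gf_hom (T i j) ((u, v), B, B') x) = gf_hom (T i l) ((u, w), B, B') x"
proof -
  note o = over_eq[OF ijl(1,2) u(1,2,4)] over_eq[OF ijl(2,3) u(2,3,5)]
  have P: "(u, v) \<in> Arr (Dbl i j)" "(v, w) \<in> Arr (Dbl j l)" "(u, w) \<in> Arr (Dbl i l)"
    and t: "(u, v, w) \<in> Arr (Tpl i j l)" using u by (simp_all add: dbl_sel tpl_sel)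
  have Q: "(Dom (V i) u, Dom (V j) v) \<in> Obj (Dbl i j)" "(Dom (V j) v, Dom (V l) w) \<in> Obj (Dbl j l)"
    "(Dom (V i) u, Dom (V l) w) \<in> Obj (Dbl i l)"
    "(Cod (V i) u, Cod (V j) v) \<in> Obj (Dbl i j)" "(Cod (V j) v, Cod (V l) w) \<in> Obj (Dbl j l)"
    "(Cod (V i) u, Cod (V l) w) \<in> Obj (Dbl i l)"
    and tD: "(Dom (V i) u, Dom (V j) v, Dom (V l) w) \<in> Obj (Tpl i j l)"
    and tC: "(Cod (V i) u, Cod (V j) v, Cod (V l) w) \<in> Obj (Tpl i j l)"
    using u ijl o by (simp_all add: dbl_sel tpl_sel)
  have d: "Dom (V i) u \<in> Obj (V i)" "Dom (V j) v \<in> Obj (V j)" "Cod (V i) u \<in> Obj (V i)" "Cod (V j) v \<in>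
      Obj (V j)"
    using u ijl by simp_all
  note ob = T_ob[OF ijl(1,2) d(1,2) o(1) B(1)] T_ob[OF ijl(1,2) d(3,4) o(2) B(2)]
  show ?thesis
    using arg_cong[OF T_cocycle[OF ijl], of "\<lambda>F. gf_hom F ((u, v, w), B, B') x"] ijl P Q t tD tC B x ob
      T_hom[OF ijl(1,2) u(1,2,4) B x]
    by (simp add: tpl_pr_apply pr_apply tpl_sel(3,4) dbl_sel(3,4))
qed

text \<open>
  The cocycle condition at \<open>(Y, Y, Y)\<close> says that the identification of \<open>b\<close> over \<open>Y\<close> with itself is
  idempotent; since it is injective, it is the identity.
\<close>

lemma T_refl:
  assumes i: "i \<in> I" and Y: "Y \<in> Obj (V i)" and B: "B \<in> gob (b i) Y"
  shows "gf_ob (T i i) ((Y, Y), B) = B"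
proof -
  have P: "(Y, Y) \<in> Obj (Dbl i i)" using Y by (simp add: dbl_sel)
  have iso: "iso_arr (Map' R (Dbl i i)) (b1 i i, T i i, b2 i i)"
    using descent_dataD(5)[OF datum i i] by (simp add: theta_eq(1)[OF i i])
  have TB: "gf_ob (T i i) ((Y, Y), B) \<in> gob (b i) Y" by (rule T_ob) (use assms in simp_all)
  show ?thesis
    by (rule Map'_iso_inj(1)[OF iso P])
      (use P B TB T_trans[OF i i i Y Y Y _ _ B] in \<open>simp_all add: pr_apply\<close>)
qed

lemma T_hom_refl:
  assumes i: "i \<in> I" and v: "v \<in> Arr (V i)" and B: "B \<in> gob (b i) (Dom (V i) v)" "B' \<in> gob (b i) (Cod (V
      i) v)"
    and x: "x \<in> carrier (ghom (b i) (v, B, B'))"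
  shows "gf_hom (T i i) ((v, v), B, B') x = x"
proof -
  have P: "(v, v) \<in> Arr (Dbl i i)" "(Dom (V i) v, Dom (V i) v) \<in> Obj (Dbl i i)"
    "(Cod (V i) v, Cod (V i) v) \<in> Obj (Dbl i i)" using v i by (simp_all add: dbl_sel)
  have iso: "iso_arr (Map' R (Dbl i i)) (b1 i i, T i i, b2 i i)"
    using descent_dataD(5)[OF datum i i] by (simp add: theta_eq(1)[OF i i])
  have TB: "gf_ob (T i i) ((Dom (V i) v, Dom (V i) v), B) =
      B" "gf_ob (T i i) ((Cod (V i) v, Cod (V i) v), B') = B'"
    using T_refl i v B by simp_all
  have Tx: "gf_hom (T i i) ((v, v), B, B') x \<in> carrier (ghom (b i) (v, B, B'))"
    using T_hom[OF i i v v _ B x] by (simp add: TB)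
  show ?thesis
    by (rule Map'_iso_inj(2)[OF iso P(1), of B B'])
      (use i P B x TB Tx T_hom_trans[OF i i i v v v _ _ B x] in \<open>simp_all add: pr_apply dbl_sel(3,4)\<close>)
qed

definition t :: "'i \<times> 'vo \<Rightarrow> 'i \<times> 'vo \<Rightarrow> 'x \<Rightarrow> 'x" where
  "t = (\<lambda>(i, Y) (j, Z) B. gf_ob (T i j) ((Y, Z), B))"

definition s :: "'i \<times> 'va \<Rightarrow> 'i \<times> 'va \<Rightarrow> 'x \<Rightarrow> 'x \<Rightarrow> 'm \<Rightarrow> 'm" where
  "s = (\<lambda>(i, v) (j, w) B B'. gf_hom (T i j) ((v, w), B, B'))"

lemma t_s_apply [simp]:
  "t (i, Y) (j, Z) B = gf_ob (T i j) ((Y, Z), B)" "s (i, v) (j, w) B B' = gf_hom (T i j) ((v, w), B, B')"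
  by (simp_all add: t_def s_def)

lemma transport_gluing:
  "gluing R (coprod I V) U (copair I V \<phi>) (coprod_gcat I V b) t s"
proof (intro gluing.intro gluing_axioms.intro, goal_cases)
  case 1 show ?case by (rule copair_functor) simp_all
next
  case 2 show ?case by (rule coprod_gcat_graded) (simp_all add: R)
next
  case (3 u u' u'')
  then obtain i v v' v'' where v: "i \<in> I" "v \<in> Arr (V i)" "v' \<in> Arr (V i)" "v'' \<in> Arr (V i)"
    "Dom (V i) v' = Cod (V i) v" "Dom (V i) v'' = Cod (V i) v'"
    "farr (\<phi> i) v = u" "farr (\<phi> i) v' = u'" "farr (\<phi> i) v'' = u''"
    using lift3[of u u' u''] by blast
  then show ?case
    by (intro bexI[of _ "(i, v)"] bexI[of _ "(i, v')"] bexI[of _ "(i, v'')"]) simp_all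
next
  case (4 p q B)
  then show ?case by (cases p; cases q) (simp add: T_ob)
next
  case (5 p q r B)
  then show ?case by (cases p; cases q; cases r) (simp add: T_trans)
next
  case (6 p B)
  then show ?case by (cases p) (simp add: T_refl)
next
  case (7 e f B B')
  obtain i v j w where ef: "e = (i, v)" "f = (j, w)" by (cases e; cases f)
  with 7 have "i \<in> I" "j \<in> I" "v \<in> Arr (V i)" "w \<in> Arr (V j)" "farr (\<phi> i) v = farr (\<phi> j) w" by simp_all
  then show ?case
    using 7 T_linear[of i j v w B B'] over_eq[of i j v w] by (simp add: ef T_ob)
next
  case (8 e f g B B' x)
  then show ?case by (cases e; cases f; cases g) (simp add: T_hom_trans)
next
  case (9 e B B' x)
  then show ?case by (cases e) (simp add: T_hom_refl)
next
  case (10 p q B)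
  then show ?case by (cases p; cases q) (simp add: T_gid T_ob)
next
  case (11 e e' f f' B B' B'' x y)
  obtain i v i' v' j w j' w' where ef: "e = (i, v)" "e' = (i', v')" "f = (j, w)" "f' = (j', w')"
    by (cases e; cases e'; cases f; cases f')
  with 11 have [simp]: "i' = i" "j' = j" by simp_all
  have A: "i \<in> I" "j \<in> I" "v \<in> Arr (V i)" "w \<in> Arr (V j)" "farr (\<phi> i) v = farr (\<phi> j) w"
    "v' \<in> Arr (V i)" "w' \<in> Arr (V j)" "farr (\<phi> i) v' = farr (\<phi> j) w'"
    "Dom (V i) v' = Cod (V i) v" "Dom (V j) w' = Cod (V j) w"
    "B \<in> gob (b i) (Dom (V i) v)" "B' \<in> gob (b i) (Cod (V i) v)" "B'' \<in> gob (b i) (Cod (V i) v')"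
    using 11 by (simp_all add: ef)
  moreover have "x \<in> carrier (ghom (b i) (v, B, B'))" "y \<in> carrier (ghom (b i) (v', B', B''))"
    using 11 A by (simp_all add: ef)
  ultimately show ?case
    using over_eq[of i j v w] over_eq[of i j v' w'] by (simp add: ef T_gcomp T_ob)
qed

text \<open>
  Glue over the disjoint union, and restrict the isomorphism between the restriction of the glued
  category and \<open>b\<close> to each \<open>V i\<close>. The restrictions are isomorphisms by functoriality, and on the
  double fibre products \<open>glued_iso_compat\<close> says that they form a morphism of descent data.
\<close>

theorem essentially_surjective:
  obtains a f where "graded_category R U a" "(canon a, f, (b, \<theta>)) \<in> Arr (Des R I V \<phi>)"
    "iso_arr (Des R I V \<phi>) (canon a, f, (b, \<theta>))"
proof -
  let ?C = "coprod I V" and ?\<pi> = "copair I V \<phi>" and ?b = "coprod_gcat I V b"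
  interpret g: gluing R ?C U ?\<pi> ?b t s by (rule transport_gluing)
  let ?a = "g.glued"
  let ?pa = "pull ?C ?\<pi> ?a"
  have a: "graded_category R U ?a" by (rule g.glued_graded)
  have \<pi>: "cat_functor ?C U ?\<pi>" by (rule g.\<pi>.cat_functor_axioms)
  have incl: "cat_functor (V i) ?C (incl V i)" if "i \<in> I" for i
    by (rule incl_functor) (use that in simp_all)
  have comp_incl: "comp_func (V i) ?\<pi> (incl V i) = \<phi> i" if "i \<in> I" for i
    by (rule cat_functor_eqI[OF comp_func_functor[OF incl[OF that] \<pi>] \<phi>[OF that]]) (use that in simp_all)
  have pull_pa: "pull (V i) (incl V i) ?pa = pull (V i) (\<phi> i) ?a" if "i \<in> I" for i
    by (simp add: pull_pull[OF \<pi> incl[OF that] a] comp_incl[OF that])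
  have pull_b: "pull (V i) (incl V i) ?b = b i" if "i \<in> I" for i
    by (rule pull_incl[where R = R]) (use R that in simp_all)
  have Psi: "Psi g.glued_iso = id_func ?C" by (simp add: g.glued_iso_def)
  define F where "F i = res_gfun (V i) (incl V i) ?pa g.glued_iso" for i
  have F: "graded_functor R (V i) (pull (V i) (\<phi> i) ?a) (V i) (b i) (F i)" if "i \<in> I" for i
    using res_gfun_graded[OF incl[OF that] g.glued_iso_graded Psi] that by (simp add: F_def pull_pa pull_b)
  have Psi_F: "Psi (F i) = id_func (V i)" if "i \<in> I" for i
    using that by (simp add: F_def)
  have F_ob: "gf_ob (F i) (Y, A) = gf_ob g.glued_iso ((i, Y), A)"
    if "i \<in> I" "Y \<in> Obj (V i)" "A \<in> gob ?a (fob (\<phi> i) Y)" for i Y A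
    using that by (simp add: F_def)
  have F_hom: "gf_hom (F i) (v, A, A') x = gf_hom g.glued_iso ((i, v), A, A') x"
    if "i \<in> I" "v \<in> Arr (V i)" "A \<in> gob ?a (fob (\<phi> i) (Dom (V i) v))" "A' \<in> gob ?a (fob (\<phi> i) (Cod (V i) v))"
      "x \<in> carrier (ghom ?a (farr (\<phi> i) v, A, A'))" for i v A A' x
    using that res_gfun_apply(3)[of "V i" v A ?pa "incl V i" A' x g.glued_iso]
      pull_apply(1)[OF g.\<pi>.C.category_axioms, of "(i, v)" A ?a ?\<pi> A']
    by (simp add: F_def)
  define f where "f = (\<lambda>i\<in>I. (pull (V i) (\<phi> i) ?a, F i, b i))"
  have f_eq: "f i = (pull (V i) (\<phi> i) ?a, F i, b i)" if "i \<in> I" for i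
    using that by (simp add: f_def)
  have f_iso: "iso_arr (Map' R (V i)) (f i)" if "i \<in> I" for i
    using functor_iso[OF Map'_functor_functor[OF incl[OF that]] g.glued_iso_iso] that
    by (simp add: Map'_functor_arr[OF incl[OF that] g.glued_iso_graded Psi] pull_pa pull_b f_eq F_def)
  have compat: "Cmp (Map' R (Dbl i j)) (\<theta> (i, j)) (farr (res1 i j) (f i)) =
      Cmp (Map' R (Dbl i j)) (farr (res2 i j) (f j)) (snd (canon ?a) (i, j))"
    if ij: "i \<in> I" "j \<in> I" for i j
  proof -
    let ?P = "Dbl i j"
    let ?p = "comp_func ?P (\<phi> i) (pr1 ?P)"
    let ?c = "pull ?P ?p ?a"
    have c1: "pull ?P (pr1 ?P) (pull (V i) (\<phi> i) ?a) = ?c" by (rule pull_pull[OF \<phi>[OF ij(1)] dbl(2)[OF ij] a])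
    have c2: "pull ?P (pr2 ?P) (pull (V j) (\<phi> j) ?a) = ?c"
      by (simp add: pull_pull[OF \<phi>[OF ij(2)] dbl(3)[OF ij] a] dbl_square[OF ij])
    note r1 = res_gfun_graded[OF dbl(2)[OF ij] F[OF ij(1)] Psi_F[OF ij(1)], unfolded c1]
    note r2 = res_gfun_graded[OF dbl(3)[OF ij] F[OF ij(2)] Psi_F[OF ij(2)], unfolded c2]
    have "comp_gfun ?P ?c (T i j) (res_gfun ?P (pr1 ?P) (pull (V i) (\<phi> i) ?a) (F i)) =
        res_gfun ?P (pr2 ?P) (pull (V j) (\<phi> j) ?a) (F j)"
    proof (rule gfun_eqI[OF comp_gfun_graded[OF r1 theta_eq(2)[OF ij]] r2])
      show "Psi (comp_gfun ?P ?c (T i j) (res_gfun ?P (pr1 ?P) (pull (V i) (\<phi> i) ?a) (F i))) =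
          Psi (res_gfun ?P (pr2 ?P) (pull (V j) (\<phi> j) ?a) (F j))"
        using ij by (simp add: theta_eq(3)[OF ij] comp_func_id_left[OF id_func_functor])
    next
      fix p A assume p: "p \<in> Obj ?P" "A \<in> gob ?c p"
      obtain Y Z where pYZ: "p = (Y, Z)" by (cases p)
      have Y: "Y \<in> Obj (V i)" "Z \<in> Obj (V j)" "fob (\<phi> i) Y = fob (\<phi> j) Z" using p
          by (simp_all add: pYZ dbl_sel)
      have A: "A \<in> gob ?a (fob (\<phi> i) Y)" using p by (simp add: pYZ pr_apply)
      show "gf_ob (comp_gfun ?P ?c (T i j) (res_gfun ?P (pr1 ?P) (pull (V i) (\<phi> i) ?a) (F i))) (p, A) =
          gf_ob (res_gfun ?P (pr2 ?P) (pull (V j) (\<phi> j) ?a) (F j)) (p, A)"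
        using p ij Y A g.glued_iso_compat(1)[of "(i, Y)" "(j, Z)" A]
        by (simp add: pYZ pr_apply F_ob)
    next
      fix e A A' x assume e: "e \<in> Arr ?P" "A \<in> gob ?c (Dom ?P e)" "A' \<in> gob ?c (Cod ?P e)" "x \<in> carrier
          (ghom ?c (e, A, A'))"
      obtain v w where evw: "e = (v, w)" by (cases e)
      have v: "v \<in> Arr (V i)" "w \<in> Arr (V j)" "farr (\<phi> i) v = farr (\<phi> j) w" using e
          by (simp_all add: evw dbl_sel)
      have Q: "(Dom (V i) v, Dom (V j) w) \<in> Obj ?P" "(Cod (V i) v, Cod (V j) w) \<in> Obj ?P"
        using v ij over_eq[OF ij v] by (simp_all add: dbl_sel)
      have A: "A \<in> gob ?a (fob (\<phi> i) (Dom (V i) v))" "A' \<in> gob ?a (fob (\<phi> i) (Cod (V i) v))"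
        using e Q ij v by (simp_all add: evw pr_apply dbl_sel(3,4))
      have x: "x \<in> carrier (ghom ?a (farr (\<phi> i) v, A, A'))"
        using e Q ij v A by (simp add: evw pr_apply dbl_sel(3,4))
      show "gf_hom (comp_gfun ?P ?c (T i j) (res_gfun ?P (pr1 ?P) (pull (V i) (\<phi> i) ?a) (F i))) (e, A, A') x =
          gf_hom (res_gfun ?P (pr2 ?P) (pull (V j) (\<phi> j) ?a) (F j)) (e, A, A') x"
        using e ij v Q A x over_eq[OF ij v] g.glued_iso_compat(2)[of "(i, v)" "(j, w)" A A' x]
        by (simp add: evw pr_apply dbl_sel(3,4) F_ob F_hom)
    qed
    moreover have "comp_gfun ?P ?c (res_gfun ?P (pr2 ?P) (pull (V j) (\<phi> j) ?a) (F j)) (id_gfun ?P ?c) =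
        res_gfun ?P (pr2 ?P) (pull (V j) (\<phi> j) ?a) (F j)"
      by (rule comp_gfun_id_right[OF r2])
    ultimately show ?thesis
      using ij a
      by (simp add: f_eq theta_eq(1) Map'_functor_arr[OF dbl(2)[OF ij] F[OF ij(1)] Psi_F[OF ij(1)]]
          Map'_functor_arr[OF dbl(3)[OF ij] F[OF ij(2)] Psi_F[OF ij(2)]] Map'_sel c1 c2)
  qed
  have D: "(canon ?a, f, (b, \<theta>)) \<in> Arr (Des R I V \<phi>)"
    using compat a datum canonical_datum_descent_data[OF a] F Psi_F
    by (simp add: Des_sel descent_arrows_iff f_eq Map'_sel) (simp add: f_def)
  show thesis
    by (rule that[OF a D Des_iso[OF D f_iso]])
qed

end

theorem corollary2p40:
  fixes R :: "('k, 'r) ring_scheme" and n :: enat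
  assumes "cring R"
  shows
    \<comment> \<open>the chosen morphisms over \<open>\<phi>\<close> are cartesian\<close>
    "(\<forall>(U :: ('uo, 'ua) cat) (V :: ('vo, 'va) cat) (W :: ('wo, 'wa) cat) \<phi>
        (a :: ('uo, 'ua, 'x, 'k, 'm) gcat) (c :: ('wo, 'wa, 'x, 'k, 'm) gcat).
        cat_functor V U \<phi> \<and> graded_category R U a \<and> graded_category R W c \<longrightarrow>
          graded_functor R V (pull V \<phi> a) U a (delta V \<phi> a) \<and>
          cartesian_wrt R W c V (pull V \<phi> a) U a (delta V \<phi> a)) \<and>
    \<comment> \<open>the associated pseudofunctor is a functor\<close>
     (\<forall>U :: ('uo, 'ua) cat. category U \<longrightarrow>
        category (Map' R U :: (('uo, 'ua, 'x, 'k, 'm) gcat, _) cat) \<and>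
        (Map'_functor R U U (id_func U) :: (('uo, 'ua, 'x, 'k, 'm) gcat, _, _, _) func) =
          id_func (Map' R U) \<and>
        (\<forall>a :: ('uo, 'ua, 'x, 'k, 'm) gcat. a \<in> Obj (Map' R U) \<longrightarrow>
          unit_coherence R U a = Ident (Map' R U) a)) \<and>
     (\<forall>(U :: ('uo, 'ua) cat) (V :: ('vo, 'va) cat) \<phi>. cat_functor V U \<phi> \<longrightarrow>
        cat_functor (Map' R U) (Map' R V)
          (Map'_functor R V U \<phi> :: (('uo, 'ua, 'x, 'k, 'm) gcat, _, _, _) func)) \<and>
     (\<forall>(U :: ('uo, 'ua) cat) (V :: ('vo, 'va) cat) (W :: ('wo, 'wa) cat) \<phi> \<psi>.
        cat_functor V U \<phi> \<and> cat_functor W V \<psi> \<longrightarrow>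
          (Map'_functor R W U (comp_func W \<phi> \<psi>) :: (('uo, 'ua, 'x, 'k, 'm) gcat, _, _, _) func) =
            comp_func (Map' R U) (Map'_functor R W V \<psi>) (Map'_functor R V U \<phi>) \<and>
          (\<forall>a :: ('uo, 'ua, 'x, 'k, 'm) gcat. a \<in> Obj (Map' R U) \<longrightarrow>
            comp_coherence R W V \<phi> \<psi> a =
              Ident (Map' R W) (fob (Map'_functor R W U (comp_func W \<phi> \<psi>)) a))) \<and>
    \<comment> \<open>prestack\<close>
     (2 \<le> n \<longrightarrow>
       (\<forall>(I :: 'i set) (V :: 'i \<Rightarrow> ('vo, 'va) cat) \<phi> (U :: ('uo, 'ua) cat). n_cover n I V \<phi> U \<longrightarrow>
         fully_faithful (Map' R U) (Des R I V \<phi>)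
           (comparison R I V \<phi> U :: (('uo, 'ua, 'x, 'k, 'm) gcat, _, _, _) func))) \<and>
    \<comment> \<open>stack\<close>
     (3 \<le> n \<longrightarrow>
       (\<forall>(I :: 'i set) (V :: 'i \<Rightarrow> ('vo, 'va) cat) \<phi> (U :: ('uo, 'ua) cat). n_cover n I V \<phi> U \<longrightarrow>
         cat_equivalence (Map' R U) (Des R I V \<phi>)
           (comparison R I V \<phi> U :: (('uo, 'ua, 'x, 'k, 'm) gcat, _, _, _) func)))"
proof (intro conjI allI impI; (elim conjE)?)
  fix U :: "('uo, 'ua) cat" and V :: "('vo, 'va) cat" and W :: "('wo, 'wa) cat" and \<phi>
    and a :: "('uo, 'ua, 'x, 'k, 'm) gcat" and c :: "('wo, 'wa, 'x, 'k, 'm) gcat"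
  assume "cat_functor V U \<phi>" "graded_category R U a"
  then show "graded_functor R V (pull V \<phi> a) U a (delta V \<phi> a)"
    and "cartesian_wrt R W c V (pull V \<phi> a) U a (delta V \<phi> a)"
    by (rule delta_graded, intro delta_cartesian)
next
  fix U :: "('uo, 'ua) cat" assume U: "category U"
  show "category (Map' R U :: (('uo, 'ua, 'x, 'k, 'm) gcat, _) cat)" by (rule Map'_category[OF U])
  show "(Map'_functor R U U (id_func U) :: (('uo, 'ua, 'x, 'k, 'm) gcat, _, _, _) func) = id_func (Map' R U)"
    by (rule Map'_functor_id[OF U])
next
  fix U :: "('uo, 'ua) cat" and a :: "('uo, 'ua, 'x, 'k, 'm) gcat" assume "a \<in> Obj (Map' R U)"
  then show "unit_coherence R U a = Ident (Map' R U) a"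
    by (intro unit_coherence_eq_Ident) (simp add: Map'_sel)
next
  fix U :: "('uo, 'ua) cat" and V :: "('vo, 'va) cat" and \<phi> assume "cat_functor V U \<phi>"
  then show "cat_functor (Map' R U) (Map' R V) (Map'_functor R V U \<phi> :: (('uo, 'ua, 'x, 'k, 'm) gcat, _, _, _) func)"
    by (rule Map'_functor_functor)
next
  fix U :: "('uo, 'ua) cat" and V :: "('vo, 'va) cat" and W :: "('wo, 'wa) cat" and \<phi> \<psi>
  assume \<phi>: "cat_functor V U \<phi>" and \<psi>: "cat_functor W V \<psi>"
  then show "(Map'_functor R W U (comp_func W \<phi> \<psi>) :: (('uo, 'ua, 'x, 'k, 'm) gcat, _, _, _) func) =
      comp_func (Map' R U) (Map'_functor R W V \<psi>) (Map'_functor R V U \<phi>)"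
    by (rule Map'_functor_comp)
  show "comp_coherence R W V \<phi> \<psi> a = Ident (Map' R W) (fob (Map'_functor R W U (comp_func W \<phi> \<psi>)) a)"
    if "a \<in> Obj (Map' R U)" for a :: "('uo, 'ua, 'x, 'k, 'm) gcat"
    using that by (simp add: Map'_sel comp_coherence_eq_Ident[OF \<phi> \<psi>])
next
  fix I :: "'i set" and V :: "'i \<Rightarrow> ('vo, 'va) cat" and \<phi> and U :: "('uo, 'ua) cat"
  assume "2 \<le> n" "n_cover n I V \<phi> U"
  then interpret pair_lifting_family R I V \<phi> U by (intro n_cover_pair_lifting)
  show "fully_faithful (Map' R U) (Des R I V \<phi>)
      (comparison R I V \<phi> U :: (('uo, 'ua, 'x, 'k, 'm) gcat, _, _, _) func)"
    by (rule comparison_fully_faithful)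
next
  fix I :: "'i set" and V :: "'i \<Rightarrow> ('vo, 'va) cat" and \<phi> and U :: "('uo, 'ua) cat"
  assume n: "3 \<le> n" and cov: "n_cover n I V \<phi> U"
  have "2 \<le> n" using n by (rule order_trans[rotated]) (simp add: numeral_eq_enat)
  with cov interpret pair_lifting_family R I V \<phi> U by (intro n_cover_pair_lifting)
  let ?K = "comparison R I V \<phi> U :: (('uo, 'ua, 'x, 'k, 'm) gcat, _, _, _) func"
  show "cat_equivalence (Map' R U) (Des R I V \<phi>) ?K"
  proof (rule fully_faithful_essentially_surjective_equivalence[OF comparison_fully_faithful])
    fix X :: "('i, 'vo, 'va, 'x, 'k, 'm) descent_datum"
    assume "X \<in> Obj (Des R I V \<phi>)"
    then obtain b \<theta> where X: "X = (b, \<theta>)" and datum: "(b, \<theta>) \<in> descent_data R I V \<phi>"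
      by (cases X) (simp add: Des_sel)
    have lift3: "\<exists>i\<in>I. \<exists>v\<in>Arr (V i). \<exists>v'\<in>Arr (V i). \<exists>v''\<in>Arr (V i).
        Dom (V i) v' = Cod (V i) v \<and> Dom (V i) v'' = Cod (V i) v' \<and>
        farr (\<phi> i) v = u \<and> farr (\<phi> i) v' = u' \<and> farr (\<phi> i) v'' = u''"
      if "u \<in> Arr U" "u' \<in> Arr U" "u'' \<in> Arr U" "Dom U u' = Cod U u" "Dom U u'' = Cod U u'" for u u' u''
      using n_cover_lift3[OF cov n that] by metis
    interpret descent R I V \<phi> U b \<theta>
      by (intro descent.intro covering_family_axioms descent_axioms.intro assms datum lift3)
    obtain a f where a: "graded_category R U a"
      and f: "(canonical_datum R I V \<phi> U a, f, (b, \<theta>)) \<in> Arr (Des R I V \<phi>)"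
        "iso_arr (Des R I V \<phi>) (canonical_datum R I V \<phi> U a, f, (b, \<theta>))"
      by (rule essentially_surjective)
    have "fob ?K a = canonical_datum R I V \<phi> U a" using a by (simp add: comparison_def Map'_sel)
    then show "\<exists>a\<in>Obj (Map' R U). \<exists>f\<in>arrows (Des R I V \<phi>) (fob ?K a) X. iso_arr (Des R I V \<phi>) f"
      using a f
      by (intro bexI[of _ a] bexI[of _ "(canonical_datum R I V \<phi> U a, f, (b, \<theta>))"])
        (simp_all add: X arrows_def Des_sel Map'_sel)
  qed
qed

end
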